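(* Let $k$ be a field, and let $H_1,H_2,\dots,H_n$ be $d$-graphs on the same finite vertex set $W$. For each $i=1,\dots,n$ assume that there is a cellular resolution of $I_{H_i}\subseteq S=k[x_w:w\in W]$ supported by a polyhedral complex $X_i$ whose vertices are labeled by squarefree monomials via $\ell_i$, and whose higher-dimensional cells are labeled (also via $\ell_i$) by the least common multiple of the labels of their vertices. Let $H=H_1\cup H_2\cup\cdots\cup H_n$, let $X=X_1\ast X_2\ast\cdots\ast X_n$, and label the cells of $X$ by $$\ell(\sigma_1\ast\sigma_2\ast\cdots\ast\sigma_n)=\mathrm{lcm}\bigl(\ell_1(\sigma_1),\ell_2(\sigma_2),\dots,\ell_n(\sigma_n)\bigr).$$ Then the complex $X$ with labels $\ell$ supports a cellular resolution of $I_H$.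
   Context: A $d$-graph $H$ on a finite vertex set $W\subseteq\mathbb{Z}$ is a set $E(H)$ of $d$-element subsets of $W$ (edges). $H_1\cup\cdots\cup H_n$ is the $d$-graph on $W$ with edge set $E(H_1)\cup\cdots\cup E(H_n)$. The edge ideal is $I_H=\langle\prod_{v\in e}x_v: e\in E(H)\rangle\subseteq S$. Here $\ast$ denotes the join of polyhedral complexes: cells of $X_1\ast\cdots\ast X_n$ are the joins $\sigma_1\ast\cdots\ast\sigma_n$ with each $\sigma_i$ a (possibly empty) cell of $X_i$, and the empty cell has label $1$. Cellular resolutions: for an oriented polyhedral complex $X$ whose vertices carry monomial labels and each of whose faces $F$ carries the lcm $\ell(F)$ of its vertex labels, $\mathcal{F}_X$ is the complex of free $S$-modules having one generator $e_F$ of multidegree $\ell(F)$ in homological degree $\dim F$ for each nonempty face $F$, with $\partial e_F=\sum_{G}\pm\frac{\ell(F)}{\ell(G)}e_G$, the sum being over facets $G$ of $F$, with signs from the cellular boundary map. $X$ supports a cellular resolution of a monomial ideal $I$ if $\mathcal{F}_X$ together with the augmentation $e_v\mapsto\ell(v)$ is a (not necessarily minimal) free resolution of $I$; in particular $I$ is generated by the vertex labels. *)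

theory Defs
  imports
    "HOL-Analysis.Analysis"
    "HOL-Library.Poly_Mapping"
    "HOL-Algebra.Ideal"
    "Jordan_Normal_Form.Determinant"
begin

section \<open>Monomials, the polynomial ring and edge ideals\<close>

text \<open>A monomial in the variables \<open>x\<^sub>v\<close>, \<open>v\<close> an integer, is represented by its exponent vector,
  so that the unit monomial is \<open>0\<close> and multiplication (exact division) of monomials is addition
  (subtraction) of exponents.\<close>

type_synonym monomial = "int \<Rightarrow>\<^sub>0 nat"
type_synonym 'k mpol = "monomial \<Rightarrow>\<^sub>0 'k"

definition monomial_poly :: "monomial \<Rightarrow> 'k::field mpol" where
  "monomial_poly m = Poly_Mapping.single m 1"

definition var :: "int \<Rightarrow> 'k::field mpol" where
  "var v = monomial_poly (Poly_Mapping.single v 1)"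

definition squarefree_monomial :: "monomial \<Rightarrow> bool" where
  "squarefree_monomial m \<longleftrightarrow> (\<forall>v. Poly_Mapping.lookup m v \<le> 1)"

text \<open>The lcm of a finite set of monomials; the lcm of the empty set is the unit monomial.\<close>

definition lcm_monomial :: "monomial set \<Rightarrow> monomial" where
  "lcm_monomial M =
     (\<Sum>v \<in> (\<Union>m\<in>M. Poly_Mapping.keys m).
        Poly_Mapping.single v (Max ((\<lambda>m. Poly_Mapping.lookup m v) ` M)))"

lemma lookup_lcm_monomial:
  assumes "finite M"
  shows "Poly_Mapping.lookup (lcm_monomial M) v = Max (insert 0 ((\<lambda>m. Poly_Mapping.lookup m v) ` M))"
proof -
  let ?K = "\<Union>m\<in>M. Poly_Mapping.keys m"
  let ?x = "Max ((\<lambda>m. Poly_Mapping.lookup m v) ` M)"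
  have fin: "finite ?K" using assms by auto
  have "Poly_Mapping.lookup (lcm_monomial M) v = (if v \<in> ?K then ?x else 0)"
    unfolding lcm_monomial_def lookup_sum lookup_single when_def
    using fin by (simp add: sum.delta)
  also have "\<dots> = Max (insert 0 ((\<lambda>m. Poly_Mapping.lookup m v) ` M))"
  proof (cases "v \<in> ?K")
    case True
    then show ?thesis using assms by (subst Max_insert) auto
  next
    case False
    then have "insert 0 ((\<lambda>m. Poly_Mapping.lookup m v) ` M) = {0}" by (auto simp: in_keys_iff)
    then show ?thesis using False by (simp only: if_False Max_singleton)
  qed
  finally show ?thesis .
qed

text \<open>The ring \<open>k[x\<^sub>w : w \<in> W]\<close>, as a subring of the type of polynomials in all \<open>x\<^sub>v\<close>.\<close>

definition polyring :: "int set \<Rightarrow> ('k::field mpol) ring" where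
  "polyring W =
     \<lparr>carrier = {p. \<forall>m \<in> Poly_Mapping.keys p. Poly_Mapping.keys m \<subseteq> W},
      monoid.mult = (*), one = 1, zero = 0, add = (+)\<rparr>"

definition d_graph :: "nat \<Rightarrow> int set \<Rightarrow> int set set \<Rightarrow> bool" where
  "d_graph d W E \<longleftrightarrow> (\<forall>e \<in> E. e \<subseteq> W \<and> card e = d)"

definition edge_ideal :: "int set \<Rightarrow> int set set \<Rightarrow> 'k::field mpol set" where
  "edge_ideal W E = Idl\<^bsub>polyring W\<^esub> {\<Prod>v\<in>e. var v | e. e \<in> E}"


section \<open>Polyhedral complexes, orientations and joins\<close>

text \<open>The empty set is a cell of every complex; the complex without nonempty cells is \<open>{{}}\<close>.\<close>

definition polyhedral_complex :: "'a::euclidean_space set set \<Rightarrow> bool" where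
  "polyhedral_complex X \<longleftrightarrow>
     finite X \<and> {} \<in> X \<and>
     (\<forall>P\<in>X. polytope P) \<and>
     (\<forall>P\<in>X. \<forall>F. F face_of P \<longrightarrow> F \<in> X) \<and>
     (\<forall>P\<in>X. \<forall>Q\<in>X. P \<inter> Q face_of P \<and> P \<inter> Q face_of Q)"

text \<open>An orientation of a nonempty cell is given by an ordered basis of the linear space parallel to
  its affine hull. A vertex gets the empty basis, i.e. the standard (positive) orientation.\<close>

definition orientation :: "'a::euclidean_space set set \<Rightarrow> ('a set \<Rightarrow> 'a list) \<Rightarrow> bool" where
  "orientation X ori \<longleftrightarrow>
     (\<forall>F\<in>X. F \<noteq> {} \<longrightarrow>
        distinct (ori F) \<and> independent (set (ori F)) \<and>
        span (set (ori F)) = span {x - y | x y. x \<in> F \<and> y \<in> F})"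

lemma orientation_exists: "\<exists>ori. orientation X ori"
proof -
  have "\<exists>bs. distinct bs \<and> independent (set bs) \<and>
        span (set bs) = span {x - y | x y. x \<in> F \<and> y \<in> F}" for F :: "'a set"
  proof -
    obtain B where B: "independent B" "span B = span {x - y | x y. x \<in> F \<and> y \<in> F}"
      using real_vector.basis_exists
      by (metis (no_types, lifting) span_eq span_superset subset_trans)
    then have "finite B" using independent_imp_finite by blast
    then obtain bs where "set bs = B" "distinct bs" using finite_distinct_list by blast
    then show ?thesis using B by auto
  qed
  then show ?thesis unfolding orientation_def by metis
qed

text \<open>Determinant of the vectors \<open>vs\<close> with respect to the ordered basis \<open>bs\<close>.\<close>

definition basis_det :: "'a::euclidean_space list \<Rightarrow> 'a list \<Rightarrow> real" where
  "basis_det bs vs =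
     Determinant.det (Matrix.mat (length bs) (length bs)
       (\<lambda>(i, j). representation (set bs) (vs ! i) (bs ! j)))"

text \<open>The coefficient of a facet \<open>G\<close> of \<open>F\<close> in the cellular boundary of \<open>F\<close>: it is \<open>1\<close> if the
  orientation of \<open>G\<close> is the boundary orientation induced by \<open>F\<close> (a vector pointing out of \<open>F\<close> across
  \<open>G\<close>, followed by the basis of \<open>G\<close>, is a positive basis for \<open>F\<close>) and \<open>-1\<close> otherwise.
  By convexity, every difference of a point of \<open>G\<close> and a point of \<open>F - G\<close> points out of \<open>F\<close>,
  and the sign does not depend on the points chosen.\<close>

definition incidence :: "('a::euclidean_space set \<Rightarrow> 'a list) \<Rightarrow> 'a set \<Rightarrow> 'a set \<Rightarrow> int" where
  "incidence ori F G =
     (let w = (SOME y. y \<in> G) - (SOME x. x \<in> F - G)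
      in if basis_det (ori F) (w # ori G) > 0 then 1 else - 1)"

text \<open>The join of cells \<open>\<sigma>\<^sub>i\<close>: the cells are put at height \<open>1\<close> in the direct summands of a Euclidean space
  (so their affine hulls are in general position), and the convex hull of their union is taken.\<close>

definition join_embed :: "'n::finite \<Rightarrow> 'a::euclidean_space \<Rightarrow> ('a \<times> real) ^ 'n" where
  "join_embed i x = axis i (x, 1)"

definition join_cell :: "('n::finite \<Rightarrow> 'a::euclidean_space set) \<Rightarrow> (('a \<times> real) ^ 'n) set" where
  "join_cell \<sigma> = convex hull (\<Union>i. join_embed i ` \<sigma> i)"

definition join_complex ::
    "('n::finite \<Rightarrow> 'a::euclidean_space set set) \<Rightarrow> (('a \<times> real) ^ 'n) set set" where
  "join_complex X = {join_cell \<sigma> | \<sigma>. \<forall>i. \<sigma> i \<in> X i}"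

text \<open>The cells \<open>\<sigma>\<^sub>i\<close> are determined by their join; hence a labelling of the join may be prescribed
  in terms of the \<open>\<sigma>\<^sub>i\<close>.\<close>

lemma join_cell_vimage:
  fixes \<sigma> :: "'n::finite \<Rightarrow> 'a::euclidean_space set"
  assumes convex: "\<And>i. convex (\<sigma> i)"
  shows "join_embed i -` join_cell \<sigma> = \<sigma> i"
proof
  show "\<sigma> i \<subseteq> join_embed i -` join_cell \<sigma>"
    unfolding join_cell_def by (auto intro!: hull_inc)
  show "join_embed i -` join_cell \<sigma> \<subseteq> \<sigma> i"
  proof
    fix x assume x: "x \<in> join_embed i -` join_cell \<sigma>"
    define I where "I = {j. \<sigma> j \<noteq> {}}"
    have emb: "join_embed j = (\<lambda>x. axis j (x, 0) + axis j (0, 1))" for j :: 'n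
      by (rule ext) (simp add: join_embed_def axis_def Finite_Cartesian_Product.vec_eq_iff)
    have "convex (join_embed j ` \<sigma> j)" for j
    proof -
      have "linear (\<lambda>x :: 'a. axis j (x, 0 :: real) :: ('a \<times> real) ^ 'n)"
        by (rule linearI) (auto simp: axis_def Finite_Cartesian_Product.vec_eq_iff)
      then have "convex ((\<lambda>x. axis j (0, 1) + x) ` (\<lambda>x. axis j (x, 0 :: real)) ` \<sigma> j)"
        by (intro convex_translation convex_linear_image convex)
      then show ?thesis by (simp add: emb image_image add.commute)
    qed
    moreover have "join_cell \<sigma> = convex hull (\<Union>j\<in>I. join_embed j ` \<sigma> j)"
      unfolding join_cell_def I_def by (rule arg_cong[where f = "\<lambda>S. convex hull S"]) auto
    ultimately have "join_embed i x \<in> {\<Sum>j\<in>I. c j *\<^sub>R s j | c s.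
        (\<forall>j\<in>I. 0 \<le> c j) \<and> sum c I = 1 \<and> (\<forall>j\<in>I. s j \<in> join_embed j ` \<sigma> j)}"
      using x convex_hull_finite_union[of I "\<lambda>j. join_embed j ` \<sigma> j"]
      by (auto simp: I_def)
    then obtain c s where s: "\<And>j. j \<in> I \<Longrightarrow> s j \<in> join_embed j ` \<sigma> j"
      and eq: "join_embed i x = (\<Sum>j\<in>I. c j *\<^sub>R s j)"
      by blast
    then have "\<forall>j\<in>I. \<exists>y\<in>\<sigma> j. s j = join_embed j y" by blast
    then obtain y where y: "\<And>j. j \<in> I \<Longrightarrow> y j \<in> \<sigma> j \<and> s j = join_embed j (y j)" by metis
    have "(x, 1 :: real) = (\<Sum>j\<in>I. if i = j then c j *\<^sub>R (y j, 1) else 0)"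
      using arg_cong[OF eq, of "\<lambda>z. Finite_Cartesian_Product.vec_nth z i"] y
      by (auto simp: join_embed_def axis_def if_distrib split: if_splits cong: if_cong sum.cong)
    also have "\<dots> = (if i \<in> I then c i *\<^sub>R (y i, 1) else 0)" by simp
    finally show "x \<in> \<sigma> i" using y[of i] by (auto split: if_splits simp: zero_prod_def)
  qed
qed


section \<open>Cellular resolutions\<close>

text \<open>In particular the empty cell has the unit label.\<close>

definition labelled_complex ::
    "int set \<Rightarrow> 'a::euclidean_space set set \<Rightarrow> ('a set \<Rightarrow> monomial) \<Rightarrow> bool" where
  "labelled_complex W X l \<longleftrightarrow>
     (\<forall>v. {v} \<in> X \<longrightarrow> Poly_Mapping.keys (l {v}) \<subseteq> W) \<and>
     (\<forall>F\<in>X. l F = lcm_monomial {l {v} | v. {v} face_of F})"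

text \<open>The free module of homological degree \<open>d\<close>, with basis the \<open>d\<close>-dimensional cells: its elements
  are the coefficient functions \<open>c\<close>, standing for the sum of all \<open>c F * e\<^sub>F\<close>.\<close>

definition cell_chains ::
    "int set \<Rightarrow> 'a::euclidean_space set set \<Rightarrow> nat \<Rightarrow> ('a set \<Rightarrow> 'k::field mpol) set" where
  "cell_chains W X d =
     {c. (\<forall>F. c F \<in> carrier (polyring W)) \<and>
         (\<forall>F. c F \<noteq> 0 \<longrightarrow> F \<in> X \<and> F \<noteq> {} \<and> aff_dim F = int d)}"

text \<open>The linear map sending \<open>e\<^sub>F\<close> to the sum of \<open>incidence ori F G * (l F / l G) * e\<^sub>G\<close> over the
  facets \<open>G\<close> of \<open>F\<close>. (\<^const>\<open>facet_of\<close> excludes the empty facet of a vertex.)\<close>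

definition cell_boundary ::
    "'a::euclidean_space set set \<Rightarrow> ('a set \<Rightarrow> 'a list) \<Rightarrow> ('a set \<Rightarrow> monomial) \<Rightarrow>
     ('a set \<Rightarrow> 'k::field mpol) \<Rightarrow> 'a set \<Rightarrow> 'k mpol" where
  "cell_boundary X ori l c =
     (\<lambda>G. \<Sum>F | F \<in> X \<and> G facet_of F.
            of_int (incidence ori F G) * monomial_poly (l F - l G) * c F)"

definition cell_augmentation ::
    "'a::euclidean_space set set \<Rightarrow> ('a set \<Rightarrow> monomial) \<Rightarrow> ('a set \<Rightarrow> 'k::field mpol) \<Rightarrow> 'k mpol" where
  "cell_augmentation X l c =
     (\<Sum>F | F \<in> X \<and> aff_dim F = 0. monomial_poly (l F) * c F)"

text \<open>The oriented labelled complex \<open>X\<close> supports a cellular resolution of the ideal \<open>I\<close>: the sequence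
  \<open>\<dots> \<rightarrow> F\<^sub>2 \<rightarrow> F\<^sub>1 \<rightarrow> F\<^sub>0 \<rightarrow> I \<rightarrow> 0\<close> is exact.\<close>

definition supports_cellular_resolution ::
    "int set \<Rightarrow> 'k::field mpol set \<Rightarrow> 'a::euclidean_space set set \<Rightarrow> ('a set \<Rightarrow> 'a list) \<Rightarrow>
     ('a set \<Rightarrow> monomial) \<Rightarrow> bool" where
  "supports_cellular_resolution W I X ori l \<longleftrightarrow>
     polyhedral_complex X \<and> orientation X ori \<and> labelled_complex W X l \<and>
     cell_augmentation X l ` cell_chains W X 0 = I \<and>
     {c \<in> cell_chains W X 0. cell_augmentation X l c = (0 :: 'k mpol)} =
       cell_boundary X ori l ` cell_chains W X 1 \<and>
     (\<forall>d. {c \<in> cell_chains W X (Suc d). cell_boundary X ori l c = (\<lambda>G. 0 :: 'k mpol)} =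
       cell_boundary X ori l ` cell_chains W X (Suc (Suc d)))"

end

theory Submission
  imports Defs
begin

text \<open>In multidegree \<open>m\<close> the cellular complex of \<open>X\<close> is the augmented cellular chain complex, over the
  field, of the subcomplex of cells whose label divides \<open>m\<close>; hence \<open>X\<close> supports a resolution of the ideal
  generated by its vertex labels iff each such subcomplex is acyclic or has no vertices. Since labels of joins
  are lcms, the subcomplex of the join in degree \<open>m\<close> is the join of the subcomplexes of the factors.
  If none of these has a vertex, neither has the join. Otherwise one factor is acyclic, augmentation included, and the
  join is a double complex whose rows are copies of that factor, so that it is acyclic as well.\<close>

section \<open>Determinants with respect to a basis\<close>

text \<open>Orientations are arbitrary ordered bases and incidence numbers are signs of
  determinants. So independence of the points chosen, vanishing of the squared boundary, and the
  comparison of an unrelated orientation of the join with those of the factors all have to come from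
  linear algebra. Two things obstruct a direct argument: affine dimension is not additive under
  joins, and the empty cell, absent from the chain modules, must take part in the double complex.
  Placing cells at height 1 removes both. A cell then spans a linear space of dimension
  \<open>aff_dim F + 1\<close>, which is zero for the empty cell, and the space of a join is the
  direct sum of those of its factors. Exactness in the direction of a single factor is enough: a
  cycle is corrected row by row, in order of decreasing dimension of the join of the other factors,
  so no Kuenneth formula is involved. A resolution gives exactness only from degree 0 upwards. In
  degree -1, that of the empty cell, exactness amounts to the existence of a vertex, and this is why
  complexes without vertices are treated apart.\<close>

definition basis_list :: "'a::euclidean_space list \<Rightarrow> 'a set \<Rightarrow> bool" where
  "basis_list bs V \<longleftrightarrow> distinct bs \<and> independent (set bs) \<and> span (set bs) = V"

lemma basis_list_length: "basis_list bs V \<Longrightarrow> length bs = dim V"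
  unfolding basis_list_def by (metis dim_span_eq_card_independent distinct_card)

definition coord :: "'a::euclidean_space list \<Rightarrow> 'a \<Rightarrow> nat \<Rightarrow> real" where
  "coord bs v j = representation (set bs) v (bs ! j)"

lemma basis_det_coord:
  "basis_det bs vs = Determinant.det (Matrix.mat (length bs) (length bs) (\<lambda>(i, j). coord bs (vs ! i) j))"
  by (simp add: basis_det_def coord_def)

lemma coord_sum:
  assumes "basis_list bs V" "v \<in> V"
  shows "(\<Sum>j<length bs. coord bs v j *\<^sub>R bs ! j) = v"
proof -
  have "(\<Sum>b\<in>set bs. representation (set bs) v b *\<^sub>R b) = v"
    using assms unfolding basis_list_def by (intro real_vector.sum_representation_eq) auto
  also have "(\<Sum>b\<in>set bs. representation (set bs) v b *\<^sub>R b) = (\<Sum>j<length bs. coord bs v j *\<^sub>R bs ! j)"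
    unfolding coord_def
    by (rule sum.reindex_bij_betw[OF bij_betw_nth, symmetric]) (use assms in \<open>auto simp: basis_list_def\<close>)
  finally show ?thesis .
qed

lemma coord_eqI:
  assumes "basis_list bs V" and v: "v = (\<Sum>j<length bs. f j *\<^sub>R bs ! j)" and "j < length bs"
  shows "coord bs v j = f j"
proof -
  have ind: "independent (set bs)" and dist: "distinct bs" using assms by (auto simp: basis_list_def)
  have "coord bs v j = (\<Sum>i<length bs. representation (set bs) (f i *\<^sub>R bs ! i) (bs ! j))"
    unfolding coord_def v
    by (subst real_vector.representation_sum[OF ind]) (simp_all add: span_scale span_base)
  also have "\<dots> = (\<Sum>i<length bs. f i * (if bs ! j = bs ! i then 1 else 0))"
    by (intro sum.cong refl)
      (simp add: real_vector.representation_scale[OF ind] real_vector.representation_basis[OF ind] span_base)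
  also have "\<dots> = (\<Sum>i<length bs. if i = j then f i else 0)"
    using dist assms(3) by (intro sum.cong refl) (auto simp: nth_eq_iff_index_eq)
  also have "\<dots> = f j" using assms(3) by simp
  finally show ?thesis .
qed

lemma coord_basis:
  assumes "basis_list bs V" "i < length bs" "j < length bs"
  shows "coord bs (bs ! i) j = (if i = j then 1 else 0)"
proof (rule coord_eqI[OF assms(1) _ assms(3)])
  have "(\<Sum>j<length bs. (if i = j then 1 else 0) *\<^sub>R bs ! j) = (\<Sum>j<length bs. if i = j then bs ! j else 0)"
    by (intro sum.cong) auto
  then show "bs ! i = (\<Sum>j<length bs. (if i = j then 1 else 0) *\<^sub>R bs ! j)"
    using assms(2) by simp
qed

text \<open>Chain rule: the coordinate matrix relative to \<open>bs\<close> is the one relative to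
  \<open>cs\<close> times the matrix of \<open>cs\<close> itself. The sign comparisons below pass
  through an intermediate basis in this way and evaluate the factors by the special cases that
  follow.\<close>

lemma basis_det_mult:
  assumes b: "basis_list bs V" and c: "basis_list cs V" and vs: "set vs \<subseteq> V" "length vs = dim V"
  shows "basis_det bs vs = basis_det cs vs * basis_det bs cs"
proof -
  define n where "n = dim V"
  have len: "length bs = n" "length cs = n" "length vs = n"
    using basis_list_length b c vs by (auto simp: n_def)
  have ind: "independent (set bs)" using b by (simp add: basis_list_def)
  have cV: "cs ! k \<in> V" if "k < n" for k
    using c that len unfolding basis_list_def by (metis nth_mem span_base)
  have *: "coord bs v j = (\<Sum>k<n. coord cs v k * coord bs (cs ! k) j)" if "v \<in> V" "j < n" for v j
  proof (rule coord_eqI[OF b])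
    have "v = (\<Sum>k<n. coord cs v k *\<^sub>R cs ! k)" using coord_sum[OF c that(1)] len by simp
    also have "\<dots> = (\<Sum>k<n. coord cs v k *\<^sub>R (\<Sum>j<n. coord bs (cs ! k) j *\<^sub>R bs ! j))"
      using coord_sum[OF b cV] len by (intro sum.cong refl) (simp del: scaleR_sum_right)
    also have "\<dots> = (\<Sum>k<n. \<Sum>j<n. (coord cs v k * coord bs (cs ! k) j) *\<^sub>R bs ! j)"
      by (simp add: scaleR_sum_right)
    also have "\<dots> = (\<Sum>j<n. (\<Sum>k<n. coord cs v k * coord bs (cs ! k) j) *\<^sub>R bs ! j)"
      by (subst sum.swap) (simp add: scaleR_sum_left)
    finally show "v = (\<Sum>j<length bs. (\<Sum>k<n. coord cs v k * coord bs (cs ! k) j) *\<^sub>R bs ! j)"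
      using len by simp
  qed (use that len in auto)
  let ?B = "Matrix.mat n n (\<lambda>(i, j). coord bs (cs ! i) j)"
  let ?C = "Matrix.mat n n (\<lambda>(i, j). coord cs (vs ! i) j)"
  have "Matrix.mat n n (\<lambda>(i, j). coord bs (vs ! i) j) = ?C * ?B"
  proof (rule eq_matI)
    fix i j assume ij: "i < dim_row (?C * ?B)" "j < dim_col (?C * ?B)"
    then have "vs ! i \<in> V" using vs len by auto
    with ij show "Matrix.mat n n (\<lambda>(i, j). coord bs (vs ! i) j) $$ (i, j) = (?C * ?B) $$ (i, j)"
      by (simp add: * scalar_prod_def lessThan_atLeast0)
  qed auto
  then show ?thesis
    unfolding basis_det_coord len by (simp add: Determinant.det_mult[of _ n])
qed

lemma basis_det_self:
  assumes "basis_list bs V" shows "basis_det bs bs = 1"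
proof -
  have "Matrix.mat (length bs) (length bs) (\<lambda>(i, j). coord bs (bs ! i) j) = 1\<^sub>m (length bs)"
    by (rule eq_matI) (auto simp: coord_basis[OF assms])
  then show ?thesis by (simp add: basis_det_coord)
qed

lemma basis_det_nonzero:
  assumes "basis_list bs V" "basis_list cs V"
  shows "basis_det bs cs \<noteq> 0"
proof
  have bV: "set bs \<subseteq> V" using assms unfolding basis_list_def by (metis span_superset)
  assume "basis_det bs cs = 0"
  then show False
    using basis_det_mult[OF assms bV basis_list_length[OF assms(1)]] basis_det_self[OF assms(1)] by simp
qed

lemma basis_det_swap:
  assumes "basis_list (w # v # rs) V"
  shows "basis_det (w # v # rs) (v # w # rs) = - 1"
proof -
  let ?bs = "w # v # rs"
  let ?n = "length ?bs"
  have "Matrix.mat ?n ?n (\<lambda>(i, j). coord ?bs ((v # w # rs) ! i) j) = swaprows 0 1 (1\<^sub>m ?n)"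
  proof (rule eq_matI)
    fix i j assume "i < dim_row (swaprows 0 1 (1\<^sub>m ?n))" "j < dim_col (swaprows 0 1 (1\<^sub>m ?n) :: real mat)"
    then have ij: "i < ?n" "j < ?n" by auto
    define i' where "i' = (if i = 0 then 1 else if i = 1 then 0 else i)"
    have i': "i' < ?n" "(v # w # rs) ! i = ?bs ! i'"
      using ij by (auto simp: i'_def nth_Cons split: nat.splits)
    show "Matrix.mat ?n ?n (\<lambda>(i, j). coord ?bs ((v # w # rs) ! i) j) $$ (i, j) = swaprows 0 1 (1\<^sub>m ?n) $$ (i, j)"
      using ij i' coord_basis[OF assms, of i' j] by (simp add: mat_swaprows_def i'_def)
  qed auto
  moreover have "Determinant.det (swaprows 0 1 (1\<^sub>m ?n)) = - (1::real)"
    by (subst det_swaprows[of _ ?n]) auto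
  ultimately show ?thesis by (simp add: basis_det_coord)
qed

text \<open>The vectors of \<open>gs\<close> have unit coordinate rows, so the matrix is upper
  triangular with diagonal \<open>t, 1, ..., 1\<close>.\<close>

lemma basis_det_change_head:
  assumes b: "basis_list (w # gs) V" and w': "w' - t *\<^sub>R w \<in> span (set gs)"
  shows "basis_det (w # gs) (w' # gs) = t"
proof -
  let ?bs = "w # gs"
  let ?n = "length ?bs"
  let ?A = "Matrix.mat ?n ?n (\<lambda>(i, j). coord ?bs ((w' # gs) ! i) j)"
  have gs: "basis_list gs (span (set gs))"
    using b unfolding basis_list_def by (auto simp: independent_insert dest: independent_mono)
  define f where "f j = (case j of 0 \<Rightarrow> t | Suc j \<Rightarrow> coord gs (w' - t *\<^sub>R w) j)" for j
  have "w' = t *\<^sub>R w + (\<Sum>j<length gs. coord gs (w' - t *\<^sub>R w) j *\<^sub>R gs ! j)"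
    using coord_sum[OF gs w'] by simp
  also have "\<dots> = (\<Sum>j<?n. f j *\<^sub>R ?bs ! j)"
    unfolding length_Cons sum.lessThan_Suc_shift by (simp add: f_def)
  finally have *: "coord ?bs w' 0 = t" using coord_eqI[OF b, of w' f 0] by (simp add: f_def)
  have **: "coord ?bs (gs ! i) j = (if Suc i = j then 1 else 0)" if "i < length gs" "j < ?n" for i j
    using coord_basis[OF b, of "Suc i" j] that by simp
  have "Determinant.det ?A = prod_list (diag_mat ?A)"
    by (rule det_upper_triangular[where n = ?n]) (auto simp: upper_triangular_def ** nth_Cons split: nat.splits)
  also have "\<dots> = t"
    by (simp add: prod_list_diag_prod prod.atLeast0_lessThan_Suc_shift * ** del: prod.op_ivl_Suc)
  finally show ?thesis by (simp add: basis_det_coord)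
qed

text \<open>Since \<open>hs\<close> has no component along \<open>w\<close>, the first row and the
  first column are those of the identity, and deleting them leaves the matrix of
  \<open>hs\<close>.\<close>

lemma basis_det_Cons:
  assumes b: "basis_list (w # gs) V" and hs: "set hs \<subseteq> span (set gs)" "length hs = length gs"
  shows "basis_det (w # gs) (w # hs) = basis_det gs hs"
proof -
  let ?bs = "w # gs"
  let ?n = "length gs"
  have gs: "basis_list gs (span (set gs))"
    using b unfolding basis_list_def by (auto simp: independent_insert dest: independent_mono)
  have *: "coord ?bs v j = (case j of 0 \<Rightarrow> 0 | Suc j \<Rightarrow> coord gs v j)" if "v \<in> span (set gs)" "j < Suc ?n" for v j
  proof (rule coord_eqI[OF b])
    show "v = (\<Sum>j<length ?bs. (case j of 0 \<Rightarrow> 0 | Suc j \<Rightarrow> coord gs v j) *\<^sub>R ?bs ! j)"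
      unfolding length_Cons sum.lessThan_Suc_shift using coord_sum[OF gs that(1)] by simp
  qed (use that in auto)
  have hsi: "hs ! i \<in> span (set gs)" if "i < ?n" for i using that hs by auto
  have "Matrix.mat (Suc ?n) (Suc ?n) (\<lambda>(i, j). coord ?bs ((w # hs) ! i) j) =
      four_block_mat (1\<^sub>m 1) (0\<^sub>m 1 ?n) (0\<^sub>m ?n 1) (Matrix.mat ?n ?n (\<lambda>(i, j). coord gs (hs ! i) j))"
    by (rule eq_matI)
      (auto simp: nth_Cons * hsi coord_basis[OF b, of 0, simplified] split: nat.splits)
  also have "Determinant.det \<dots> = Determinant.det (Matrix.mat ?n ?n (\<lambda>(i, j). coord gs (hs ! i) j))"
    by (subst det_four_block_mat_upper_right_zero[of _ 1 _ ?n]) auto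
  finally show ?thesis by (simp add: basis_det_coord)
qed

text \<open>The counterpart of \<open>basis_det_Cons\<close> for a common tail. It lets those
  factors of a join that stay fixed drop out of a sign.\<close>

lemma basis_det_append:
  assumes b: "basis_list (gs @ ts) V" and hs: "set hs \<subseteq> span (set gs)" "length hs = length gs"
  shows "basis_det (gs @ ts) (hs @ ts) = basis_det gs hs"
proof -
  let ?bs = "gs @ ts"
  let ?n = "length gs" and ?m = "length ts"
  have gs: "basis_list gs (span (set gs))"
    using b unfolding basis_list_def by (auto dest: independent_mono)
  have *: "coord ?bs v j = (if j < ?n then coord gs v j else 0)" if "v \<in> span (set gs)" "j < ?n + ?m" for v j
  proof (rule coord_eqI[OF b])
    have "v = (\<Sum>j<?n. coord gs v j *\<^sub>R gs ! j)" using coord_sum[OF gs that(1)] by simp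
    also have "\<dots> = (\<Sum>j<?n. (if j < ?n then coord gs v j else 0) *\<^sub>R ?bs ! j)"
      by (intro sum.cong) (auto simp: nth_append)
    also have "\<dots> = (\<Sum>j<?n + ?m. (if j < ?n then coord gs v j else 0) *\<^sub>R ?bs ! j)"
      by (intro sum.mono_neutral_left) auto
    finally show "v = (\<Sum>j<length ?bs. (if j < ?n then coord gs v j else 0) *\<^sub>R ?bs ! j)" by simp
  qed (use that in auto)
  have hsi: "hs ! i \<in> span (set gs)" if "i < ?n" for i using that hs by auto
  have ts: "coord ?bs (ts ! i) j = (if ?n + i = j then 1 else 0)" if "i < ?m" "j < ?n + ?m" for i j
    using coord_basis[OF b, of "?n + i" j] that by simp
  have "Matrix.mat (?n + ?m) (?n + ?m) (\<lambda>(i, j). coord ?bs ((hs @ ts) ! i) j) =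
      four_block_mat (Matrix.mat ?n ?n (\<lambda>(i, j). coord gs (hs ! i) j)) (0\<^sub>m ?n ?m) (0\<^sub>m ?m ?n) (1\<^sub>m ?m)"
    by (rule eq_matI) (auto simp: nth_append * hsi hs ts)
  also have "Determinant.det \<dots> = Determinant.det (Matrix.mat ?n ?n (\<lambda>(i, j). coord gs (hs ! i) j))"
    by (subst det_four_block_mat_upper_right_zero[of _ ?n _ ?m]) auto
  finally show ?thesis by (simp add: basis_det_coord)
qed

lemma basis_det_map:
  assumes "linear f" and b: "basis_list (map f gs) V" "basis_list gs U" and hs: "set hs \<subseteq> U" "length hs = length gs"
  shows "basis_det (map f gs) (map f hs) = basis_det gs hs"
proof -
  have "coord (map f gs) (f v) j = coord gs v j" if "v \<in> U" "j < length gs" for v j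
  proof (rule coord_eqI[OF b(1)])
    have "f v = f (\<Sum>j<length gs. coord gs v j *\<^sub>R gs ! j)" using coord_sum[OF b(2) that(1)] by simp
    then show "f v = (\<Sum>j<length (map f gs). coord gs v j *\<^sub>R map f gs ! j)"
      by (simp add: linear_sum[OF assms(1)] linear_scale[OF assms(1)])
  qed (use that in auto)
  moreover have "hs ! i \<in> U" if "i < length gs" for i using that hs by auto
  ultimately have "Matrix.mat (length gs) (length gs) (\<lambda>(i, j). coord (map f gs) (map f hs ! i) j)
      = Matrix.mat (length gs) (length gs) (\<lambda>(i, j). coord gs (hs ! i) j)"
    by (intro eq_matI) (auto simp: hs)
  then show ?thesis by (simp add: basis_det_coord)
qed

section \<open>Incidence numbers and the augmented boundary\<close>

text \<open>A cell \<open>F\<close> is put at height \<open>1\<close>, where its points span a linear space of dimension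
  \<open>aff_dim F + 1\<close>. There the outward vector across a facet may be replaced by any point \<open>x\<close> of \<open>F\<close>
  off the facet, and the empty facet of a vertex is no exception: the augmentation becomes the last
  boundary map, with all its incidence numbers equal to \<open>1\<close>.\<close>

definition cone_span :: "'a::euclidean_space set \<Rightarrow> ('a \<times> real) set" where
  "cone_span F = span ((\<lambda>x. (x, 1)) ` F)"

text \<open>The empty list is an ordered basis of the zero space, so the empty cell is oriented like
  all others. Otherwise the choice of the leading point does not matter for determinants, since two
  points of a cell differ by a vector in the span of the remaining entries.\<close>

definition cone_basis :: "('a::euclidean_space set \<Rightarrow> 'a list) \<Rightarrow> 'a set \<Rightarrow> ('a \<times> real) list" where
  "cone_basis ori F = (if F = {} then [] else (SOME q. q \<in> F, 1) # map (\<lambda>v. (v, 0)) (ori F))"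

definition aug_facet :: "'a::euclidean_space set \<Rightarrow> 'a set \<Rightarrow> bool" where
  "aug_facet G F \<longleftrightarrow> G face_of F \<and> aff_dim G = aff_dim F - 1"

definition aug_incidence :: "('a::euclidean_space set \<Rightarrow> 'a list) \<Rightarrow> 'a set \<Rightarrow> 'a set \<Rightarrow> int" where
  "aug_incidence ori F G = (if basis_det (cone_basis ori F) ((SOME x. x \<in> F - G, 1) # cone_basis ori G) > 0 then 1 else - 1)"

lemma facet_of_aug_facet: "G facet_of F \<longleftrightarrow> aug_facet G F \<and> G \<noteq> {}"
  by (auto simp: facet_of_def aug_facet_def)

lemma subspace_cone_span [simp]: "subspace (cone_span F)"
  by (simp add: cone_span_def)

lemma cone_span_base: "x \<in> F \<Longrightarrow> (x, 1) \<in> cone_span F"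
  by (auto simp: cone_span_def intro!: span_base)

lemma cone_span_mono: "F \<subseteq> G \<Longrightarrow> cone_span F \<subseteq> cone_span G"
  by (auto simp: cone_span_def intro!: span_mono)

lemma linear_Pair_0: "linear (\<lambda>v. (v, 0))"
  by (rule linearI) auto

lemma cone_span_diff:
  assumes "v \<in> span {x - y | x y. x \<in> F \<and> y \<in> F}"
  shows "(v, 0) \<in> cone_span F"
proof -
  have "(v, 0::real) \<in> (\<lambda>v. (v, 0)) ` span {x - y | x y. x \<in> F \<and> y \<in> F}" using assms by blast
  also have "\<dots> = span ((\<lambda>v. (v, 0)) ` {x - y | x y. x \<in> F \<and> y \<in> F})"
    by (rule linear_span_image[OF linear_Pair_0, symmetric])
  also have "\<dots> \<subseteq> cone_span F"
  proof (rule span_minimal)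
    show "(\<lambda>v. (v, 0)) ` {x - y | x y. x \<in> F \<and> y \<in> F} \<subseteq> cone_span F"
    proof clarify
      fix x y assume "x \<in> F" "y \<in> F"
      then have "(x, 1) - (y, 1) \<in> cone_span F" by (intro subspace_diff cone_span_base) auto
      then show "(x - y, 0) \<in> cone_span F" by simp
    qed
  qed simp
  finally show ?thesis .
qed

lemma cone_basis_basis:
  assumes "orientation X ori" "F \<in> X"
  shows "basis_list (cone_basis ori F) (cone_span F)"
proof (cases "F = {}")
  case True
  then show ?thesis by (simp add: cone_basis_def cone_span_def basis_list_def independent_empty)
next
  case False
  define q where "q = (SOME q. q \<in> F)"
  have q: "q \<in> F" unfolding q_def using False by (simp add: some_in_eq)
  have cone_basis: "cone_basis ori F = (q, 1) # map (\<lambda>v. (v, 0)) (ori F)" using False by (simp add: cone_basis_def q_def)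
  have ori: "distinct (ori F)" "independent (set (ori F))"
    and sp: "span (set (ori F)) = span {x - y | x y. x \<in> F \<and> y \<in> F}"
    using assms False unfolding orientation_def by auto
  let ?M = "(\<lambda>v. (v, 0)) ` set (ori F) :: ('a \<times> real) set"
  have spM: "span ?M = (\<lambda>v. (v, 0)) ` span (set (ori F))"
    by (rule linear_span_image[OF linear_Pair_0])
  have "independent ?M"
    by (rule linear_independent_injective_image[OF linear_Pair_0 ori(2)]) (auto simp: inj_on_def)
  moreover have "(q, 1) \<notin> span ?M" unfolding spM by auto
  ultimately have ind: "independent (insert (q, 1) ?M)" by (simp add: independent_insert)
  have "span (insert (q, 1) ?M) = cone_span F"
  proof
    show "span (insert (q, 1) ?M) \<subseteq> cone_span F"
    proof (rule span_minimal)
      show "insert (q, 1) ?M \<subseteq> cone_span F"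
        using cone_span_diff[of _ F] sp cone_span_base[OF q] by (auto intro: span_base)
    qed simp
    show "cone_span F \<subseteq> span (insert (q, 1) ?M)"
      unfolding cone_span_def
    proof (rule span_minimal)
      show "(\<lambda>x. (x, 1)) ` F \<subseteq> span (insert (q, 1) ?M)"
      proof clarify
        fix x assume "x \<in> F"
        then have "x - q \<in> span (set (ori F))" unfolding sp using q by (auto intro!: span_base)
        then have "(x - q, 0) \<in> span (insert (q, 1) ?M)" using spM span_mono[of ?M "insert (q, 1) ?M"] by blast
        moreover have "(q, 1) \<in> span (insert (q, 1) ?M)" by (simp add: span_base)
        ultimately have "(q, 1) + (x - q, 0) \<in> span (insert (q, 1) ?M)" by (intro span_add)
        then show "(x, 1) \<in> span (insert (q, 1) ?M)" by simp
      qed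
    qed simp
  qed
  with ind ori show ?thesis
    by (auto simp: basis_list_def cone_basis distinct_map inj_on_def)
qed

lemma dim_cone_span: "int (dim (cone_span F)) = aff_dim F + 1"
proof (cases "F = {}")
  case True
  then show ?thesis by (simp add: cone_span_def)
next
  case False
  then obtain q where q: "q \<in> F" by blast
  \<comment> \<open>Any orientation will do: it only supplies a basis of the direction space, whose
    length is the affine dimension.\<close>
  obtain ori where o: "orientation {F} ori" using orientation_exists by blast
  then have ori: "distinct (ori F)" "independent (set (ori F))"
    and sp: "span (set (ori F)) = span {x - y | x y. x \<in> F \<and> y \<in> F}"
    using False unfolding orientation_def by auto
  have sub: "(+) (- q) ` F \<subseteq> {x - y | x y. x \<in> F \<and> y \<in> F}" using q by force
  have "span ((+) (- q) ` F) = span (set (ori F))"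
  proof
    show "span ((+) (- q) ` F) \<subseteq> span (set (ori F))"
      unfolding sp using sub by (rule span_mono)
    show "span (set (ori F)) \<subseteq> span ((+) (- q) ` F)"
      unfolding sp
    proof (rule span_minimal)
      show "{x - y | x y. x \<in> F \<and> y \<in> F} \<subseteq> span ((+) (- q) ` F)"
      proof clarify
        fix x y assume "x \<in> F" "y \<in> F"
        then have "(- q + x) - (- q + y) \<in> span ((+) (- q) ` F)"
          by (intro span_diff span_base) auto
        then show "x - y \<in> span ((+) (- q) ` F)" by simp
      qed
    qed simp
  qed
  then have "dim ((+) (- q) ` F) = length (ori F)"
    using ori by (metis dim_span dim_eq_card_independent distinct_card)
  then have "aff_dim F = length (ori F)" using aff_dim_eq_dim[of q F] q by (simp add: hull_inc)
  moreover have "dim (cone_span F) = length (cone_basis ori F)" using cone_basis_basis[OF o] basis_list_length by force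
  ultimately show ?thesis using False by (simp add: cone_basis_def)
qed

text \<open>Faces of a polytope are exposed. If \<open>a\<close> and \<open>b\<close> describe a
  supporting hyperplane that cuts out \<open>G\<close>, the functional is the slack in the
  inequality, homogenised so as to be linear on the cone.\<close>

lemma face_functional:
  fixes F :: "'a::euclidean_space set"
  assumes "polytope F" "G face_of F"
  obtains f :: "'a \<times> real \<Rightarrow> real" where "linear f" "\<forall>u\<in>cone_span G. f u = 0" "\<forall>x\<in>F - G. f (x, 1) > 0"
proof -
  have "G exposed_face_of F"
    using assms exposed_face_of_polyhedron polytope_imp_polyhedron by blast
  then obtain a b where ab: "F \<subseteq> {x. a \<bullet> x \<le> b}" "G = F \<inter> {x. a \<bullet> x = b}"
    unfolding exposed_face_of_def by blast
  define f where "f = (\<lambda>u :: 'a \<times> real. b * snd u - a \<bullet> fst u)"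
  have lin: "linear f" unfolding f_def by (rule linearI) (auto simp: algebra_simps inner_right_distrib)
  have "f u = 0" if "u \<in> cone_span G" for u
    using that unfolding cone_span_def
    by (rule linear_eq_0_on_span[OF lin, rotated]) (use ab in \<open>auto simp: f_def\<close>)
  moreover have "f (x, 1) > 0" if "x \<in> F - G" for x using that ab by (auto simp: f_def less_le)
  ultimately show ?thesis using that lin by blast
qed

lemma aug_facetD:
  assumes "aug_facet G F" shows "G face_of F" "G \<subseteq> F" "aff_dim G = aff_dim F - 1" "F - G \<noteq> {}"
proof -
  show G: "G face_of F" "aff_dim G = aff_dim F - 1" using assms by (auto simp: aug_facet_def)
  show "G \<subseteq> F" using G face_of_imp_subset by blast
  then show "F - G \<noteq> {}" using G by (metis Diff_eq_empty_iff add_left_cancel diff_add_cancel equalityI less_irrefl zless_add1_eq)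
qed

lemma face_notin_cone_span:
  assumes "polytope F" "G face_of F" "x \<in> F - G"
  shows "(x, 1) \<notin> cone_span G"
  using face_functional[OF assms(1,2)] assms(3) by (metis less_irrefl)

lemma basis_list_Cons:
  assumes gs: "basis_list gs U" and w: "w \<notin> U" "w \<in> V" and "U \<subseteq> V" "subspace V" "dim V = dim U + 1"
  shows "basis_list (w # gs) V"
proof -
  have g: "distinct gs" "independent (set gs)" "span (set gs) = U" using gs by (auto simp: basis_list_def)
  have wgs: "w \<notin> set gs" using g w span_base by blast
  have ind: "independent (insert w (set gs))" using g w by (simp add: independent_insert)
  have sub: "insert w (set gs) \<subseteq> V" using g assms span_superset by blast
  have "card (insert w (set gs)) = dim V"
    using assms(6) wgs g dim_span_eq_card_independent by fastforce
  then have "V \<subseteq> span (insert w (set gs))" using card_eq_dim[OF sub] ind by simp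
  moreover have "span (insert w (set gs)) \<subseteq> V" using sub assms(5) by (rule span_minimal)
  ultimately show ?thesis using g ind wgs by (simp add: basis_list_def)
qed

lemma aug_facet_basis:
  assumes "polytope F" "aug_facet G F" "basis_list gs (cone_span G)" "w \<notin> cone_span G" "w \<in> cone_span F"
  shows "basis_list (w # gs) (cone_span F)"
proof (rule basis_list_Cons[OF assms(3-5)])
  show "cone_span G \<subseteq> cone_span F" using aug_facetD[OF assms(2)] by (intro cone_span_mono)
  show "dim (cone_span F) = dim (cone_span G) + 1" using dim_cone_span[of F] dim_cone_span[of G] aug_facetD(3)[OF assms(2)] by simp
qed simp

text \<open>Modulo \<open>cone_span G\<close> the space \<open>cone_span F\<close> is a line, and
  the slack \<open>f\<close> of the face \<open>G\<close> is a coordinate on it. Both points have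
  positive slack, so exchanging them multiplies the determinant by
  \<open>t = f (y, 1) / f (x, 1)\<close>, which is positive.\<close>

lemma basis_det_facet_sgn:
  assumes F: "polytope F" and G: "aug_facet G F" and gs: "basis_list gs (cone_span G)" and hs: "basis_list hs (cone_span F)"
    and x: "x \<in> F - G" and y: "y \<in> F - G"
  shows "sgn (basis_det hs ((y, 1) # gs)) = sgn (basis_det hs ((x, 1) # gs))"
proof -
  note G' = aug_facetD[OF G]
  obtain f :: "_ \<Rightarrow> real" where f: "linear f" "\<forall>u\<in>cone_span G. f u = 0" "\<forall>x\<in>F - G. f (x, 1) > 0"
    using face_functional[OF F G'(1)] by blast
  define t where "t = f (y, 1) / f (x, 1)"
  have fxy: "f (x, 1) > 0" "f (y, 1) > 0" using f(3) x y by blast+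
  then have "t > 0" by (simp add: t_def)
  have bx: "basis_list ((x, 1) # gs) (cone_span F)"
    by (rule aug_facet_basis[OF F G gs face_notin_cone_span[OF F G'(1) x] cone_span_base]) (use x in auto)
  have by': "basis_list ((y, 1) # gs) (cone_span F)"
    by (rule aug_facet_basis[OF F G gs face_notin_cone_span[OF F G'(1) y] cone_span_base]) (use y in auto)
  have "(y, 1) \<in> span (insert (x, 1) (set gs))" using bx y cone_span_base[of y F] by (simp add: basis_list_def)
  then obtain k where k: "(y, 1) - k *\<^sub>R (x, 1) \<in> span (set gs)" using span_breakdown_eq by blast
  then have "f ((y, 1) - k *\<^sub>R (x, 1)) = 0" using f(2) gs by (simp add: basis_list_def)
  then have "f (y, 1) = k * f (x, 1)" using f(1) by (simp add: linear_diff linear_scale del: scaleR_Pair)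
  then have "k = t" using fxy by (simp add: t_def)
  then have "basis_det ((x, 1) # gs) ((y, 1) # gs) = t" using k bx by (intro basis_det_change_head) auto
  moreover have "basis_det hs ((y, 1) # gs) = basis_det ((x, 1) # gs) ((y, 1) # gs) * basis_det hs ((x, 1) # gs)"
  proof (rule basis_det_mult[OF hs bx])
    show "set ((y, 1) # gs) \<subseteq> cone_span F" using by' unfolding basis_list_def by (metis span_superset)
  qed (use basis_list_length[OF by'] in simp)
  ultimately show ?thesis using \<open>t > 0\<close> by (simp add: sgn_mult)
qed

text \<open>The determinant is nonzero, so the value -1 in the definition does mean a negative sign,
  and the chosen point may be replaced by any \<open>x\<close> off the facet.\<close>

lemma aug_incidence_eq:
  assumes "orientation X ori" "F \<in> X" "G \<in> X" "polytope F" "aug_facet G F" "x \<in> F - G"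
  shows "real_of_int (aug_incidence ori F G) = sgn (basis_det (cone_basis ori F) ((x, 1) # cone_basis ori G))"
proof -
  note G' = aug_facetD[OF assms(5)]
  have hG: "basis_list (cone_basis ori G) (cone_span G)" and hF: "basis_list (cone_basis ori F) (cone_span F)" using cone_basis_basis assms by blast+
  define y where "y = (SOME x. x \<in> F - G)"
  have y: "y \<in> F - G" unfolding y_def by (rule someI_ex) (use G'(4) in blast)
  have "basis_list ((y, 1) # cone_basis ori G) (cone_span F)"
    by (rule aug_facet_basis[OF assms(4,5) hG face_notin_cone_span[OF assms(4) G'(1) y] cone_span_base]) (use y in auto)
  then have "basis_det (cone_basis ori F) ((y, 1) # cone_basis ori G) \<noteq> 0" by (rule basis_det_nonzero[OF hF])
  then have "real_of_int (aug_incidence ori F G) = sgn (basis_det (cone_basis ori F) ((y, 1) # cone_basis ori G))"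
    unfolding aug_incidence_def y_def[symmetric] by (auto simp: sgn_if)
  also have "\<dots> = sgn (basis_det (cone_basis ori F) ((x, 1) # cone_basis ori G))"
    by (rule basis_det_facet_sgn[OF assms(4,5) hG hF assms(6) y])
  finally show ?thesis .
qed

text \<open>The direction space of a point is zero, which forces \<open>ori {v}\<close> to be empty.
  Both lists compared are then \<open>[(v, 1)]\<close>.\<close>

lemma aug_incidence_vertex:
  assumes "orientation X ori" "{v} \<in> X"
  shows "aug_incidence ori {v} {} = 1"
proof -
  have "{x - y | x y. x \<in> {v} \<and> y \<in> {v}} = {0}" by auto
  then have "span {x - y | x y. x \<in> {v} \<and> y \<in> {v}} = {0}" by (simp only: span_insert_0 span_empty)
  moreover have "independent (set (ori {v})) \<and> span (set (ori {v})) = span {x - y | x y. x \<in> {v} \<and> y \<in> {v}}"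
    using assms(1)[unfolded orientation_def, rule_format, OF assms(2)] by blast
  ultimately have "independent (set (ori {v}))" "span (set (ori {v})) = {0}" by simp_all
  then have "set (ori {v}) = {}" by (metis dependent_zero span_superset subset_singletonD insertI1)
  then have h: "cone_basis ori {v} = [(v, 1)]" "cone_basis ori {} = []" by (auto simp: cone_basis_def)
  then have "basis_det (cone_basis ori {v}) [(v, 1)] = 1"
    using basis_det_self[OF cone_basis_basis[OF assms]] by simp
  then show ?thesis by (simp add: aug_incidence_def h)
qed

text \<open>Let \<open>w0\<close> be the outward vector \<open>y - x\<close> at height 0. Putting
  \<open>q\<close> in front of both lists passes to the cone without changing the determinant, and
  replacing \<open>q\<close> by \<open>y\<close> on the right multiplies it by 1. Moving
  \<open>w0\<close> before \<open>y\<close> costs a factor -1. Replacing \<open>w0\<close> by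
  \<open>x\<close> costs another -1, because \<open>x + w0 = y\<close> is already in the list. The
  two signs cancel.\<close>

lemma incidence_eq_aug_incidence:
  assumes ori: "orientation X ori" and X: "F \<in> X" "G \<in> X" and F: "polytope F" and fac: "G facet_of F"
  shows "incidence ori F G = aug_incidence ori F G"
proof -
  have G: "aug_facet G F" "G \<noteq> {}" using fac by (auto simp: facet_of_aug_facet)
  note G' = aug_facetD[OF G(1)]
  have ne: "F \<noteq> {}" using G' G by auto
  define x where "x = (SOME x. x \<in> F - G)"
  define y where "y = (SOME y. y \<in> G)"
  define q where "q = (SOME q. q \<in> F)"
  have x: "x \<in> F - G" unfolding x_def by (rule someI_ex) (use G'(4) in blast)
  have y: "y \<in> G" unfolding y_def using G(2) by (simp add: some_in_eq)
  have q: "q \<in> F" unfolding q_def using ne by (simp add: some_in_eq)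
  define F0 where "F0 = map (\<lambda>v. (v, 0::real)) (ori F)"
  define G0 where "G0 = map (\<lambda>v. (v, 0::real)) (ori G)"
  have hF: "cone_basis ori F = (q, 1) # F0" using ne by (simp add: cone_basis_def q_def F0_def)
  have hG: "cone_basis ori G = (y, 1) # G0" using G(2) by (simp add: cone_basis_def y_def G0_def)
  have bF: "basis_list ((q, 1) # F0) (cone_span F)" and bG: "basis_list ((y, 1) # G0) (cone_span G)"
    using cone_basis_basis[OF ori] X hF hG by metis+
  have oriF: "basis_list (ori F) (span {x - y | x y. x \<in> F \<and> y \<in> F})"
    using ori X ne unfolding orientation_def basis_list_def by auto
  have spG: "span (set (ori G)) = span {x - y | x y. x \<in> G \<and> y \<in> G}"
    using ori X G(2) unfolding orientation_def basis_list_def by auto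
  let ?x = "(x, 1::real)" and ?y = "(y, 1::real)" and ?w0 = "(y - x, 0::real)" and ?q = "(q, 1::real)"
  have bx: "basis_list (?x # ?y # G0) (cone_span F)"
    by (rule aug_facet_basis[OF F G(1) bG face_notin_cone_span[OF F G'(1) x] cone_span_base]) (use x in auto)
  have w0: "?w0 = ?y - ?x" by simp
  have yF: "?y \<in> cone_span F" and xF: "?x \<in> cone_span F" using x y G'(2) by (auto intro: cone_span_base)
  have yG: "?y \<in> cone_span G" using y by (rule cone_span_base)
  have bw: "basis_list (?w0 # ?y # G0) (cone_span F)"
  proof (rule aug_facet_basis[OF F G(1) bG])
    show "?w0 \<in> cone_span F" unfolding w0 using xF yF by (intro subspace_diff) auto
    show "?w0 \<notin> cone_span G"
    proof
      assume "?w0 \<in> cone_span G"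
      then have "?y - ?w0 \<in> cone_span G" using yG by (intro subspace_diff) auto
      then show False using face_notin_cone_span[OF F G'(1) x] by simp
    qed
  qed
  have len: "length (ori F) = length ((y - x) # ori G)" "length F0 = length (?w0 # G0)"
    using basis_list_length[OF bF] basis_list_length[OF bw] by (auto simp: F0_def G0_def)
  have bw': "basis_list (?y # ?w0 # G0) (cone_span F)" using bw by (auto simp: basis_list_def insert_commute)
  have bF0: "basis_list F0 (span (set F0))"
    using bF unfolding basis_list_def by (auto simp: independent_insert dest: independent_mono)
  have in_oriF: "set ((y - x) # ori G) \<subseteq> span (set (ori F))"
  proof -
    have "span (set (ori G)) \<subseteq> span (set (ori F))"
      using spG oriF G'(2) unfolding basis_list_def by (auto intro!: span_mono)
    moreover have "y - x \<in> span (set (ori F))" using oriF x y G'(2) unfolding basis_list_def by (auto intro!: span_base)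
    ultimately show ?thesis using span_superset by fastforce
  qed
  have spF0: "span (set F0) = (\<lambda>v. (v, 0)) ` span (set (ori F))"
    unfolding F0_def set_map by (rule linear_span_image[OF linear_Pair_0])
  have in_F0: "set (?w0 # G0) \<subseteq> span (set F0)" unfolding spF0 using in_oriF by (auto simp: G0_def)
  have "basis_det (ori F) ((y - x) # ori G) = basis_det F0 (?w0 # G0)"
    using basis_det_map[OF linear_Pair_0 _ oriF, where V = "span (set F0)" and hs = "(y - x) # ori G"] bF0 in_oriF oriF len
    by (simp add: F0_def G0_def basis_list_def)
  also have "\<dots> = basis_det (?q # F0) (?q # ?w0 # G0)"
    using basis_det_Cons[OF bF in_F0] len by simp
  also have "\<dots> = basis_det (?y # ?w0 # G0) (?q # ?w0 # G0) * basis_det (?q # F0) (?y # ?w0 # G0)"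
  proof (rule basis_det_mult[OF bF bw'])
    show "set (?q # ?w0 # G0) \<subseteq> cone_span F"
      using bw' q cone_span_base[OF q] unfolding basis_list_def by (auto intro: span_base)
    show "length (?q # ?w0 # G0) = dim (cone_span F)" using basis_list_length[OF bw'] by simp
  qed
  also have "basis_det (?y # ?w0 # G0) (?q # ?w0 # G0) = 1"
  proof (rule basis_det_change_head[OF bw'])
    have "q - y \<in> span {x - y | x y. x \<in> F \<and> y \<in> F}" using q y G'(2) by (auto intro!: span_base)
    then have "(q - y, 0) \<in> span (set F0)" unfolding spF0 using oriF by (auto simp: basis_list_def)
    \<comment> \<open>The list \<open>?w0 # G0\<close> consists of as many independent vectors of
      \<open>span (set F0)\<close> as \<open>F0\<close> has entries, so the two spans agree.\<close>
    moreover have "span (set F0) \<subseteq> span (set (?w0 # G0))"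
    proof -
      have "independent (set (?w0 # G0))" "card (set (?w0 # G0)) = length F0"
        using bw' len unfolding basis_list_def by (auto simp: independent_insert distinct_card dest: independent_mono)
      then show ?thesis
        using card_eq_dim[of "set (?w0 # G0)" "span (set F0)"] in_F0 basis_list_length[OF bF0] by simp
    qed
    ultimately show "?q - 1 *\<^sub>R ?y \<in> span (set (?w0 # G0))" by auto
  qed
  also have "basis_det (?q # F0) (?y # ?w0 # G0) =
      basis_det (?w0 # ?y # G0) (?y # ?w0 # G0) * basis_det (?q # F0) (?w0 # ?y # G0)"
    by (rule basis_det_mult[OF bF bw]) (use bw' basis_list_length[OF bw'] in \<open>auto simp: basis_list_def intro: span_base\<close>)
  also have "basis_det (?w0 # ?y # G0) (?y # ?w0 # G0) = - 1" by (rule basis_det_swap[OF bw])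
  finally have 1: "basis_det (ori F) ((y - x) # ori G) = - basis_det (?q # F0) (?w0 # ?y # G0)" by simp
  have "basis_det (?q # F0) (?x # ?y # G0) =
     basis_det (?w0 # ?y # G0) (?x # ?y # G0) * basis_det (?q # F0) (?w0 # ?y # G0)"
    by (rule basis_det_mult[OF bF bw]) (use bx basis_list_length[OF bx] in \<open>auto simp: basis_list_def intro: span_base\<close>)
  also have "basis_det (?w0 # ?y # G0) (?x # ?y # G0) = - 1"
    by (rule basis_det_change_head[OF bw]) (simp add: span_base)
  finally have "basis_det (ori F) ((y - x) # ori G) = basis_det (?q # F0) (?x # ?y # G0)" using 1 by simp
  then show ?thesis
    unfolding incidence_def aug_incidence_def hF hG x_def[symmetric] y_def[symmetric] Let_def by simp
qed

section \<open>The diamond property of face lattices and the vanishing of the squared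
  boundary\<close>

lemma aug_facet_Int:
  assumes "polytope F" "aug_facet G F" "aug_facet G' F" "G \<noteq> G'" "aug_facet R G" "aug_facet R G'"
  shows "G \<inter> G' = R"
proof (rule ccontr)
  note d = aug_facetD[OF assms(2)] aug_facetD[OF assms(3)] aug_facetD[OF assms(5)] aug_facetD[OF assms(6)]
  have cv: "convex G" "convex G'" using d(1,5) face_of_imp_convex by blast+
  have I: "G \<inter> G' face_of F" using d by (intro face_of_Int)
  have IG: "G \<inter> G' face_of G" using face_of_subset[OF I _ d(2)] by blast
  have "G \<inter> G' \<noteq> G"
  proof
    assume "G \<inter> G' = G"
    then have "G face_of G'" using face_of_subset[OF d(1)] d(6) by blast
    from face_of_aff_dim_lt[OF cv(2) this assms(4)] show False using d by simp
  qed
  then have "aff_dim (G \<inter> G') < aff_dim G" using face_of_aff_dim_lt[OF cv(1) IG] by simp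
  moreover assume "G \<inter> G' \<noteq> R"
  moreover have "R face_of G \<inter> G'" using face_of_subset[OF d(9)] d(10,14) by blast
  \<comment> \<open>Two proper inclusions of faces, \<open>R\<close> in \<open>G \<inter> G'\<close>
    and \<open>G \<inter> G'\<close> in \<open>G\<close>, cost at least two dimensions, whereas
    \<open>R\<close> has codimension one in \<open>G\<close>.\<close>
  ultimately have "aff_dim R < aff_dim G - 1"
    using face_of_aff_dim_lt[of "G \<inter> G'" R] convex_Int[OF cv] by auto
  then show False using d by simp
qed

text \<open>Existence: a nonempty \<open>R\<close> is the intersection of the facets containing it,
  and \<open>G\<close> alone is too large. If \<open>R\<close> is empty, \<open>G\<close> is a
  vertex, and \<open>F\<close>, not being a single point, has a further one. Uniqueness: modulo
  \<open>cone_span R\<close> the space \<open>cone_span F\<close> is a plane, in which the facets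
  through \<open>R\<close> are boundary rays of a convex cone, and there are at most two of
  those.\<close>

lemma aug_facet_diamond:
  fixes F :: "'a::euclidean_space set"
  assumes F: "polytope F" and G: "aug_facet G F" and R: "aug_facet R G"
  obtains G' where "G' \<noteq> G" "{K. aug_facet K F \<and> aug_facet R K} = {G, G'}"
proof -
  note d = aug_facetD[OF G] aug_facetD[OF R]
  have RF: "R face_of F" using face_of_trans[OF d(5,1)] .
  have "\<exists>G'. G' \<noteq> G \<and> aug_facet G' F \<and> aug_facet R G'"
  proof (cases "R = {}")
    case False
    have "R \<noteq> F" using d(3,7) by auto
    then have R_eq: "R = \<Inter>{K. K facet_of F \<and> R \<subseteq> K}"
      using face_of_polyhedron[OF polytope_imp_polyhedron[OF F] RF False] by blast
    have "\<exists>K. K facet_of F \<and> R \<subseteq> K \<and> K \<noteq> G"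
    proof (rule ccontr)
      assume "\<not> ?thesis"
      then have "{K. K facet_of F \<and> R \<subseteq> K} \<subseteq> {G}" by blast
      then have "G \<subseteq> R" using R_eq by blast
      then show False using d(8) by blast
    qed
    then obtain K where K: "K facet_of F" "R \<subseteq> K" "K \<noteq> G" by blast
    then have "R face_of K" using face_of_subset[OF RF] facet_of_imp_subset by blast
    moreover have "aug_facet K F" using K facet_of_aug_facet by blast
    ultimately show ?thesis using K(3) d(3,7) aug_facetD(3)[of K F] by (intro exI[of _ K]) (simp add: aug_facet_def)
  next
    case True
    then have dG: "aff_dim G = 0" using d(7) by simp
    then obtain v where v: "G = {v}" using aff_dim_eq_0 by blast
    have "F = convex hull {x. x extreme_point_of F}"
      by (rule Krein_Milman_Minkowski) (use F polytope_imp_compact polytope_imp_convex in auto)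
    moreover have "\<not> F \<subseteq> {v}" using d(4) v by blast
    ultimately have "\<not> {x. x extreme_point_of F} \<subseteq> {v}" by (metis convex_singleton hull_minimal)
    then obtain w where "w extreme_point_of F" "w \<noteq> v" by blast
    then have "aug_facet {w} F" "{w} \<noteq> G" "aug_facet R {w}"
      using v True d(3) by (auto simp: aug_facet_def face_of_singleton)
    then show ?thesis by metis
  qed
  then obtain G' where G': "G' \<noteq> G" "aug_facet G' F" "aug_facet R G'" by metis
  note d' = aug_facetD[OF G'(2)] aug_facetD[OF G'(3)]
  have "K = G \<or> K = G'" if K: "aug_facet K F" "aug_facet R K" for K
  proof (rule ccontr)
    assume "\<not> ?thesis"
    then have ne: "K \<noteq> G" "K \<noteq> G'" by auto
    note k = aug_facetD[OF K(1)] aug_facetD[OF K(2)]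
    have I: "G \<inter> G' = R" "G \<inter> K = R" "G' \<inter> K = R" using aug_facet_Int[OF F] G R G' K ne by metis+
    obtain x1 x2 x3 where x: "x1 \<in> G - R" "x2 \<in> G' - R" "x3 \<in> K - R" using d(8) d'(8) k(8) by blast
    obtain rs where rs: "basis_list rs (cone_span R)"
      using cone_basis_basis[of "{R}"] orientation_exists[of "{R}"] by blast
    have pG: "polytope G" using face_of_polytope_polytope[OF F d(1)] .
    have b1: "basis_list ((x1, 1) # rs) (cone_span G)"
      by (rule aug_facet_basis[OF pG R rs face_notin_cone_span[OF pG d(5) x(1)] cone_span_base]) (use x in auto)
    have "x2 \<in> F - G" using x I(1) d'(2) by blast
    then have b2: "basis_list ((x2, 1) # (x1, 1) # rs) (cone_span F)"
      by (intro aug_facet_basis[OF F G b1 face_notin_cone_span[OF F d(1)] cone_span_base]) auto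
    \<comment> \<open>Modulo \<open>R\<close>, the point \<open>x3\<close> would be a positive combination of \<open>x1\<close> and \<open>x2\<close>, which is off \<open>K\<close>.\<close>
    have "(x3, 1) \<in> cone_span F" using x(3) k(2) by (auto intro: cone_span_base)
    then have "(x3, 1) \<in> span (insert (x2, 1) (insert (x1, 1) (set rs)))" using b2 by (simp add: basis_list_def)
    then obtain \<alpha> where "(x3, 1) - \<alpha> *\<^sub>R (x2, 1) \<in> span (insert (x1, 1) (set rs))" using span_breakdown_eq by blast
    then obtain \<beta> where "(x3, 1) - \<alpha> *\<^sub>R (x2, 1) - \<beta> *\<^sub>R (x1, 1) \<in> span (set rs)" using span_breakdown_eq by blast
    then have u: "(x3, 1) - \<alpha> *\<^sub>R (x2, 1) - \<beta> *\<^sub>R (x1, 1) \<in> cone_span R" using rs by (simp add: basis_list_def)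
    have *: "f (x3, 1) = \<alpha> * f (x2, 1) + \<beta> * f (x1, 1)"
      if f: "linear f" "\<forall>u\<in>cone_span M. f u = 0" and "R \<subseteq> M" for f :: "'a \<times> real \<Rightarrow> real" and M
    proof -
      have "f ((x3, 1) - \<alpha> *\<^sub>R (x2, 1) - \<beta> *\<^sub>R (x1, 1)) = 0" using u cone_span_mono[OF that(3)] f(2) by blast
      then show ?thesis using f(1) by (simp add: linear_diff linear_scale del: scaleR_Pair)
    qed
    obtain f1 :: "_ \<Rightarrow> real" where f1: "linear f1" "\<forall>u\<in>cone_span G. f1 u = 0" "\<forall>x\<in>F - G. f1 (x, 1) > 0"
      using face_functional[OF F d(1)] by blast
    obtain f2 :: "_ \<Rightarrow> real" where f2: "linear f2" "\<forall>u\<in>cone_span G'. f2 u = 0" "\<forall>x\<in>F - G'. f2 (x, 1) > 0"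
      using face_functional[OF F d'(1)] by blast
    obtain f3 :: "_ \<Rightarrow> real" where f3: "linear f3" "\<forall>u\<in>cone_span K. f3 u = 0" "\<forall>x\<in>F - K. f3 (x, 1) > 0"
      using face_functional[OF F k(1)] by blast
    have xF: "x1 \<in> F - G'" "x1 \<in> F - K" "x2 \<in> F - G" "x2 \<in> F - K" "x3 \<in> F - G" "x3 \<in> F - G'"
      using x I d(2) d'(2) k(2) by blast+
    have "(x1, 1) \<in> cone_span G" "(x2, 1) \<in> cone_span G'" "(x3, 1) \<in> cone_span K" using x by (auto intro: cone_span_base)
    then have "f1 (x1, 1) = 0" "f2 (x2, 1) = 0" "f3 (x3, 1) = 0" using f1(2) f2(2) f3(2) by blast+
    moreover have pos: "f1 (x2, 1) > 0" "f1 (x3, 1) > 0" "f2 (x1, 1) > 0" "f2 (x3, 1) > 0" "f3 (x1, 1) > 0" "f3 (x2, 1) > 0"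
      using f1(3) f2(3) f3(3) xF by blast+
    ultimately have "f1 (x3, 1) = \<alpha> * f1 (x2, 1)" "f2 (x3, 1) = \<beta> * f2 (x1, 1)" "0 = \<alpha> * f3 (x2, 1) + \<beta> * f3 (x1, 1)"
      using *[OF f1(1,2) d(6)] *[OF f2(1,2) d'(6)] *[OF f3(1,2) k(6)] by simp_all
    moreover have "\<alpha> > 0" "\<beta> > 0"
      using calculation pos by (metis zero_less_mult_pos2)+
    moreover have "\<alpha> * f3 (x2, 1) > 0" "\<beta> * f3 (x1, 1) > 0" using calculation pos by simp_all
    ultimately show False by linarith
  qed
  then have "{K. aug_facet K F \<and> aug_facet R K} = {G, G'}" using G R G' by blast
  then show ?thesis using that G' by blast
qed

text \<open>The product of the signs along \<open>R\<close>, \<open>G\<close>, \<open>F\<close> is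
  the sign of a single determinant, that of \<open>(x', 1)\<close>, \<open>(x, 1)\<close> and the
  basis of \<open>R\<close>, for any \<open>x\<close> in \<open>G - R\<close> and \<open>x'\<close>
  in \<open>F - G\<close>. As \<open>G\<close> and \<open>G'\<close> meet in \<open>R\<close>, a
  point \<open>x\<close> of \<open>G - R\<close> and a point \<open>x'\<close> of
  \<open>G' - R\<close> serve for both flags, but in opposite order.\<close>

lemma aug_incidence_anticommute:
  assumes ori: "orientation X ori" and X: "F \<in> X" "G \<in> X" "G' \<in> X" "R \<in> X" and F: "polytope F"
    and G: "aug_facet G F" "aug_facet R G" and G': "aug_facet G' F" "aug_facet R G'" and ne: "G \<noteq> G'"
  shows "aug_incidence ori F G * aug_incidence ori G R = - (aug_incidence ori F G' * aug_incidence ori G' R)"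
proof -
  have *: "\<exists>b. basis_list ((x', 1) # (x, 1) # cone_basis ori R) (cone_span F) \<and>
      real_of_int (aug_incidence ori F G * aug_incidence ori G R) = sgn (basis_det (cone_basis ori F) ((x', 1) # (x, 1) # cone_basis ori R))"
    if G: "aug_facet G F" "aug_facet R G" "G \<in> X" and x: "x \<in> G - R" "x' \<in> F - G" for G x x'
  proof -
    note d = aug_facetD[OF G(1)] aug_facetD[OF G(2)]
    have pG: "polytope G" using face_of_polytope_polytope[OF F d(1)] .
    note hF = cone_basis_basis[OF ori X(1)] and hG = cone_basis_basis[OF ori G(3)] and hR = cone_basis_basis[OF ori X(4)]
    have b1: "basis_list ((x, 1) # cone_basis ori R) (cone_span G)"
      by (rule aug_facet_basis[OF pG G(2) hR face_notin_cone_span[OF pG d(5) x(1)] cone_span_base]) (use x in auto)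
    have b2: "basis_list ((x', 1) # (x, 1) # cone_basis ori R) (cone_span F)"
      by (rule aug_facet_basis[OF F G(1) b1 face_notin_cone_span[OF F d(1) x(2)] cone_span_base]) (use x in auto)
    have b3: "basis_list ((x', 1) # cone_basis ori G) (cone_span F)"
      by (rule aug_facet_basis[OF F G(1) hG face_notin_cone_span[OF F d(1) x(2)] cone_span_base]) (use x in auto)
    have "basis_det (cone_basis ori F) ((x', 1) # (x, 1) # cone_basis ori R) =
        basis_det ((x', 1) # cone_basis ori G) ((x', 1) # (x, 1) # cone_basis ori R) * basis_det (cone_basis ori F) ((x', 1) # cone_basis ori G)"
      by (rule basis_det_mult[OF hF b3])
        (use b2 basis_list_length[OF b2] in \<open>auto simp: basis_list_def intro: span_base\<close>)
    also have "basis_det ((x', 1) # cone_basis ori G) ((x', 1) # (x, 1) # cone_basis ori R) =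
        basis_det (cone_basis ori G) ((x, 1) # cone_basis ori R)"
    proof (rule basis_det_Cons[OF b3])
      show "set ((x, 1) # cone_basis ori R) \<subseteq> span (set (cone_basis ori G))"
        using b1 hG unfolding basis_list_def by (metis span_superset)
    qed (use basis_list_length[OF b1] basis_list_length[OF hG] in simp)
    finally show ?thesis
      using b2 aug_incidence_eq[OF ori X(1) G(3) F G(1) x(2)] aug_incidence_eq[OF ori G(3) X(4) pG G(2) x(1)]
      by (simp add: sgn_mult)
  qed
  have I: "G \<inter> G' = R" using aug_facet_Int[OF F G(1) G'(1) ne G(2) G'(2)] .
  obtain x x' where x: "x \<in> G - R" "x' \<in> G' - R" using aug_facetD(4)[OF G(2)] aug_facetD(4)[OF G'(2)] by blast
  then have x': "x' \<in> F - G" "x \<in> F - G'" using I aug_facetD(2)[OF G(1)] aug_facetD(2)[OF G'(1)] by auto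
  note 1 = *[OF G X(2) x(1) x'(1)] and 2 = *[OF G' X(3) x(2) x'(2)]
  have b1: "basis_list ((x', 1) # (x, 1) # cone_basis ori R) (cone_span F)" and b2: "basis_list ((x, 1) # (x', 1) # cone_basis ori R) (cone_span F)"
    using 1 2 by auto
  have "basis_det (cone_basis ori F) ((x', 1) # (x, 1) # cone_basis ori R) =
      basis_det ((x, 1) # (x', 1) # cone_basis ori R) ((x', 1) # (x, 1) # cone_basis ori R) *
      basis_det (cone_basis ori F) ((x, 1) # (x', 1) # cone_basis ori R)"
    by (rule basis_det_mult[OF cone_basis_basis[OF ori X(1)] b2])
      (use b1 basis_list_length[OF b1] in \<open>auto simp: basis_list_def intro: span_base\<close>)
  also have "basis_det ((x, 1) # (x', 1) # cone_basis ori R) ((x', 1) # (x, 1) # cone_basis ori R) = - 1"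
    by (rule basis_det_swap[OF b2])
  finally have "real_of_int (aug_incidence ori F G * aug_incidence ori G R) = real_of_int (- (aug_incidence ori F G' * aug_incidence ori G' R))"
    using 1 2 by (simp add: sgn_minus)
  then show ?thesis using of_int_eq_iff by blast
qed

definition aug_boundary :: "'a::euclidean_space set set \<Rightarrow> ('a set \<Rightarrow> 'a list) \<Rightarrow> ('a set \<Rightarrow> 'k::comm_ring_1) \<Rightarrow> 'a set \<Rightarrow> 'k" where
  "aug_boundary X ori a G = (\<Sum>F | F \<in> X \<and> aug_facet G F. of_int (aug_incidence ori F G) * a F)"

lemma aug_boundary_alt:
  assumes "finite X"
  shows "aug_boundary X ori a G = (\<Sum>F\<in>X. if aug_facet G F then of_int (aug_incidence ori F G) * a F else 0)"
  using assms by (simp add: aug_boundary_def sum.inter_filter)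

text \<open>After exchanging the sums, each \<open>F\<close> contributes over the cells between
  \<open>R\<close> and \<open>F\<close>. By the diamond property there are none or exactly two, and
  the two cancel. This includes \<open>R = {}\<close>, where it says that the augmentation kills
  boundaries.\<close>

lemma aug_boundary_aug_boundary:
  assumes X: "polyhedral_complex X" and ori: "orientation X ori"
  shows "aug_boundary X ori (aug_boundary X ori a) R = 0"
proof (cases "R \<in> X")
  case False
  then have *: "{F. F \<in> X \<and> aug_facet R F} = {}"
    using X aug_facetD(1) unfolding polyhedral_complex_def by blast
  show ?thesis unfolding aug_boundary_def[of _ _ _ R] * by simp
next
  case True
  have fin: "finite X" and poly: "\<And>F. F \<in> X \<Longrightarrow> polytope F" and cl: "\<And>F G. F \<in> X \<Longrightarrow> aug_facet G F \<Longrightarrow> G \<in> X"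
    using X aug_facetD(1) unfolding polyhedral_complex_def by blast+
  have "aug_boundary X ori (aug_boundary X ori a) R =
      (\<Sum>G\<in>X. \<Sum>F\<in>X. if aug_facet R G \<and> aug_facet G F then of_int (aug_incidence ori F G * aug_incidence ori G R) * a F else 0)"
    unfolding aug_boundary_alt[OF fin]
    by (intro sum.cong refl) (auto simp: sum_distrib_left mult.assoc mult.commute mult.left_commute intro!: sum.cong)
  also have "\<dots> = (\<Sum>F\<in>X. \<Sum>G\<in>X. if aug_facet R G \<and> aug_facet G F then of_int (aug_incidence ori F G * aug_incidence ori G R) * a F else 0)"
    by (rule sum.swap)
  also have "\<dots> = (\<Sum>F\<in>X. \<Sum>G | aug_facet G F \<and> aug_facet R G. of_int (aug_incidence ori F G * aug_incidence ori G R) * a F)"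
  proof (rule sum.cong[OF refl])
    fix F assume F: "F \<in> X"
    have *: "{G. aug_facet G F \<and> aug_facet R G} = {G \<in> X. aug_facet R G \<and> aug_facet G F}" using cl[OF F] by blast
    show "(\<Sum>G\<in>X. if aug_facet R G \<and> aug_facet G F then of_int (aug_incidence ori F G * aug_incidence ori G R) * a F else 0) =
        (\<Sum>G | aug_facet G F \<and> aug_facet R G. of_int (aug_incidence ori F G * aug_incidence ori G R) * a F)"
      unfolding * by (rule sum.inter_filter[OF fin, symmetric])
  qed
  also have "\<dots> = (\<Sum>F\<in>X. 0)"
  proof (rule sum.cong[OF refl])
    fix F assume F: "F \<in> X"
    show "(\<Sum>G | aug_facet G F \<and> aug_facet R G. of_int (aug_incidence ori F G * aug_incidence ori G R) * a F) = 0"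
    proof (cases "\<exists>G. aug_facet G F \<and> aug_facet R G")
      case True
      then obtain G where G: "aug_facet G F" "aug_facet R G" by blast
      obtain G' where G': "G' \<noteq> G" "{K. aug_facet K F \<and> aug_facet R K} = {G, G'}"
        using aug_facet_diamond[OF poly[OF F] G] .
      then have G'2: "aug_facet G' F" "aug_facet R G'" by auto
      have "aug_incidence ori F G * aug_incidence ori G R = - (aug_incidence ori F G' * aug_incidence ori G' R)"
        by (rule aug_incidence_anticommute[OF ori F _ _ \<open>R \<in> X\<close> poly[OF F] G G'2]) (use cl F G G' G'2 in auto)
      then show ?thesis using G'(1) unfolding G'(2) by (simp del: of_int_mult)
    qed (auto intro: sum.neutral)
  qed
  finally show ?thesis by simp
qed

section \<open>Faces of joins\<close>

text \<open>The coordinates of a point of a join range over the cones over the cells joined.\<close>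

definition hcone :: "'a::euclidean_space set \<Rightarrow> ('a \<times> real) set" where
  "hcone S = {u. u = 0 \<or> snd u > 0 \<and> fst u /\<^sub>R snd u \<in> S}"

lemma hcone_0 [simp]: "0 \<in> hcone S"
  by (simp add: hcone_def)

lemma hcone_Int: "hcone (S \<inter> T) = hcone S \<inter> hcone T"
  by (auto simp: hcone_def)

lemma hcone_Pair_1: "(x, 1) \<in> hcone S \<longleftrightarrow> x \<in> S"
  by (auto simp: hcone_def zero_prod_def)

lemma hcone_snd: "u \<in> hcone S \<Longrightarrow> snd u \<ge> 0"
  by (auto simp: hcone_def)

lemma hcone_snd_0: "u \<in> hcone S \<Longrightarrow> snd u = 0 \<Longrightarrow> u = 0"
  by (auto simp: hcone_def)

lemma hcone_scale: "u \<in> hcone S \<Longrightarrow> c \<ge> 0 \<Longrightarrow> c *\<^sub>R u \<in> hcone S"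
  by (cases "c = 0") (auto simp: hcone_def field_simps)

lemma hcone_scale_iff:
  assumes "c > 0" shows "c *\<^sub>R u \<in> hcone S \<longleftrightarrow> u \<in> hcone S"
  using hcone_scale[of u S c] hcone_scale[of "c *\<^sub>R u" S "inverse c"] assms by auto

text \<open>Dividing by the height is barycentric normalisation: the sum of two cone points lies
  over the average of their base points, weighted by height. Convexity and the face condition pass
  to cones for this reason.\<close>

lemma hcone_combination:
  fixes u v :: "'a::real_vector \<times> real"
  assumes "snd u > 0" "snd v > 0"
  shows "fst (u + v) /\<^sub>R snd (u + v) =
    (1 - snd v / (snd u + snd v)) *\<^sub>R (fst u /\<^sub>R snd u) + (snd v / (snd u + snd v)) *\<^sub>R (fst v /\<^sub>R snd v)"
proof -
  have "1 - snd v / (snd u + snd v) = snd u / (snd u + snd v)" using assms by (simp add: field_simps)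
  moreover have "(a / s) *\<^sub>R (w /\<^sub>R a) = w /\<^sub>R s" if "a > 0" for a s :: real and w :: 'a
  proof -
    have "(a / s) * inverse a = inverse s" using that by (simp add: field_simps)
    then show ?thesis by (simp only: scaleR_scaleR)
  qed
  ultimately show ?thesis using assms by (simp only: fst_add snd_add scaleR_add_right)
qed

lemma hcone_add:
  assumes "convex S" "u \<in> hcone S" "v \<in> hcone S"
  shows "u + v \<in> hcone S"
proof (cases "u = 0 \<or> v = 0")
  case True
  then show ?thesis using assms by auto
next
  case False
  then have uv: "snd u > 0" "fst u /\<^sub>R snd u \<in> S" "snd v > 0" "fst v /\<^sub>R snd v \<in> S" using assms by (auto simp: hcone_def)
  then have "fst (u + v) /\<^sub>R snd (u + v) \<in> S"
    unfolding hcone_combination[OF uv(1,3)] by (intro convexD_alt[OF assms(1)]) auto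
  then show ?thesis using uv by (simp add: hcone_def)
qed

lemma hcone_face:
  assumes F: "F face_of S" and u: "u + v \<in> hcone F" "u \<in> hcone S" "v \<in> hcone S"
  shows "u \<in> hcone F" "v \<in> hcone F"
proof -
  have "u \<in> hcone F \<and> v \<in> hcone F"
  proof (cases "u = 0 \<or> v = 0")
    case True
    then show ?thesis using u by auto
  next
    case False
    then have uv: "snd u > 0" "fst u /\<^sub>R snd u \<in> S" "snd v > 0" "fst v /\<^sub>R snd v \<in> S" using u by (auto simp: hcone_def)
    let ?a = "fst u /\<^sub>R snd u" and ?b = "fst v /\<^sub>R snd v" and ?t = "snd v / (snd u + snd v)"
    have t: "0 < ?t" "?t < 1" using uv by auto
    have "u + v \<noteq> 0" using uv by (auto simp: prod_eq_iff)
    then have "fst (u + v) /\<^sub>R snd (u + v) \<in> F" using u(1) unfolding hcone_def by blast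
    then have *: "(1 - ?t) *\<^sub>R ?a + ?t *\<^sub>R ?b \<in> F" unfolding hcone_combination[OF uv(1,3)] .
    have "?a \<in> F \<and> ?b \<in> F"
    \<comment> \<open>Coinciding base points have an empty open segment, so the face condition is
      silent; but then the combination is that point itself.\<close>
    proof (cases "?a = ?b")
      case True
      have "(1 - ?t) *\<^sub>R ?b + ?t *\<^sub>R ?b = ?b" by (metis add.commute diff_add_cancel scaleR_left_distrib scaleR_one)
      then show ?thesis using * unfolding True by simp
    next
      case False
      then have "(1 - ?t) *\<^sub>R ?a + ?t *\<^sub>R ?b \<in> open_segment ?a ?b" using t unfolding in_segment by blast
      then show ?thesis using face_ofD[OF F] uv * by blast
    qed
    then show ?thesis using uv by (simp add: hcone_def)
  qed
  then show "u \<in> hcone F" "v \<in> hcone F" by auto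
qed

lemma join_embed_combination:
  assumes "p + q = 1"
  shows "join_embed i (p *\<^sub>R x + q *\<^sub>R y) = p *\<^sub>R join_embed i x + q *\<^sub>R join_embed i y"
  using assms by (auto simp: join_embed_def axis_def Finite_Cartesian_Product.vec_eq_iff)

lemma vec_nth_join_embed: "vec_nth (join_embed i x) j = (if j = i then (x, 1) else 0)"
  by (simp add: join_embed_def axis_def)

lemma join_embed_inj: "join_embed i x = join_embed j y \<longleftrightarrow> i = j \<and> x = y"
proof
  assume *: "join_embed i x = join_embed j y"
  have "vec_nth (join_embed j y) i = (x, 1)" unfolding *[symmetric] by (simp add: vec_nth_join_embed)
  then show "i = j \<and> x = y" by (auto simp: vec_nth_join_embed zero_prod_def split: if_splits)
qed auto

lemma convex_vimage_join_embed: "convex C \<Longrightarrow> convex (join_embed i -` C)"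
  unfolding convex_def by (simp add: join_embed_combination)

lemma join_embed_in_join: "x \<in> \<sigma> i \<Longrightarrow> join_embed i x \<in> join_cell \<sigma>"
  unfolding join_cell_def by (auto intro!: hull_inc)

lemma convex_join_cell [simp]: "convex (join_cell \<sigma>)"
  by (simp add: join_cell_def)

text \<open>The heights of the coordinates are the weights of a convex combination and the
  normalised coordinates are its points. Since \<open>hcone {}\<close> is \<open>{0}\<close>, empty
  factors carry no weight and need no separate treatment.\<close>

lemma mem_join_cell:
  fixes \<sigma> :: "'n::finite \<Rightarrow> 'a::euclidean_space set"
  assumes cv: "\<And>i. convex (\<sigma> i)"
  shows "z \<in> join_cell \<sigma> \<longleftrightarrow> (\<forall>i. vec_nth z i \<in> hcone (\<sigma> i)) \<and> (\<Sum>i\<in>UNIV. snd (vec_nth z i)) = 1"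
proof
  let ?K = "{z. (\<forall>i. vec_nth z i \<in> hcone (\<sigma> i)) \<and> (\<Sum>i\<in>UNIV. snd (vec_nth z i)) = 1}"
  have "join_cell \<sigma> \<subseteq> ?K"
    unfolding join_cell_def
  proof (rule hull_minimal)
    show "(\<Union>i. join_embed i ` \<sigma> i) \<subseteq> ?K"
      by (auto simp: vec_nth_join_embed hcone_Pair_1 if_distrib cong: if_cong)
    show "convex ?K"
    proof (rule convexI)
      fix a b and p q :: real
      assume ab: "a \<in> ?K" "b \<in> ?K" and pq: "0 \<le> p" "0 \<le> q" "p + q = 1"
      have "(\<Sum>i\<in>UNIV. snd (vec_nth (p *\<^sub>R a + q *\<^sub>R b) i)) =
          p * (\<Sum>i\<in>UNIV. snd (vec_nth a i)) + q * (\<Sum>i\<in>UNIV. snd (vec_nth b i))"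
        by (simp add: sum.distrib sum_distrib_left)
      then show "p *\<^sub>R a + q *\<^sub>R b \<in> ?K"
        using ab pq by (auto intro!: hcone_add[OF cv] hcone_scale)
    qed
  qed
  then show "(\<forall>i. vec_nth z i \<in> hcone (\<sigma> i)) \<and> (\<Sum>i\<in>UNIV. snd (vec_nth z i)) = 1" if "z \<in> join_cell \<sigma>"
    using that by blast
next
  assume z: "(\<forall>i. vec_nth z i \<in> hcone (\<sigma> i)) \<and> (\<Sum>i\<in>UNIV. snd (vec_nth z i)) = 1"
  define I where "I = {i. snd (vec_nth z i) > 0}"
  define x where "x i = fst (vec_nth z i) /\<^sub>R snd (vec_nth z i)" for i
  have nI: "vec_nth z i = 0" if "i \<notin> I" for i
    using that z hcone_snd[of "vec_nth z i" "\<sigma> i"] hcone_snd_0[of "vec_nth z i" "\<sigma> i"] unfolding I_def by force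
  have "z = (\<Sum>i\<in>I. snd (vec_nth z i) *\<^sub>R join_embed i (x i))"
  proof (rule Finite_Cartesian_Product.vec_eq_iff[THEN iffD2, rule_format])
    fix j
    have "vec_nth (\<Sum>i\<in>I. snd (vec_nth z i) *\<^sub>R join_embed i (x i)) j =
        (\<Sum>i\<in>I. if i = j then snd (vec_nth z i) *\<^sub>R (x i, 1) else 0)"
      unfolding sum_component by (rule sum.cong) (auto simp: vec_nth_join_embed)
    also have "\<dots> = (if j \<in> I then snd (vec_nth z j) *\<^sub>R (x j, 1) else 0)" by simp
    also have "\<dots> = vec_nth z j" using nI[of j] by (auto simp: x_def I_def prod_eq_iff)
    finally show "vec_nth z j = vec_nth (\<Sum>i\<in>I. snd (vec_nth z i) *\<^sub>R join_embed i (x i)) j" by simp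
  qed
  also have "\<dots> \<in> join_cell \<sigma>"
  proof (rule convex_sum)
    have "(\<Sum>i\<in>I. snd (vec_nth z i)) = (\<Sum>i\<in>UNIV. snd (vec_nth z i))"
      by (rule sum.mono_neutral_left) (use nI in auto)
    then show "(\<Sum>i\<in>I. snd (vec_nth z i)) = 1" using z by simp
    show "join_embed i (x i) \<in> join_cell \<sigma>" if "i \<in> I" for i
    proof (rule join_embed_in_join)
      have "vec_nth z i \<in> hcone (\<sigma> i)" "snd (vec_nth z i) > 0" using z that by (auto simp: I_def)
      then show "x i \<in> \<sigma> i" by (auto simp: hcone_def x_def)
    qed
  qed (auto simp: I_def)
  finally show "z \<in> join_cell \<sigma>" .
qed

lemma join_cell_Int:
  assumes "\<And>i. convex (\<sigma> i)" "\<And>i. convex (\<rho> i)"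
  shows "join_cell \<sigma> \<inter> join_cell \<rho> = join_cell (\<lambda>i. \<sigma> i \<inter> \<rho> i)"
  using assms by (auto simp: set_eq_iff mem_join_cell convex_Int hcone_Int)

text \<open>A segment in the join is a segment in every coordinate, with the same parameter
  \<open>t\<close>, so \<open>hcone_face\<close> can be applied coordinatewise.\<close>

lemma join_cell_face:
  assumes cv: "\<And>i. convex (\<sigma> i)" and F: "\<And>i. F i face_of \<sigma> i"
  shows "join_cell F face_of join_cell \<sigma>"
  unfolding face_of_def
proof (intro conjI ballI impI)
  have cvF: "convex (F i)" for i using F face_of_imp_convex by blast
  show "join_cell F \<subseteq> join_cell \<sigma>"
    using face_of_imp_subset[OF F] unfolding join_cell_def by (intro hull_mono) blast
  fix a b x assume a: "a \<in> join_cell \<sigma>" and b: "b \<in> join_cell \<sigma>" and x: "x \<in> join_cell F" and "x \<in> open_segment a b"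
  then obtain t where t: "0 < t" "t < 1" "x = (1 - t) *\<^sub>R a + t *\<^sub>R b" by (auto simp: in_segment)
  have "vec_nth a i \<in> hcone (F i) \<and> vec_nth b i \<in> hcone (F i)" for i
  proof -
    have "(1 - t) *\<^sub>R vec_nth a i + t *\<^sub>R vec_nth b i \<in> hcone (F i)"
      using x unfolding t(3) mem_join_cell[OF cvF] by simp
    moreover have "(1 - t) *\<^sub>R vec_nth a i \<in> hcone (\<sigma> i)" "t *\<^sub>R vec_nth b i \<in> hcone (\<sigma> i)"
      using a b t by (auto simp: mem_join_cell[OF cv] intro!: hcone_scale)
    ultimately have "(1 - t) *\<^sub>R vec_nth a i \<in> hcone (F i)" "t *\<^sub>R vec_nth b i \<in> hcone (F i)"
      using hcone_face[OF F] by blast+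
    then show ?thesis using t by (simp add: hcone_scale_iff)
  qed
  then show "a \<in> join_cell F" "b \<in> join_cell F" using a b by (auto simp: mem_join_cell[OF cv] mem_join_cell[OF cvF])
qed simp

lemma vimage_face:
  fixes \<sigma> :: "'n::finite \<Rightarrow> 'a::euclidean_space set"
  assumes cv: "\<And>i. convex (\<sigma> i)" and Phi: "\<Phi> face_of join_cell \<sigma>"
  shows "(join_embed i -` \<Phi>) face_of \<sigma> i"
  unfolding face_of_def
proof (intro conjI ballI impI)
  show "join_embed i -` \<Phi> \<subseteq> \<sigma> i"
    using face_of_imp_subset[OF Phi] join_cell_vimage[of \<sigma> i, OF cv] by blast
  show "convex (join_embed i -` \<Phi>)" using face_of_imp_convex[OF Phi] by (rule convex_vimage_join_embed)
  fix a b x assume a: "a \<in> \<sigma> i" and b: "b \<in> \<sigma> i" and x: "x \<in> join_embed i -` \<Phi>" and "x \<in> open_segment a b"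
  then obtain t where t: "0 < t" "t < 1" "a \<noteq> b" "x = (1 - t) *\<^sub>R a + t *\<^sub>R b" by (auto simp: in_segment)
  have "join_embed i x = (1 - t) *\<^sub>R join_embed i a + t *\<^sub>R join_embed i b"
    unfolding t(4) by (rule join_embed_combination) simp
  moreover have "join_embed i a \<noteq> join_embed i b" using t by (simp add: join_embed_inj)
  ultimately have "join_embed i x \<in> open_segment (join_embed i a) (join_embed i b)"
    using t(1,2) unfolding in_segment by blast
  then have "join_embed i a \<in> \<Phi> \<and> join_embed i b \<in> \<Phi>"
    using face_ofD[OF Phi] join_embed_in_join[of _ \<sigma> i] a b x by blast
  then show "a \<in> join_embed i -` \<Phi>" "b \<in> join_embed i -` \<Phi>" by auto
qed

text \<open>A point \<open>z\<close> of the face with a nonzero \<open>i\<close>-th coordinate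
  either is the embedded point \<open>x\<close> below that coordinate or lies strictly between it
  and a point of the join with zero \<open>i\<close>-th coordinate. In both cases the embedded point
  belongs to the face, so every coordinate of \<open>z\<close> lies in the cone over a trace of the
  face.\<close>

lemma face_of_join_cell:
  fixes \<sigma> :: "'n::finite \<Rightarrow> 'a::euclidean_space set"
  assumes cv: "\<And>i. convex (\<sigma> i)" and Phi: "\<Phi> face_of join_cell \<sigma>"
  shows "\<Phi> = join_cell (\<lambda>i. join_embed i -` \<Phi>)"
proof
  have cvF: "convex (join_embed i -` \<Phi>)" for i using face_of_imp_convex[OF Phi] by (rule convex_vimage_join_embed)
  show "join_cell (\<lambda>i. join_embed i -` \<Phi>) \<subseteq> \<Phi>"
    unfolding join_cell_def by (rule hull_minimal) (use face_of_imp_convex[OF Phi] in auto)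
  show "\<Phi> \<subseteq> join_cell (\<lambda>i. join_embed i -` \<Phi>)"
  proof
    fix z assume z: "z \<in> \<Phi>"
    then have zs: "z \<in> join_cell \<sigma>" using face_of_imp_subset[OF Phi] by blast
    then have zc: "vec_nth z i \<in> hcone (\<sigma> i)" and sum1: "(\<Sum>i\<in>UNIV. snd (vec_nth z i)) = 1" for i
      by (auto simp: mem_join_cell[OF cv])
    have "vec_nth z i \<in> hcone (join_embed i -` \<Phi>)" for i
    proof (cases "vec_nth z i = 0")
      case False
      define c where "c = snd (vec_nth z i)"
      define x where "x = fst (vec_nth z i) /\<^sub>R c"
      have c: "c > 0" and x: "x \<in> \<sigma> i" using zc[of i] False by (auto simp: hcone_def c_def x_def)
      have zi: "vec_nth z i = c *\<^sub>R (x, 1)" using c by (simp add: prod_eq_iff x_def) (simp add: c_def)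
      have rest: "(\<Sum>j\<in>UNIV - {i}. snd (vec_nth z j)) = 1 - c"
        using sum1 by (simp add: sum.remove[of UNIV i] c_def)
      have nn: "snd (vec_nth z j) \<ge> 0" for j using zc hcone_snd by blast
      then have "1 - c \<ge> 0" unfolding rest[symmetric] by (intro sum_nonneg) auto
      have "join_embed i x \<in> \<Phi>"
      proof (cases "c = 1")
        case True
        then have "\<forall>j\<in>UNIV - {i}. snd (vec_nth z j) = 0"
          using rest sum_nonneg_eq_0_iff[of "UNIV - {i}" "\<lambda>j. snd (vec_nth z j)"] nn by simp
        then have "vec_nth z j = 0" if "j \<noteq> i" for j using that hcone_snd_0[OF zc] by blast
        then have "z = join_embed i x"
          using zi True by (simp add: Finite_Cartesian_Product.vec_eq_iff vec_nth_join_embed)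
        then show ?thesis using z by simp
      next
        case False
        then have c1: "c < 1" using \<open>1 - c \<ge> 0\<close> by simp
        \<comment> \<open>The \<open>i\<close>-th coordinate is removed and the rest, of total
          height \<open>1 - c\<close>, is rescaled to total height 1.\<close>
        define y where "y = (z - c *\<^sub>R join_embed i x) /\<^sub>R (1 - c)"
        have yj: "vec_nth y j = (if j = i then 0 else vec_nth z j /\<^sub>R (1 - c))" for j
          by (simp add: y_def vec_nth_join_embed zi)
        have "y \<in> join_cell \<sigma>"
          unfolding mem_join_cell[OF cv]
        proof
          show "\<forall>j. vec_nth y j \<in> hcone (\<sigma> j)" using zc c1 by (auto simp: yj intro!: hcone_scale)
          have "(\<Sum>j\<in>UNIV. snd (vec_nth y j)) = (\<Sum>j\<in>UNIV - {i}. snd (vec_nth z j) / (1 - c))"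
            by (simp add: sum.remove[of UNIV i] yj divide_inverse mult.commute)
          also have "\<dots> = 1" using rest c1 by (simp add: sum_divide_distrib[symmetric])
          finally show "(\<Sum>j\<in>UNIV. snd (vec_nth y j)) = 1" .
        qed
        moreover have "z \<in> open_segment y (join_embed i x)"
        proof -
          have "vec_nth y i \<noteq> vec_nth (join_embed i x) i" by (simp add: yj vec_nth_join_embed zero_prod_def)
          then have "y \<noteq> join_embed i x" by metis
          moreover have "z = (1 - c) *\<^sub>R y + c *\<^sub>R join_embed i x" using c1 by (simp add: y_def)
          ultimately show ?thesis using c c1 unfolding in_segment by blast
        qed
        ultimately show ?thesis using face_ofD[OF Phi _ _ _ z] join_embed_in_join[of x \<sigma> i] x by blast
      qed
      then show ?thesis using c by (simp add: hcone_def zi)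
    qed simp
    then show "z \<in> join_cell (\<lambda>i. join_embed i -` \<Phi>)" using sum1 by (simp add: mem_join_cell[OF cvF])
  qed
qed

lemma join_cell_inj:
  fixes \<sigma> \<rho> :: "'n::finite \<Rightarrow> 'a::euclidean_space set"
  assumes "\<And>i. convex (\<sigma> i)" "\<And>i. convex (\<rho> i)" "join_cell \<sigma> = join_cell \<rho>"
  shows "\<sigma> = \<rho>"
  using join_cell_vimage[of \<sigma>] join_cell_vimage[of \<rho>] assms by (metis ext)

lemma join_cell_face_iff:
  fixes \<sigma> \<rho> :: "'n::finite \<Rightarrow> 'a::euclidean_space set"
  assumes "\<And>i. convex (\<sigma> i)" "\<And>i. convex (\<rho> i)"
  shows "join_cell \<rho> face_of join_cell \<sigma> \<longleftrightarrow> (\<forall>i. \<rho> i face_of \<sigma> i)"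
  using join_cell_face[of \<sigma> \<rho>] vimage_face[of \<sigma> "join_cell \<rho>"] join_cell_vimage[of \<rho>] assms by metis

lemma join_cell_empty: "join_cell (\<lambda>i. {}) = {}"
  by (simp add: join_cell_def)

lemma polytope_join_cell:
  fixes \<sigma> :: "'n::finite \<Rightarrow> 'a::euclidean_space set"
  assumes "\<And>i. polytope (\<sigma> i)"
  shows "polytope (join_cell \<sigma>)"
proof -
  have "\<forall>i. \<exists>V. finite V \<and> \<sigma> i = convex hull V" using assms unfolding polytope_def by auto
  then obtain V where V: "\<And>i. finite (V i)" "\<And>i. \<sigma> i = convex hull (V i)" by metis
  let ?U = "\<Union>i. join_embed i ` V i"
  have "join_cell \<sigma> = convex hull ?U"
  proof
    have "convex hull (V i) \<subseteq> join_embed i -` (convex hull ?U)" for i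
      by (rule hull_minimal) (auto intro!: convex_vimage_join_embed hull_inc)
    then show "join_cell \<sigma> \<subseteq> convex hull ?U" unfolding join_cell_def V(2) by (intro hull_minimal) auto
    show "convex hull ?U \<subseteq> join_cell \<sigma>"
      unfolding join_cell_def V(2) by (intro hull_mono) (auto intro: hull_inc)
  qed
  moreover have "finite ?U" using V by auto
  ultimately show ?thesis unfolding polytope_def by blast
qed

lemma polyhedral_complex_join:
  fixes X :: "'n::finite \<Rightarrow> 'a::euclidean_space set set"
  assumes X: "\<And>i. polyhedral_complex (X i)"
  shows "polyhedral_complex (join_complex X)"
proof -
  have fin: "finite (X i)" and em: "{} \<in> X i" and poly: "P \<in> X i \<Longrightarrow> polytope P"
    and face: "P \<in> X i \<Longrightarrow> F face_of P \<Longrightarrow> F \<in> X i"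
    and int: "P \<in> X i \<Longrightarrow> Q \<in> X i \<Longrightarrow> P \<inter> Q face_of P" for i P Q F
    using X[of i] unfolding polyhedral_complex_def by blast+
  have cv: "convex P" if "P \<in> X i" for P i using poly[OF that] polytope_imp_convex by blast
  have "{\<sigma>. \<forall>i. \<sigma> i \<in> X i} = PiE UNIV X" by (auto simp: PiE_def)
  then have "finite {\<sigma>. \<forall>i. \<sigma> i \<in> X i}" using fin by (simp add: finite_PiE)
  moreover have "join_complex X = join_cell ` {\<sigma>. \<forall>i. \<sigma> i \<in> X i}" by (auto simp: join_complex_def)
  ultimately have "finite (join_complex X)" by simp
  moreover have "{} \<in> join_complex X" unfolding join_complex_def by (intro CollectI exI[of _ "\<lambda>i. {}"]) (simp add: join_cell_empty em)
  moreover have "\<forall>P\<in>join_complex X. polytope P" by (auto simp: join_complex_def intro!: polytope_join_cell poly)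
  moreover have "F \<in> join_complex X" if P: "P \<in> join_complex X" and F: "F face_of P" for P F
  proof -
    obtain \<sigma> where s: "P = join_cell \<sigma>" "\<And>i. \<sigma> i \<in> X i" using P by (auto simp: join_complex_def)
    have cs: "convex (\<sigma> i)" for i using s cv by blast
    have "F = join_cell (\<lambda>i. join_embed i -` F)" using face_of_join_cell[of \<sigma>, OF cs] F s by simp
    moreover have "join_embed i -` F \<in> X i" for i
      using face[OF s(2)] vimage_face[of \<sigma>, OF cs] F s by simp
    ultimately show ?thesis unfolding join_complex_def by blast
  qed
  moreover have "P \<inter> Q face_of P" if PQ: "P \<in> join_complex X" "Q \<in> join_complex X" for P Q
  proof -
    obtain \<sigma> \<rho> where s: "P = join_cell \<sigma>" "\<And>i. \<sigma> i \<in> X i" "Q = join_cell \<rho>" "\<And>i. \<rho> i \<in> X i"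
      using PQ by (auto simp: join_complex_def)
    have cs: "convex (\<sigma> i)" "convex (\<rho> i)" for i using s cv by blast+
    show ?thesis unfolding s(1,3) join_cell_Int[of \<sigma> \<rho>, OF cs]
      by (rule join_cell_face[of \<sigma>, OF cs(1)]) (use int s in blast)
  qed
  moreover from this have "P \<inter> Q face_of Q" if "P \<in> join_complex X" "Q \<in> join_complex X" for P Q
    using that by (metis inf_commute)
  ultimately show ?thesis unfolding polyhedral_complex_def by blast
qed

section \<open>Orientation of joins\<close>

lemma cone_span_convex_hull: "cone_span (convex hull U) = cone_span U"
proof
  have "convex {z. (z, 1) \<in> cone_span U}"
  proof (rule convexI)
    fix x y and u v :: real
    assume xy: "x \<in> {z. (z, 1) \<in> cone_span U}" "y \<in> {z. (z, 1) \<in> cone_span U}" and uv: "0 \<le> u" "0 \<le> v" "u + v = 1"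
    have "u *\<^sub>R (x, 1) + v *\<^sub>R (y, 1) \<in> cone_span U" using xy by (intro subspace_add subspace_scale) auto
    then show "u *\<^sub>R x + v *\<^sub>R y \<in> {z. (z, 1) \<in> cone_span U}" using uv by simp
  qed
  then have "convex hull U \<subseteq> {z. (z, 1) \<in> cone_span U}" by (intro hull_minimal) (auto intro: cone_span_base)
  then have "(\<lambda>x. (x, 1)) ` (convex hull U) \<subseteq> cone_span U" by blast
  then show "cone_span (convex hull U) \<subseteq> cone_span U" unfolding cone_span_def[of "convex hull U"] by (intro span_minimal) simp_all
  show "cone_span U \<subseteq> cone_span (convex hull U)" by (intro cone_span_mono hull_subset)
qed

lemma basis_list_subset: "basis_list gs V \<Longrightarrow> set gs \<subseteq> V"
  unfolding basis_list_def by (metis span_superset)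

lemma span_Un_span: "span (span A \<union> span B) = span (A \<union> B)"
proof
  show "span (span A \<union> span B) \<subseteq> span (A \<union> B)" by (intro span_minimal) (simp_all add: span_mono)
  show "span (A \<union> B) \<subseteq> span (span A \<union> span B)" by (intro span_mono Un_mono span_superset)
qed

lemma basis_list_append:
  assumes as: "basis_list as U" and bs: "basis_list bs V" and UV: "U \<inter> V \<subseteq> {0}"
  shows "basis_list (as @ bs) (span (U \<union> V))"
proof -
  have a: "distinct as" "independent (set as)" "span (set as) = U" using as by (auto simp: basis_list_def)
  have b: "distinct bs" "independent (set bs)" "span (set bs) = V" using bs by (auto simp: basis_list_def)
  have "x = 0" if "x \<in> set as" "x \<in> set bs" for x using that UV a(3) b(3) span_base by blast
  then have disj: "set as \<inter> set bs = {}" using a(2) dependent_zero by blast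
  have sub: "subspace U" "subspace V" using a(3) b(3) by auto
  have sp: "span (set as \<union> set bs) = {x + y | x y. x \<in> U \<and> y \<in> V}" unfolding span_Un a(3) b(3) by auto
  have "dim {x + y | x y. x \<in> U \<and> y \<in> V} + dim (U \<inter> V) = dim U + dim V" by (rule dim_sums_Int[OF sub])
  moreover have "dim (U \<inter> V) = 0" using UV by (simp add: dim_eq_0)
  ultimately have "dim (span (set as \<union> set bs)) = card (set as \<union> set bs)"
    using basis_list_length[OF as] basis_list_length[OF bs] a b disj
    by (simp add: sp card_Un_disjoint distinct_card del: dim_span)
  then have "independent (set as \<union> set bs)"
    using card_eq_dim[of "set as \<union> set bs" "span (set as \<union> set bs)"] span_superset[of "set as \<union> set bs"] by simp
  moreover have "span (set as \<union> set bs) = span (U \<union> V)"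
    unfolding a(3)[symmetric] b(3)[symmetric] span_Un_span ..
  ultimately show ?thesis using a b disj by (auto simp: basis_list_def)
qed

text \<open>The linear extension of \<open>join_embed i\<close> to homogeneous coordinates. The
  height is copied into the last component because the join is itself put at height 1.\<close>

definition hom_embed :: "'n::finite \<Rightarrow> 'a::euclidean_space \<times> real \<Rightarrow> (('a \<times> real) ^ 'n) \<times> real" where
  "hom_embed i u = (axis i u, snd u)"

lemma linear_hom_embed: "linear (hom_embed i)"
  by (rule linearI) (auto simp: hom_embed_def axis_def Finite_Cartesian_Product.vec_eq_iff)

lemma vec_nth_hom_embed: "vec_nth (fst (hom_embed i u)) j = (if j = i then u else 0)"
  by (simp add: hom_embed_def axis_def)

lemma inj_hom_embed: "inj_on (hom_embed i) S"
  by (rule inj_onI) (metis vec_nth_hom_embed)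

lemma hom_embed_join_embed: "hom_embed i (x, 1) = (join_embed i x, 1)"
  by (simp add: hom_embed_def join_embed_def)

lemma cone_span_join_cell: "cone_span (join_cell \<sigma>) = span (\<Union>i. hom_embed i ` (\<lambda>x. (x, 1)) ` \<sigma> i)"
proof -
  have "(\<lambda>z. (z, 1)) ` (\<Union>i. join_embed i ` \<sigma> i) = (\<Union>i. hom_embed i ` (\<lambda>x. (x, 1)) ` \<sigma> i)"
    by (simp add: image_UN image_image hom_embed_join_embed)
  then show ?thesis unfolding join_cell_def cone_span_convex_hull by (simp add: cone_span_def)
qed

text \<open>Together with \<open>hom_embed_cone_span_Int\<close> this is a direct sum decomposition
  into the \<open>i\<close>-th factor and the join of the others, the latter being written with
  \<open>{}\<close> in place \<open>i\<close>.\<close>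

lemma cone_span_join_cell_upd:
  "cone_span (join_cell (\<sigma>(i := F))) = span (hom_embed i ` cone_span F \<union> cone_span (join_cell (\<sigma>(i := {}))))"
proof -
  let ?A = "hom_embed i ` (\<lambda>x. (x, 1)) ` F"
  let ?B = "\<Union>j. hom_embed j ` (\<lambda>x. (x, 1)) ` (\<sigma>(i := {})) j"
  have "(\<Union>j. hom_embed j ` (\<lambda>x. (x, 1)) ` (\<sigma>(i := F)) j) = ?A \<union> ?B"
    by (auto simp: fun_upd_def split: if_splits)
  then have "cone_span (join_cell (\<sigma>(i := F))) = span (?A \<union> ?B)" unfolding cone_span_join_cell by simp
  also have "\<dots> = span (span ?A \<union> span ?B)" by (rule span_Un_span[symmetric])
  also have "span ?A = hom_embed i ` cone_span F" unfolding cone_span_def by (rule linear_span_image[OF linear_hom_embed])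
  also have "span ?B = cone_span (join_cell (\<sigma>(i := {})))" by (rule cone_span_join_cell[symmetric])
  finally show ?thesis .
qed

lemma hom_embed_cone_span_Int:
  assumes "\<sigma> i = {}"
  shows "hom_embed i ` S \<inter> cone_span (join_cell \<sigma>) \<subseteq> {0}"
proof
  fix w assume w: "w \<in> hom_embed i ` S \<inter> cone_span (join_cell \<sigma>)"
  then obtain u where u: "w = hom_embed i u" by blast
  have "linear (\<lambda>w :: (('a \<times> real) ^ 'b) \<times> real. vec_nth (fst w) i)" by (rule linearI) auto
  then have "vec_nth (fst w) i = 0"
  proof (rule linear_eq_0_on_span)
    show "w \<in> span (\<Union>i. hom_embed i ` (\<lambda>x. (x, 1)) ` \<sigma> i)" using w by (simp add: cone_span_join_cell)
  qed (use assms in \<open>auto simp: vec_nth_hom_embed\<close>)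
  then have "u = 0" by (simp add: u vec_nth_hom_embed)
  then show "w \<in> {0}" by (simp add: u linear_0[OF linear_hom_embed])
qed

text \<open>The orientation \<open>oj\<close> of the join is not assumed to be related to the
  orientations \<open>ori\<close> of the factors.\<close>

locale oriented_join =
  fixes X :: "'n::finite \<Rightarrow> 'a::euclidean_space set set"
    and ori :: "'n \<Rightarrow> 'a set \<Rightarrow> 'a list"
    and oj :: "(('a \<times> real) ^ 'n) set \<Rightarrow> (('a \<times> real) ^ 'n) list"
  assumes complex: "\<And>i. polyhedral_complex (X i)"
    and ori: "\<And>i. orientation (X i) (ori i)"
    and oj: "orientation (join_complex X) oj"
begin

abbreviation "J \<equiv> join_complex X"

lemma polyhedral_J: "polyhedral_complex J"
  using polyhedral_complex_join complex .

lemma cell_convex: "P \<in> X i \<Longrightarrow> convex P" and cell_polytope: "P \<in> X i \<Longrightarrow> polytope P"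
  and cell_empty: "{} \<in> X i" and cell_face: "P \<in> X i \<Longrightarrow> F face_of P \<Longrightarrow> F \<in> X i"
  using complex[of i] polytope_imp_convex unfolding polyhedral_complex_def by blast+

lemma J_polytope: "C \<in> J \<Longrightarrow> polytope C" and J_face: "C \<in> J \<Longrightarrow> K face_of C \<Longrightarrow> K \<in> J" and J_finite: "finite J"
  using polyhedral_J unfolding polyhedral_complex_def by blast+

lemma J_I: "(\<And>j. \<sigma> j \<in> X j) \<Longrightarrow> join_cell \<sigma> \<in> J"
  by (auto simp: join_complex_def)

lemma J_upd: "(\<And>j. \<sigma> j \<in> X j) \<Longrightarrow> F \<in> X i \<Longrightarrow> join_cell (\<sigma>(i := F)) \<in> J"
  by (intro J_I) auto

text \<open>With factor \<open>i\<close> first and a tail independent of \<open>F\<close>, a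
  boundary in direction \<open>i\<close> alters only the head. No sign depending on the dimensions
  of the other factors arises.\<close>

definition row_basis :: "'n \<Rightarrow> ('n \<Rightarrow> 'a set) \<Rightarrow> 'a set \<Rightarrow> ((('a \<times> real) ^ 'n) \<times> real) list" where
  "row_basis i \<sigma> F = map (hom_embed i) (cone_basis (ori i) F) @ cone_basis oj (join_cell (\<sigma>(i := {})))"

text \<open>Compares the given orientation of a join with that of its factors. Up to rescaling the basis by
  these signs, the boundary of a join in the direction of one factor is the boundary of that factor.\<close>

definition eta :: "'n \<Rightarrow> ('n \<Rightarrow> 'a set) \<Rightarrow> 'a set \<Rightarrow> int" where
  "eta i \<sigma> F = (if basis_det (cone_basis oj (join_cell (\<sigma>(i := F)))) (row_basis i \<sigma> F) > 0 then 1 else - 1)"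

lemma basis_list_hom_embed:
  assumes "basis_list gs U"
  shows "basis_list (map (hom_embed i) gs) (hom_embed i ` U)"
proof -
  have g: "distinct gs" "independent (set gs)" "span (set gs) = U" using assms by (auto simp: basis_list_def)
  have "independent (hom_embed i ` set gs)"
    using linear_independent_injective_image[OF linear_hom_embed g(2)] inj_hom_embed by blast
  moreover have "span (hom_embed i ` set gs) = hom_embed i ` U"
    using linear_span_image[OF linear_hom_embed] g by metis
  ultimately show ?thesis using g by (simp add: basis_list_def distinct_map inj_hom_embed)
qed

lemma row_basis_append:
  assumes "\<And>j. \<sigma> j \<in> X j" "basis_list gs (cone_span F)"
  shows "basis_list (map (hom_embed i) gs @ cone_basis oj (join_cell (\<sigma>(i := {})))) (cone_span (join_cell (\<sigma>(i := F))))"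
  unfolding cone_span_join_cell_upd[of \<sigma> i F]
  by (rule basis_list_append[OF basis_list_hom_embed[OF assms(2)] cone_basis_basis[OF oj J_upd[OF assms(1) cell_empty]]])
    (rule hom_embed_cone_span_Int, simp)

lemma row_basis:
  assumes "\<And>j. \<sigma> j \<in> X j" "F \<in> X i"
  shows "basis_list (row_basis i \<sigma> F) (cone_span (join_cell (\<sigma>(i := F))))"
  unfolding row_basis_def using row_basis_append[OF assms(1) cone_basis_basis[OF ori assms(2)]] .

text \<open>Dimensions of cone spans add up, and each of them exceeds the affine dimension by
  one.\<close>

lemma aff_dim_join_upd:
  assumes "\<And>j. \<sigma> j \<in> X j" "F \<in> X i"
  shows "aff_dim (join_cell (\<sigma>(i := F))) = aff_dim F + aff_dim (join_cell (\<sigma>(i := {}))) + 1"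
  using basis_list_length[OF row_basis[of \<sigma>, OF assms]] basis_list_length[OF cone_basis_basis[OF ori assms(2)]]
    basis_list_length[OF cone_basis_basis[OF oj J_upd[of \<sigma>, OF assms(1) cell_empty[of i]]]]
    dim_cone_span[of F] dim_cone_span[of "join_cell (\<sigma>(i := F))"] dim_cone_span[of "join_cell (\<sigma>(i := {}))"]
  by (simp add: row_basis_def)

lemma eta_sgn:
  assumes "\<And>j. \<sigma> j \<in> X j" "F \<in> X i"
  shows "real_of_int (eta i \<sigma> F) = sgn (basis_det (cone_basis oj (join_cell (\<sigma>(i := F)))) (row_basis i \<sigma> F))"
  using basis_det_nonzero[OF cone_basis_basis[OF oj J_upd[of \<sigma>, OF assms]] row_basis[of \<sigma>, OF assms]]
  by (auto simp: eta_def sgn_if)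

lemma eta_square: "eta i \<sigma> F * eta i \<sigma> F = 1"
  by (simp add: eta_def)

lemma join_upd_face_iff:
  assumes "\<And>j. \<sigma> j \<in> X j" "F \<in> X i" "G \<in> X i"
  shows "join_cell (\<sigma>(i := G)) face_of join_cell (\<sigma>(i := F)) \<longleftrightarrow> G face_of F"
proof -
  have c: "convex ((\<sigma>(i := F)) j)" "convex ((\<sigma>(i := G)) j)" for j
    using cell_convex[OF assms(1), of j] cell_convex[OF assms(2)] cell_convex[OF assms(3)] by auto
  have "\<sigma> j face_of \<sigma> j" for j using cell_convex[OF assms(1)] by (rule face_of_refl)
  then show ?thesis
    using join_cell_face_iff[of "\<sigma>(i := F)" "\<sigma>(i := G)", OF c] by (auto split: if_splits)
qed

lemma aug_facet_join_upd:
  assumes "\<And>j. \<sigma> j \<in> X j" "F \<in> X i" "G \<in> X i"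
  shows "aug_facet (join_cell (\<sigma>(i := G))) (join_cell (\<sigma>(i := F))) \<longleftrightarrow> aug_facet G F"
  using join_upd_face_iff[of \<sigma>, OF assms] aff_dim_join_upd[of \<sigma>, OF assms(1,2)] aff_dim_join_upd[of \<sigma>, OF assms(1,3)]
  by (auto simp: aug_facet_def)

text \<open>The determinant of \<open>?x # row_basis i \<sigma> G\<close> relative to the oriented
  cell of the join is computed in two ways. Through the orientation of the smaller cell its sign is
  \<open>eta i \<sigma> G\<close> times the incidence in the join. Through
  \<open>row_basis i \<sigma> F\<close> the common tail drops out, and its sign is
  \<open>eta i \<sigma> F\<close> times the incidence in factor \<open>i\<close>.\<close>

lemma aug_incidence_join:
  assumes s: "\<And>j. \<sigma> j \<in> X j" and F: "F \<in> X i" and G: "G \<in> X i" and fac: "aug_facet G F"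
  shows "aug_incidence oj (join_cell (\<sigma>(i := F))) (join_cell (\<sigma>(i := G))) = eta i \<sigma> F * eta i \<sigma> G * aug_incidence (ori i) F G"
proof -
  let ?F = "join_cell (\<sigma>(i := F))" and ?G = "join_cell (\<sigma>(i := G))" and ?T = "cone_basis oj (join_cell (\<sigma>(i := {})))"
  have FJ: "?F \<in> J" and GJ: "?G \<in> J" using J_upd s F G by blast+
  have fac': "aug_facet ?G ?F" using aug_facet_join_upd[of \<sigma>, OF s F G] fac by simp
  obtain x where x: "x \<in> F - G" using aug_facetD(4)[OF fac] by blast
  let ?x = "(join_embed i x, 1 :: real)"
  have cG: "convex ((\<sigma>(i := G)) j)" for j using cell_convex[OF s, of j] cell_convex[OF G] by auto
  have xF: "join_embed i x \<in> ?F" using x by (intro join_embed_in_join) simp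
  have "join_embed i x \<notin> ?G" using join_cell_vimage[of "\<sigma>(i := G)" i, OF cG] x by auto
  with xF have xFG: "join_embed i x \<in> ?F - ?G" by blast
  note hF = cone_basis_basis[OF oj FJ] and hG = cone_basis_basis[OF oj GJ]
  note rF = row_basis[of \<sigma>, OF s F] and rG = row_basis[of \<sigma>, OF s G]
  note nin = face_notin_cone_span[OF J_polytope[OF FJ] aug_facetD(1)[OF fac'] xFG]
  have b1: "basis_list (?x # cone_basis oj ?G) (cone_span ?F)"
    by (rule aug_facet_basis[OF J_polytope[OF FJ] fac' hG nin cone_span_base[OF xF]])
  have b2: "basis_list (?x # row_basis i \<sigma> G) (cone_span ?F)"
    by (rule aug_facet_basis[OF J_polytope[OF FJ] fac' rG nin cone_span_base[OF xF]])
  have b3: "basis_list ((x, 1) # cone_basis (ori i) G) (cone_span F)"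
    by (rule aug_facet_basis[OF cell_polytope[OF F] fac cone_basis_basis[OF ori G]
        face_notin_cone_span[OF cell_polytope[OF F] aug_facetD(1)[OF fac] x] cone_span_base]) (use x in blast)
  have b2': "set (?x # row_basis i \<sigma> G) \<subseteq> cone_span ?F" "length (?x # row_basis i \<sigma> G) = dim (cone_span ?F)"
    using basis_list_length[OF b2] basis_list_subset[OF b2] by blast+
  have b3': "set ((x, 1) # cone_basis (ori i) G) \<subseteq> cone_span F" "length ((x, 1) # cone_basis (ori i) G) = length (cone_basis (ori i) F)"
    using basis_list_length[OF b3] basis_list_length[OF cone_basis_basis[OF ori F]] basis_list_subset[OF b3] by simp_all
  have "basis_det (cone_basis oj ?F) (?x # row_basis i \<sigma> G) =
      basis_det (?x # cone_basis oj ?G) (?x # row_basis i \<sigma> G) * basis_det (cone_basis oj ?F) (?x # cone_basis oj ?G)"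
    by (rule basis_det_mult[OF hF b1 b2'])
  also have "basis_det (?x # cone_basis oj ?G) (?x # row_basis i \<sigma> G) = basis_det (cone_basis oj ?G) (row_basis i \<sigma> G)"
    by (rule basis_det_Cons[OF b1])
      (use hG basis_list_length[OF rG] basis_list_length[OF hG] basis_list_subset[OF rG] in \<open>simp_all add: basis_list_def\<close>)
  finally have A: "basis_det (cone_basis oj ?F) (?x # row_basis i \<sigma> G) =
      basis_det (cone_basis oj ?G) (row_basis i \<sigma> G) * basis_det (cone_basis oj ?F) (?x # cone_basis oj ?G)" .
  have 1: "sgn (basis_det (cone_basis oj ?F) (?x # row_basis i \<sigma> G)) = real_of_int (eta i \<sigma> G * aug_incidence oj ?F ?G)"
    unfolding A sgn_mult of_int_mult eta_sgn[of \<sigma>, OF s G] aug_incidence_eq[OF oj FJ GJ J_polytope[OF FJ] fac' xFG] ..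
  have B: "basis_det (cone_basis oj ?F) (?x # row_basis i \<sigma> G) =
      basis_det (row_basis i \<sigma> F) (?x # row_basis i \<sigma> G) * basis_det (cone_basis oj ?F) (row_basis i \<sigma> F)"
    by (rule basis_det_mult[OF hF rF b2'])
  have C: "?x # row_basis i \<sigma> G = map (hom_embed i) ((x, 1) # cone_basis (ori i) G) @ ?T"
    by (simp add: row_basis_def hom_embed_join_embed)
  have "basis_det (row_basis i \<sigma> F) (?x # row_basis i \<sigma> G) =
      basis_det (map (hom_embed i) (cone_basis (ori i) F)) (map (hom_embed i) ((x, 1) # cone_basis (ori i) G))"
    unfolding C unfolding row_basis_def
  proof (rule basis_det_append)
    show "basis_list (map (hom_embed i) (cone_basis (ori i) F) @ ?T) (cone_span ?F)" using rF unfolding row_basis_def .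
    show "set (map (hom_embed i) ((x, 1) # cone_basis (ori i) G)) \<subseteq> span (set (map (hom_embed i) (cone_basis (ori i) F)))"
      using basis_list_hom_embed[OF cone_basis_basis[OF ori F]] b3'(1) by (auto simp: basis_list_def)
    show "length (map (hom_embed i) ((x, 1) # cone_basis (ori i) G)) = length (map (hom_embed i) (cone_basis (ori i) F))"
      using b3'(2) by simp
  qed
  also have "\<dots> = basis_det (cone_basis (ori i) F) ((x, 1) # cone_basis (ori i) G)"
    by (rule basis_det_map[OF linear_hom_embed basis_list_hom_embed[OF cone_basis_basis[OF ori F]] cone_basis_basis[OF ori F] b3'])
  finally have D: "basis_det (row_basis i \<sigma> F) (?x # row_basis i \<sigma> G) = basis_det (cone_basis (ori i) F) ((x, 1) # cone_basis (ori i) G)" .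
  have 2: "sgn (basis_det (cone_basis oj ?F) (?x # row_basis i \<sigma> G)) = real_of_int (aug_incidence (ori i) F G * eta i \<sigma> F)"
    unfolding B D sgn_mult of_int_mult eta_sgn[of \<sigma>, OF s F] aug_incidence_eq[OF ori F G cell_polytope[OF F] fac x] ..
  have "eta i \<sigma> G * aug_incidence oj ?F ?G = aug_incidence (ori i) F G * eta i \<sigma> F"
    using 1 2 of_int_eq_iff[where 'a = real] by metis
  then have "eta i \<sigma> G * eta i \<sigma> G * aug_incidence oj ?F ?G = eta i \<sigma> F * eta i \<sigma> G * aug_incidence (ori i) F G"
    by (simp add: algebra_simps)
  then show ?thesis by (simp add: eta_square)
qed

end

section \<open>Exactness over the field\<close>

definition scalar_chain :: "'a::euclidean_space set set \<Rightarrow> int \<Rightarrow> ('a set \<Rightarrow> 'k::field) \<Rightarrow> bool" where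
  "scalar_chain X d a \<longleftrightarrow> (\<forall>F. a F \<noteq> 0 \<longrightarrow> F \<in> X \<and> aff_dim F = d)"

text \<open>Degrees are integers, so that -1, the degree of the empty cell, is included. The
  argument \<open>K\<close> names the coefficient field, which the other arguments do not
  determine.\<close>

definition scalar_exact :: "'k::field itself \<Rightarrow> 'a::euclidean_space set set \<Rightarrow> ('a set \<Rightarrow> 'a list) \<Rightarrow> int \<Rightarrow> bool" where
  "scalar_exact K X ori d \<longleftrightarrow> (\<forall>a :: 'a set \<Rightarrow> 'k. scalar_chain X d a \<and> (\<forall>G. aug_boundary X ori a G = 0) \<longrightarrow>
     (\<exists>b. scalar_chain X (d + 1) b \<and> (\<forall>G. aug_boundary X ori b G = a G)))"

lemma aug_boundary_add: "aug_boundary X ori (\<lambda>F. a F + b F) G = aug_boundary X ori a G + aug_boundary X ori b G"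
  by (simp add: aug_boundary_def algebra_simps sum.distrib)

lemma aug_boundary_diff: "aug_boundary X ori (\<lambda>F. a F - b F) G = aug_boundary X ori a G - aug_boundary X ori b G"
  by (simp add: aug_boundary_def algebra_simps sum_subtractf)

lemma scalar_chain_aug_boundary:
  assumes "polyhedral_complex X" "scalar_chain X (d + 1) a"
  shows "scalar_chain X d (aug_boundary X ori a)"
  unfolding scalar_chain_def
proof (intro allI impI)
  fix G assume "aug_boundary X ori a G \<noteq> 0"
  then obtain F where F: "F \<in> X" "aug_facet G F" "of_int (aug_incidence ori F G) * a F \<noteq> 0"
    unfolding aug_boundary_def by (metis (mono_tags, lifting) mem_Collect_eq sum.neutral)
  then have "aff_dim F = d + 1" using assms(2) unfolding scalar_chain_def by auto
  moreover have "G \<in> X" using assms(1) F aug_facetD(1) unfolding polyhedral_complex_def by blast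
  ultimately show "G \<in> X \<and> aff_dim G = d" using aug_facetD(3)[OF F(2)] by simp
qed

lemma aug_boundary_outside:
  assumes "polyhedral_complex X" "G \<notin> X"
  shows "aug_boundary X ori a G = 0"
proof -
  have *: "{F. F \<in> X \<and> aug_facet G F} = {}" using assms aug_facetD(1) unfolding polyhedral_complex_def by blast
  show ?thesis unfolding aug_boundary_def * by simp
qed

text \<open>Chains of degree -1 are multiples of the empty cell, which is the boundary of any
  vertex; in lower degrees there are no nonzero chains. The nonempty cell \<open>P\<close> provides
  the vertex.\<close>

lemma scalar_exact_negative:
  assumes "polyhedral_complex X" "orientation X ori" "P \<in> X" "P \<noteq> {}" "d < 0"
  shows "scalar_exact K X ori d"
  unfolding scalar_exact_def
proof (intro allI impI)
  fix a :: "'a set \<Rightarrow> 'k::field"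
  assume a: "scalar_chain X d a \<and> (\<forall>G. aug_boundary X ori a G = 0)"
  have poly: "polytope P" and cl: "\<And>F. F face_of P \<Longrightarrow> F \<in> X" and fin: "finite X"
    using assms unfolding polyhedral_complex_def by blast+
  have "P = convex hull {x. x extreme_point_of P}"
    by (rule Krein_Milman_Minkowski) (use poly polytope_imp_compact polytope_imp_convex in auto)
  then have "{x. x extreme_point_of P} \<noteq> {}" using assms(4) by (metis convex_hull_empty)
  then obtain v where "{v} face_of P" by (auto simp: face_of_singleton)
  then have v: "{v} \<in> X" using cl by blast
  define b where "b F = (if F = {v} then a {} else 0)" for F
  have neg: "F = {}" if "aff_dim F < 0" for F :: "'a set"
    using that aff_dim_geq[of F] by (metis aff_dim_negative_iff)
  have pf: "aug_facet G {v} \<longleftrightarrow> G = {}" for G by (auto simp: aug_facet_def aff_dim_empty[symmetric])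
  have "aug_boundary X ori b G = a G" for G
  proof -
    have "aug_boundary X ori b G = (\<Sum>F\<in>X. if F = {v} then (if aug_facet G {v} then of_int (aug_incidence ori {v} G) * a {} else 0) else 0)"
      unfolding aug_boundary_alt[OF fin] by (intro sum.cong) (auto simp: b_def)
    also have "\<dots> = (if aug_facet G {v} then of_int (aug_incidence ori {v} G) * a {} else 0)"
      using v fin by simp
    also have "\<dots> = a G"
    proof (cases "G = {}")
      case True
      then show ?thesis using aug_incidence_vertex[OF assms(2) v] pf[of "{}"] by simp
    next
      case False
      then have "a G = 0" using a neg[of G] assms(5) unfolding scalar_chain_def by auto
      then show ?thesis using False pf[of G] by simp
    qed
    finally show ?thesis .
  qed
  moreover have "scalar_chain X (d + 1) b"
    unfolding scalar_chain_def
  proof (intro allI impI)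
    fix F assume "b F \<noteq> 0"
    then have "F = {v}" "a {} \<noteq> 0" by (auto simp: b_def split: if_splits)
    moreover have "aff_dim ({} :: 'a set) = d" using a \<open>a {} \<noteq> 0\<close> unfolding scalar_chain_def by blast
    ultimately show "F \<in> X \<and> aff_dim F = d + 1" using v by simp
  qed
  ultimately show "\<exists>b. scalar_chain X (d + 1) b \<and> (\<forall>G. aug_boundary X ori b G = a G)" by blast
qed

section \<open>Filtration of a join by the dimension of the factors other than
  \<open>i\<close>\<close>

context oriented_join
begin

definition part :: "(('a \<times> real) ^ 'n) set \<Rightarrow> 'n \<Rightarrow> 'a set" where
  "part C = (\<lambda>j. join_embed j -` C)"

lemma part_join: "(\<And>j. \<sigma> j \<in> X j) \<Longrightarrow> part (join_cell \<sigma>) = \<sigma>"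
  unfolding part_def by (rule ext, rule join_cell_vimage) (use cell_convex in blast)

lemma J_cases:
  assumes "C \<in> J" obtains "\<And>j. part C j \<in> X j" "join_cell (part C) = C"
proof -
  obtain \<sigma> where s: "C = join_cell \<sigma>" "\<And>j. \<sigma> j \<in> X j" using assms by (auto simp: join_complex_def)
  then show ?thesis using that part_join[of \<sigma>] by simp
qed

text \<open>One of the two indices of the double complex; the other is the dimension of
  \<open>part C i\<close>.\<close>

definition height :: "'n \<Rightarrow> (('a \<times> real) ^ 'n) set \<Rightarrow> int" where
  "height i C = aff_dim (join_cell ((part C)(i := {})))"

lemma part_upd:
  assumes "\<And>j. \<sigma> j \<in> X j" "F \<in> X i"
  shows "part (join_cell (\<sigma>(i := F))) = \<sigma>(i := F)"
  by (rule part_join) (use assms in auto)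

lemma height_upd:
  assumes "\<And>j. \<sigma> j \<in> X j" "F \<in> X i"
  shows "height i (join_cell (\<sigma>(i := F))) = aff_dim (join_cell (\<sigma>(i := {})))"
  unfolding height_def part_upd[of \<sigma>, OF assms] by simp

text \<open>Passing to a larger cell can only enlarge the factors. If a factor other than
  \<open>i\<close> grows, the join of those factors gains dimension. If that dimension stays the
  same, the growth took place in factor \<open>i\<close> alone.\<close>

lemma aug_facet_height:
  assumes s: "\<And>j. \<sigma> j \<in> X j" and si: "\<sigma> i = {}" and G: "G \<in> X i" and C: "C \<in> J"
    and fac: "aug_facet (join_cell (\<sigma>(i := G))) C"
  shows "height i C \<ge> aff_dim (join_cell \<sigma>)"
    and "height i C = aff_dim (join_cell \<sigma>) \<Longrightarrow> C = join_cell (\<sigma>(i := part C i))"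
proof -
  obtain p: "\<And>j. part C j \<in> X j" "join_cell (part C) = C" using J_cases[OF C] by blast
  have cp: "convex (part C j)" for j using cell_convex[OF p(1)] .
  have cs: "convex (\<sigma> j)" for j using cell_convex[OF s] .
  have cu: "convex ((\<sigma>(i := G)) j)" for j using cs cell_convex[OF G] by simp
  have ce: "convex (((part C)(i := {})) j)" for j using cp by simp
  have "join_cell (\<sigma>(i := G)) face_of join_cell (part C)" using aug_facetD(1)[OF fac] p(2) by simp
  then have "\<forall>j. (\<sigma>(i := G)) j face_of part C j"
    using join_cell_face_iff[of "part C" "\<sigma>(i := G)", OF cp cu] by blast
  then have f: "\<sigma> j face_of ((part C)(i := {})) j" for j using si by (auto split: if_splits)
  have face: "join_cell \<sigma> face_of join_cell ((part C)(i := {}))"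
    by (rule join_cell_face[OF ce f])
  then show "height i C \<ge> aff_dim (join_cell \<sigma>)"
    unfolding height_def by (intro aff_dim_subset face_of_imp_subset)
  assume "height i C = aff_dim (join_cell \<sigma>)"
  then have "join_cell \<sigma> = join_cell ((part C)(i := {}))"
    using face_of_aff_dim_lt[OF convex_join_cell face] unfolding height_def by auto
  then have "\<sigma> = (part C)(i := {})" by (rule join_cell_inj[OF cs ce])
  then have "\<sigma>(i := part C i) = part C" by auto
  then show "C = join_cell (\<sigma>(i := part C i))" using p(2) by simp
qed

text \<open>Cells outside the row of \<open>\<sigma>\<close> that have the given cell as a facet
  have greater height, and there \<open>c\<close> vanishes. Within the row,
  \<open>aug_incidence_join\<close> turns the incidences into those of factor
  \<open>i\<close>.\<close>

lemma aug_boundary_row: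
  fixes c :: "(('a \<times> real) ^ 'n) set \<Rightarrow> 'k::field"
  assumes s: "\<And>j. \<sigma> j \<in> X j" and si: "\<sigma> i = {}" and G: "G \<in> X i"
    and c: "\<And>C. C \<in> J \<Longrightarrow> c C \<noteq> 0 \<Longrightarrow> height i C \<le> aff_dim (join_cell \<sigma>)"
  shows "aug_boundary J oj c (join_cell (\<sigma>(i := G))) =
    of_int (eta i \<sigma> G) * aug_boundary (X i) (ori i) (\<lambda>F. of_int (eta i \<sigma> F) * c (join_cell (\<sigma>(i := F)))) G"
proof -
  let ?f = "\<lambda>F. join_cell (\<sigma>(i := F))"
  let ?A = "{F. F \<in> X i \<and> aug_facet G F}"
  have inj: "inj_on ?f ?A"
  proof (rule inj_onI)
    fix F F' assume "F \<in> ?A" "F' \<in> ?A" "?f F = ?f F'"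
    then have "\<sigma>(i := F) = \<sigma>(i := F')" using part_upd[of \<sigma>, OF s] by (metis mem_Collect_eq)
    then show "F = F'" by (metis fun_upd_same)
  qed
  have sub: "?f ` ?A \<subseteq> {C. C \<in> J \<and> aug_facet (?f G) C}"
    using J_upd[of \<sigma>, OF s] aug_facet_join_upd[of \<sigma>, OF s _ G] by auto
  have zero: "c C = 0" if C: "C \<in> J" "aug_facet (?f G) C" "C \<notin> ?f ` ?A" for C
  proof (rule ccontr)
    assume "c C \<noteq> 0"
    then have "height i C = aff_dim (join_cell \<sigma>)"
      using c[OF C(1)] aug_facet_height(1)[of \<sigma>, OF s si G C(1,2)] by simp
    then have C': "C = ?f (part C i)" by (rule aug_facet_height(2)[of \<sigma>, OF s si G C(1,2)])
    have pi: "part C i \<in> X i" using J_cases[OF C(1)] by blast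
    have "aug_facet (?f G) (?f (part C i))" using C(2) C' by simp
    then have "aug_facet G (part C i)" using aug_facet_join_upd[of \<sigma>, OF s pi G] by simp
    then show False using C(3) C' pi by blast
  qed
  have "aug_boundary J oj c (?f G) = (\<Sum>C\<in>?f ` ?A. of_int (aug_incidence oj C (?f G)) * c C)"
    unfolding aug_boundary_def
  proof (rule sum.mono_neutral_right[OF _ sub])
    show "finite {C. C \<in> J \<and> aug_facet (?f G) C}" using J_finite by simp
  qed (use zero in auto)
  also have "\<dots> = (\<Sum>F\<in>?A. of_int (aug_incidence oj (?f F) (?f G)) * c (?f F))"
    by (rule sum.reindex_cong[OF inj refl refl])
  also have "\<dots> = (\<Sum>F\<in>?A. of_int (eta i \<sigma> G) * (of_int (aug_incidence (ori i) F G) * (of_int (eta i \<sigma> F) * c (?f F))))"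
  proof (rule sum.cong[OF refl])
    fix F assume F: "F \<in> ?A"
    then have "aug_incidence oj (?f F) (?f G) = eta i \<sigma> F * eta i \<sigma> G * aug_incidence (ori i) F G"
      using aug_incidence_join[of \<sigma>, OF s _ G] by blast
    then show "of_int (aug_incidence oj (?f F) (?f G)) * c (?f F) =
        of_int (eta i \<sigma> G) * (of_int (aug_incidence (ori i) F G) * (of_int (eta i \<sigma> F) * c (?f F)))"
      by (simp add: mult_ac)
  qed
  finally show ?thesis unfolding aug_boundary_def by (simp add: sum_distrib_left)
qed

text \<open>The part of a cycle on cells of largest height is itself a cycle for the boundary in direction
  \<open>i\<close>; correcting by a preimage under that boundary lowers the height.\<close>

lemma scalar_exact_J_row:
  assumes ex: "\<And>d. scalar_exact TYPE('k::field) (X i) (ori i) d"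
  shows "scalar_exact TYPE('k) J oj e"
proof -
  \<comment> \<open>Induction on a bound for the heights. At \<open>n = 0\<close> the bound is -1,
    the dimension of the empty cell and the least possible height, so that the chain is
    zero.\<close>
  have "\<exists>b. scalar_chain J (e + 1) b \<and> (\<forall>C. aug_boundary J oj b C = a C)"
    if "scalar_chain J e a" "\<forall>C. aug_boundary J oj a C = 0" "\<forall>C. a C \<noteq> 0 \<longrightarrow> height i C < int n - 1"
    for n and a :: "(('a \<times> real) ^ 'n) set \<Rightarrow> 'k"
    using that
  proof (induction n arbitrary: a)
    case 0
    have "a C = 0" for C
      using 0(3) aff_dim_geq[of "join_cell ((part C)(i := {}))"] unfolding height_def by force
    then show ?case by (intro exI[of _ "\<lambda>_. 0"]) (auto simp: scalar_chain_def aug_boundary_def)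
  next
    case (Suc n)
    define p where "p = int n - 1"
    have aC: "C \<in> J" "aff_dim C = e" "height i C \<le> p" if "a C \<noteq> 0" for C
      using Suc.prems that unfolding scalar_chain_def p_def by auto
    define row where "row \<sigma> F = (if F \<in> X i then of_int (eta i \<sigma> F) * a (join_cell (\<sigma>(i := F))) else 0)" for \<sigma> F
    \<comment> \<open>A row of height \<open>p\<close>, the largest height that may occur in
      \<open>a\<close>, is indexed by its fixed factors, with \<open>{}\<close> in place
      \<open>i\<close>.\<close>
    define R where "R = {\<sigma>. (\<forall>j. \<sigma> j \<in> X j) \<and> \<sigma> i = {} \<and> aff_dim (join_cell \<sigma>) = p}"
    have eta2: "of_int (eta i \<sigma> F) * (of_int (eta i \<sigma> F) * x) = (x :: 'k)" for \<sigma> F x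
      by (metis eta_square mult.assoc mult_1 of_int_1 of_int_mult)
    have upd_empty: "\<sigma>(i := {}) = \<sigma>" if "\<sigma> \<in> R" for \<sigma> using that unfolding R_def by (intro fun_upd_idem) simp
    have aug_boundary_cong: "aug_boundary (X i) (ori i) f G = aug_boundary (X i) (ori i) g G" if "\<And>F. F \<in> X i \<Longrightarrow> f F = g F" for f g :: "'a set \<Rightarrow> 'k" and G
      unfolding aug_boundary_def by (intro sum.cong) (use that in auto)
    \<comment> \<open>By \<open>aff_dim_join_upd\<close>, a cell of dimension \<open>e\<close> in a
      row of height \<open>p\<close> has an \<open>i\<close>-th factor of dimension
      \<open>e - p - 1\<close>. Each such row is a cycle in factor \<open>i\<close>, since nothing
      of greater height contributes to the boundary of \<open>a\<close> there.\<close>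
    have row_ex: "\<exists>b. scalar_chain (X i) (e - p - 1 + 1) b \<and> (\<forall>G. aug_boundary (X i) (ori i) b G = row \<sigma> G)" if R: "\<sigma> \<in> R" for \<sigma>
    proof -
      have s: "\<And>j. \<sigma> j \<in> X j" and si: "\<sigma> i = {}" and dim: "aff_dim (join_cell \<sigma>) = p" using R by (auto simp: R_def)
      have "scalar_chain (X i) (e - p - 1) (row \<sigma>)"
        unfolding scalar_chain_def
      proof (intro allI impI)
        fix F assume "row \<sigma> F \<noteq> 0"
        then have F: "F \<in> X i" "a (join_cell (\<sigma>(i := F))) \<noteq> 0" by (auto simp: row_def split: if_splits)
        then show "F \<in> X i \<and> aff_dim F = e - p - 1"
          using aff_dim_join_upd[of \<sigma>, OF s F(1)] aC(2)[OF F(2)] dim upd_empty[OF R] by simp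
      qed
      moreover have "aug_boundary (X i) (ori i) (row \<sigma>) G = 0" for G
      proof (cases "G \<in> X i")
        case True
        have "0 = of_int (eta i \<sigma> G) * aug_boundary (X i) (ori i) (\<lambda>F. of_int (eta i \<sigma> F) * a (join_cell (\<sigma>(i := F)))) G"
          using aug_boundary_row[of \<sigma>, OF s si True, of a] aC(3) dim Suc.prems(2) by simp
        then have "of_int (eta i \<sigma> G) * 0 = of_int (eta i \<sigma> G) * (of_int (eta i \<sigma> G) *
            aug_boundary (X i) (ori i) (\<lambda>F. of_int (eta i \<sigma> F) * a (join_cell (\<sigma>(i := F)))) G)" by simp
        then have "aug_boundary (X i) (ori i) (\<lambda>F. of_int (eta i \<sigma> F) * a (join_cell (\<sigma>(i := F)))) G = 0"
          unfolding eta2 by simp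
        moreover have "aug_boundary (X i) (ori i) (row \<sigma>) G = aug_boundary (X i) (ori i) (\<lambda>F. of_int (eta i \<sigma> F) * a (join_cell (\<sigma>(i := F)))) G"
          by (rule aug_boundary_cong) (simp add: row_def)
        ultimately show ?thesis by simp
      next
        case False
        then show ?thesis by (rule aug_boundary_outside[OF complex])
      qed
      ultimately show ?thesis using ex[of "e - p - 1"] unfolding scalar_exact_def by blast
    qed
    then obtain br where br: "\<And>\<sigma>. \<sigma> \<in> R \<Longrightarrow> scalar_chain (X i) (e - p) (br \<sigma>)"
      and br_aug_boundary: "\<And>\<sigma> G. \<sigma> \<in> R \<Longrightarrow> aug_boundary (X i) (ori i) (br \<sigma>) G = row \<sigma> G"
      by (simp) metis
    \<comment> \<open>The preimages found in the rows are glued together. Multiplying by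
      \<open>eta\<close> once more undoes the rescaling, as this sign is its own inverse.\<close>
    define b where "b C = (if C \<in> J \<and> (part C)(i := {}) \<in> R
      then of_int (eta i ((part C)(i := {})) (part C i)) * br ((part C)(i := {})) (part C i) else 0)" for C
    have b_upd: "b (join_cell (\<sigma>(i := F))) = of_int (eta i \<sigma> F) * br \<sigma> F" if "\<sigma> \<in> R" "F \<in> X i" for \<sigma> F
    proof -
      have s: "\<And>j. \<sigma> j \<in> X j" using that by (auto simp: R_def)
      show ?thesis
        using that J_upd[of \<sigma>, OF s that(2)] upd_empty[OF that(1)] by (simp add: b_def part_upd[of \<sigma>, OF s that(2)])
    qed
    have bC: "C \<in> J" "height i C = p" "aff_dim C = e + 1" if "b C \<noteq> 0" for C
    proof -
      show C: "C \<in> J" using that by (auto simp: b_def split: if_splits)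
      obtain pc: "\<And>j. part C j \<in> X j" "join_cell (part C) = C" using J_cases[OF C] by blast
      let ?s = "(part C)(i := {})"
      have R: "?s \<in> R" and nz: "br ?s (part C i) \<noteq> 0" using that by (auto simp: b_def split: if_splits)
      then show h: "height i C = p" by (simp add: height_def R_def)
      have "aff_dim (part C i) = e - p" using br[OF R] nz unfolding scalar_chain_def by blast
      then show "aff_dim C = e + 1"
        using aff_dim_join_upd[of "part C", OF pc(1) pc(1)[of i]] h pc(2) by (simp add: height_def)
    qed
    have kb: "scalar_chain J (e + 1) b" using bC unfolding scalar_chain_def by blast
    \<comment> \<open>In height \<open>p\<close> the boundary of \<open>b\<close> agrees with
      \<open>a\<close>, and above that height both vanish. The terms that the boundary of
      \<open>b\<close> adds in lower heights are left to the induction hypothesis.\<close>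
    define a' where "a' C = a C - aug_boundary J oj b C" for C
    have "scalar_chain J e a'"
      using Suc.prems(1) scalar_chain_aug_boundary[OF polyhedral_J kb, of oj] unfolding scalar_chain_def a'_def by force
    moreover have "\<forall>C. aug_boundary J oj a' C = 0"
      unfolding a'_def[abs_def] aug_boundary_diff aug_boundary_aug_boundary[OF polyhedral_J oj] using Suc.prems(2) by simp
    moreover have "\<forall>C. a' C \<noteq> 0 \<longrightarrow> height i C < int n - 1"
    proof (intro allI impI, rule ccontr)
      fix C assume nz: "a' C \<noteq> 0" and "\<not> height i C < int n - 1"
      then have h: "height i C \<ge> p" by (simp add: p_def)
      have CJ: "C \<in> J" using nz \<open>scalar_chain J e a'\<close> unfolding scalar_chain_def by blast
      obtain pc: "\<And>j. part C j \<in> X j" "join_cell (part C) = C" using J_cases[OF CJ] by blast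
      define \<sigma> where "\<sigma> = (part C)(i := {})"
      define G where "G = part C i"
      have s: "\<And>j. \<sigma> j \<in> X j" using pc cell_empty by (simp add: \<sigma>_def)
      have si: "\<sigma> i = {}" by (simp add: \<sigma>_def)
      have G: "G \<in> X i" using pc by (simp add: G_def)
      have C: "C = join_cell (\<sigma>(i := G))" using pc by (simp add: \<sigma>_def G_def)
      have hs: "height i C = aff_dim (join_cell \<sigma>)" by (simp add: height_def \<sigma>_def)
      have row: "aug_boundary J oj b C = of_int (eta i \<sigma> G) * aug_boundary (X i) (ori i) (\<lambda>F. of_int (eta i \<sigma> F) * b (join_cell (\<sigma>(i := F)))) G"
        unfolding C by (rule aug_boundary_row[of \<sigma>, OF s si G]) (use bC h hs in auto)
      have "a' C = 0"
      proof (cases "height i C = p")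
        case True
        then have R: "\<sigma> \<in> R" using s si hs by (simp add: R_def)
        have "aug_boundary (X i) (ori i) (\<lambda>F. of_int (eta i \<sigma> F) * b (join_cell (\<sigma>(i := F)))) G = aug_boundary (X i) (ori i) (br \<sigma>) G"
          by (rule aug_boundary_cong) (simp add: b_upd[OF R] eta2)
        then have "aug_boundary J oj b C = of_int (eta i \<sigma> G) * row \<sigma> G" using row br_aug_boundary[OF R] by simp
        also have "\<dots> = a C" using G by (simp add: row_def eta2 C)
        finally show ?thesis by (simp add: a'_def)
      next
        case False
        then have "a C = 0" using aC(3)[of C] h by force
        have "b (join_cell (\<sigma>(i := F))) = 0" if "F \<in> X i" for F
        proof (rule ccontr)
          assume "b (join_cell (\<sigma>(i := F))) \<noteq> 0"
          from bC(2)[OF this] height_upd[of \<sigma>, OF s that] show False using False hs by (simp add: \<sigma>_def)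
        qed
        then have "aug_boundary (X i) (ori i) (\<lambda>F. of_int (eta i \<sigma> F) * b (join_cell (\<sigma>(i := F)))) G = aug_boundary (X i) (ori i) (\<lambda>F. 0) G"
          by (intro aug_boundary_cong) simp
        then have "aug_boundary J oj b C = 0" using row by (simp add: aug_boundary_def)
        then show ?thesis using \<open>a C = 0\<close> by (simp add: a'_def)
      qed
      then show False using nz by simp
    qed
    ultimately obtain b' where b': "scalar_chain J (e + 1) b'" "\<forall>C. aug_boundary J oj b' C = a' C" using Suc.IH by blast
    have "scalar_chain J (e + 1) (\<lambda>C. b C + b' C)" using kb b'(1) unfolding scalar_chain_def by force
    moreover have "\<forall>C. aug_boundary J oj (\<lambda>C. b C + b' C) C = a C" unfolding aug_boundary_add using b'(2) by (simp add: a'_def)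
    ultimately show ?case by blast
  qed
  then have *: "\<exists>b. scalar_chain J (e + 1) b \<and> (\<forall>C. aug_boundary J oj b C = a C)"
    if "scalar_chain J e a" "\<forall>C. aug_boundary J oj a C = 0" "\<forall>C. a C \<noteq> 0 \<longrightarrow> height i C < int n - 1"
    for n and a :: "(('a \<times> real) ^ 'n) set \<Rightarrow> 'k" using that by blast
  \<comment> \<open>Heights do not exceed the dimension of the ambient space, and
    \<open>int n - 1\<close> has to be strictly larger: hence the summand 2.\<close>
  have "height i C < int (DIM(('a \<times> real) ^ 'n) + 2) - 1" for C
    unfolding height_def using aff_dim_le_DIM[of "join_cell ((part C)(i := {}))"] by linarith
  then show ?thesis unfolding scalar_exact_def using *[where n = "DIM(('a \<times> real) ^ 'n) + 2"] by blast
qed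

text \<open>The assumption stops at degree 0 because a factor without vertices is not exact in
  degree -1: its empty cell is a cycle that bounds nothing. A factor with a nonempty cell is exact
  in the negative degrees as well and can serve as the row direction.\<close>

lemma scalar_exact_J:
  assumes "\<And>i d. d \<ge> 0 \<Longrightarrow> scalar_exact TYPE('k::field) (X i) (ori i) d" and "e \<ge> 0"
  shows "scalar_exact TYPE('k) J oj e"
proof (cases "\<exists>i. \<exists>P\<in>X i. P \<noteq> {}")
  case True
  then obtain i P where P: "P \<in> X i" "P \<noteq> {}" by blast
  have "scalar_exact TYPE('k) (X i) (ori i) d" for d
    using assms(1)[of d i] scalar_exact_negative[OF complex ori P, of d] by (metis not_less)
  then show ?thesis by (rule scalar_exact_J_row)
next
  case False
  have "C = {}" if C: "C \<in> J" for C
  proof -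
    obtain \<sigma> where "C = join_cell \<sigma>" "\<forall>i. \<sigma> i \<in> X i" using C unfolding join_complex_def by blast
    moreover from this have "\<sigma> = (\<lambda>i. {})" using False by (intro ext) metis
    ultimately show ?thesis by (simp add: join_cell_empty)
  qed
  have zero: "a C = 0" if a: "scalar_chain J e a" for a :: "(('a \<times> real) ^ 'n) set \<Rightarrow> 'k" and C
  proof (rule ccontr)
    assume "a C \<noteq> 0"
    then have "C \<in> J" "aff_dim C = e" using a unfolding scalar_chain_def by blast+
    then show False using \<open>\<And>C. C \<in> J \<Longrightarrow> C = {}\<close>[of C] assms(2) by (metis aff_dim_negative_iff not_less)
  qed
  have "scalar_chain J (e + 1) (\<lambda>_. 0 :: 'k)" by (simp add: scalar_chain_def)
  moreover have "aug_boundary J oj (\<lambda>_. 0) C = a C" if "scalar_chain J e a" for a :: "(('a \<times> real) ^ 'n) set \<Rightarrow> 'k" and C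
    using zero[OF that] by (simp add: aug_boundary_def)
  ultimately show ?thesis unfolding scalar_exact_def by blast
qed

end

section \<open>Splitting into multidegrees\<close>

definition mono_dvd :: "monomial \<Rightarrow> monomial \<Rightarrow> bool" where
  "mono_dvd a m \<longleftrightarrow> (\<forall>v. Poly_Mapping.lookup a v \<le> Poly_Mapping.lookup m v)"

lemma mono_dvd_refl [simp]: "mono_dvd a a" and mono_dvd_0 [simp]: "mono_dvd 0 a" and mono_dvd_add [simp]: "mono_dvd b (a + b)"
  by (simp_all add: mono_dvd_def lookup_add)

lemma mono_dvd_trans: "mono_dvd a b \<Longrightarrow> mono_dvd b c \<Longrightarrow> mono_dvd a c"
  unfolding mono_dvd_def using order_trans by blast

lemma mono_dvd_diff_add: "mono_dvd a m \<Longrightarrow> m - a + a = m"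
  unfolding mono_dvd_def by (intro poly_mapping_eqI) (simp add: lookup_add lookup_minus)

text \<open>Antisymmetry of divisibility, taking each of the two monomials for \<open>m\<close>.
  Labels are compared through their multiples, so that lcms enter only by their universal property
  \<open>mono_dvd_lcm\<close>.\<close>

lemma mono_dvd_eqI: "(\<And>m. mono_dvd a m \<longleftrightarrow> mono_dvd b m) \<Longrightarrow> a = b"
  by (intro poly_mapping_eqI order_antisym) (metis mono_dvd_def mono_dvd_refl)+

lemma mono_dvd_diff: "mono_dvd g f \<Longrightarrow> mono_dvd g m \<Longrightarrow> mono_dvd (f - g) (m - g) \<longleftrightarrow> mono_dvd f m"
  unfolding mono_dvd_def lookup_minus by (metis diff_le_mono eq_diff_iff le_diff_iff)

lemma diff_diff_monomial: "mono_dvd g f \<Longrightarrow> mono_dvd g m \<Longrightarrow> m - g - (f - g) = m - f" for f g m :: monomial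
  unfolding mono_dvd_def by (intro poly_mapping_eqI) (simp add: lookup_minus)

lemma keys_diff_monomial: "Poly_Mapping.keys (m - a :: monomial) \<subseteq> Poly_Mapping.keys m"
  by (auto simp: in_keys_iff lookup_minus)

lemma keys_add_monomial: "Poly_Mapping.keys (a + b :: monomial) = Poly_Mapping.keys a \<union> Poly_Mapping.keys b"
  by (auto simp: in_keys_iff lookup_add)

lemma mono_dvd_lcm:
  assumes "finite M"
  shows "mono_dvd (lcm_monomial M) m \<longleftrightarrow> (\<forall>a\<in>M. mono_dvd a m)"
  using assms by (auto simp: mono_dvd_def lookup_lcm_monomial)

lemma lookup_single_mult:
  fixes p :: "'k::field mpol"
  shows "Poly_Mapping.lookup (Poly_Mapping.single q c * p) t =
    (if mono_dvd q t then c * Poly_Mapping.lookup p (t - q) else 0)"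
proof -
  have eq: "t = q + s \<longleftrightarrow> mono_dvd q t \<and> s = t - q" for s
    by (metis add.commute add_diff_cancel_left' mono_dvd_add mono_dvd_diff_add)
  have "Poly_Mapping.lookup (Poly_Mapping.single q c * p) t =
      (\<Sum>l. (c * (\<Sum>s. Poly_Mapping.lookup p s when t = l + s)) when q = l)"
    by (simp add: lookup_mult lookup_single when_mult)
  also have "\<dots> = c * (\<Sum>s. Poly_Mapping.lookup p s when t = q + s)" by simp
  also have "(\<Sum>s. Poly_Mapping.lookup p s when t = q + s) =
      (if mono_dvd q t then Poly_Mapping.lookup p (t - q) else 0)"
    unfolding eq by simp
  finally show ?thesis by simp
qed

lemma of_int_monomial_poly: "of_int n * (monomial_poly q :: 'k::field mpol) = Poly_Mapping.single q (of_int n)"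
  unfolding monomial_poly_def single_of_int[symmetric] mult_single by simp

definition aug_cell_boundary :: "'a::euclidean_space set set \<Rightarrow> ('a set \<Rightarrow> 'a list) \<Rightarrow> ('a set \<Rightarrow> monomial) \<Rightarrow>
     ('a set \<Rightarrow> 'k::field mpol) \<Rightarrow> 'a set \<Rightarrow> 'k mpol" where
  "aug_cell_boundary X ori l c G = (\<Sum>F | F \<in> X \<and> aug_facet G F. of_int (aug_incidence ori F G) * monomial_poly (l F - l G) * c F)"

text \<open>The basis element of a cell \<open>F\<close> has degree \<open>l F\<close>, so the component of a chain in degree \<open>m\<close> is a
  chain over the field on the cells whose label divides \<open>m\<close>.\<close>

definition degree_part :: "('a set \<Rightarrow> monomial) \<Rightarrow> monomial \<Rightarrow> ('a set \<Rightarrow> 'k::field mpol) \<Rightarrow> 'a set \<Rightarrow> 'k" where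
  "degree_part l m c F = (if mono_dvd (l F) m then Poly_Mapping.lookup (c F) (m - l F) else 0)"

text \<open>The coefficient of \<open>c F\<close> at \<open>p\<close> reappears in degree
  \<open>p + l F\<close>, so the degree parts together determine the entry.\<close>

lemma degree_part_eqI:
  assumes "\<And>m. degree_part l m c F = degree_part l m c' F"
  shows "c F = c' F"
proof (rule poly_mapping_eqI)
  fix p
  show "Poly_Mapping.lookup (c F) p = Poly_Mapping.lookup (c' F) p"
    using assms[of "p + l F"] by (simp add: degree_part_def)
qed

lemma degree_part_0 [simp]: "degree_part l m (\<lambda>_. 0) F = 0"
  by (simp add: degree_part_def)

locale labelled_polyhedral =
  fixes W :: "int set" and X :: "'a::euclidean_space set set" and ori l
  assumes complex: "polyhedral_complex X" and ori: "orientation X ori" and labelled: "labelled_complex W X l"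
begin

lemma finite_X: "finite X" and cell_polytope: "P \<in> X \<Longrightarrow> polytope P" and cell_empty: "{} \<in> X"
  and cell_face: "P \<in> X \<Longrightarrow> F face_of P \<Longrightarrow> F \<in> X"
  using complex unfolding polyhedral_complex_def by blast+

lemma finite_vertex_labels: "F \<in> X \<Longrightarrow> finite {l {v} | v. {v} face_of F}"
proof -
  assume "F \<in> X"
  then have "{l {v} | v. {v} face_of F} \<subseteq> l ` X" using cell_face by blast
  then show ?thesis using finite_X finite_subset by blast
qed

lemma mono_dvd_label: "F \<in> X \<Longrightarrow> mono_dvd (l F) m \<longleftrightarrow> (\<forall>v. {v} face_of F \<longrightarrow> mono_dvd (l {v}) m)"
  using labelled mono_dvd_lcm[OF finite_vertex_labels] unfolding labelled_complex_def by auto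

lemma label_empty: "l {} = 0"
  by (rule mono_dvd_eqI) (simp add: mono_dvd_label[OF cell_empty])

lemma label_mono: "F \<in> X \<Longrightarrow> G face_of F \<Longrightarrow> mono_dvd (l G) (l F)"
  using mono_dvd_label[of F "l F"] mono_dvd_label[of G "l F"] cell_face face_of_trans by (metis mono_dvd_refl)

lemma label_keys: "F \<in> X \<Longrightarrow> Poly_Mapping.keys (l F) \<subseteq> W"
proof
  fix v assume F: "F \<in> X" and v: "v \<in> Poly_Mapping.keys (l F)"
  \<comment> \<open>Deleting a variable outside \<open>W\<close> from \<open>l F\<close> leaves a
    common multiple of the vertex labels, hence a multiple of their lcm \<open>l F\<close>. So the
    variable did not occur in \<open>l F\<close>.\<close>
  have "mono_dvd (l F) (l F - Poly_Mapping.single v (Poly_Mapping.lookup (l F) v))" if "v \<notin> W"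
    unfolding mono_dvd_label[OF F]
  proof (intro allI impI)
    fix x assume x: "{x} face_of F"
    then have "Poly_Mapping.keys (l {x}) \<subseteq> W" using labelled cell_face[OF F] unfolding labelled_complex_def by blast
    then have "Poly_Mapping.lookup (l {x}) v = 0" using \<open>v \<notin> W\<close> by (meson in_keys_iff subsetD)
    then show "mono_dvd (l {x}) (l F - Poly_Mapping.single v (Poly_Mapping.lookup (l F) v))"
      using label_mono[OF F x] by (auto simp: mono_dvd_def lookup_minus lookup_single when_def)
  qed
  then have "v \<notin> W \<Longrightarrow> Poly_Mapping.lookup (l F) v \<le> 0" by (auto simp: mono_dvd_def lookup_minus dest: spec[of _ v])
  then show "v \<in> W" using v by (auto simp: in_keys_iff)
qed

text \<open>The boundary is homogeneous: multiplication by \<open>l F - l G\<close> moves the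
  exponent \<open>m - l F\<close> to \<open>m - l G\<close>. If \<open>l G\<close> does not divide
  \<open>m\<close>, no label of a larger cell does, and both sides vanish.\<close>

lemma degree_part_aug_cell_boundary: "degree_part l m (aug_cell_boundary X ori l c) G = aug_boundary X ori (degree_part l m c) G"
proof (cases "mono_dvd (l G) m")
  case True
  have "degree_part l m (aug_cell_boundary X ori l c) G = (\<Sum>F | F \<in> X \<and> aug_facet G F.
      Poly_Mapping.lookup (Poly_Mapping.single (l F - l G) (of_int (aug_incidence ori F G)) * c F) (m - l G))"
    using True by (simp add: degree_part_def aug_cell_boundary_def lookup_sum of_int_monomial_poly)
  also have "\<dots> = (\<Sum>F | F \<in> X \<and> aug_facet G F. of_int (aug_incidence ori F G) * degree_part l m c F)"
  proof (rule sum.cong[OF refl], clarify)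
    fix F assume F: "F \<in> X" "aug_facet G F"
    then have "mono_dvd (l G) (l F)" using label_mono aug_facetD(1) by blast
    then show "Poly_Mapping.lookup (Poly_Mapping.single (l F - l G) (of_int (aug_incidence ori F G)) * c F) (m - l G) =
        of_int (aug_incidence ori F G) * degree_part l m c F"
      using True by (simp add: lookup_single_mult degree_part_def mono_dvd_diff diff_diff_monomial)
  qed
  finally show ?thesis by (simp add: aug_boundary_def)
next
  case False
  have "degree_part l m c F = 0" if "F \<in> X" "aug_facet G F" for F
    using False label_mono[OF that(1) aug_facetD(1)[OF that(2)]] mono_dvd_trans by (auto simp: degree_part_def)
  then have "aug_boundary X ori (degree_part l m c) G = 0" unfolding aug_boundary_def by (intro sum.neutral) auto
  then show ?thesis using False by (simp add: degree_part_def)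
qed

lemma aug_cell_boundary_aug_cell_boundary: "aug_cell_boundary X ori l (aug_cell_boundary X ori l c) R = (0 :: 'k::field mpol)"
proof -
  have "aug_cell_boundary X ori l (aug_cell_boundary X ori l c) R = (\<lambda>_. 0) R"
  proof (rule degree_part_eqI)
    fix m
    have "degree_part l m (aug_cell_boundary X ori l c) = aug_boundary X ori (degree_part l m c)" using degree_part_aug_cell_boundary by blast
    then show "degree_part l m (aug_cell_boundary X ori l (aug_cell_boundary X ori l c)) R = degree_part l m (\<lambda>_. 0) R"
      by (simp add: degree_part_aug_cell_boundary aug_boundary_aug_boundary[OF complex ori])
  qed
  then show ?thesis .
qed

end

lemma polyring_closed:
  shows "p \<in> carrier (polyring W) \<Longrightarrow> q \<in> carrier (polyring W) \<Longrightarrow> p + q \<in> carrier (polyring W)"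
    and "p \<in> carrier (polyring W) \<Longrightarrow> q \<in> carrier (polyring W) \<Longrightarrow> p * q \<in> carrier (polyring W)"
    and "0 \<in> carrier (polyring W)"
    and "Poly_Mapping.keys m \<subseteq> W \<Longrightarrow> Poly_Mapping.single m c \<in> carrier (polyring W)"
proof -
  show "p + q \<in> carrier (polyring W)" if "p \<in> carrier (polyring W)" "q \<in> carrier (polyring W)"
    using that keys_add[of p q] by (auto simp: polyring_def)
  show "p * q \<in> carrier (polyring W)" if "p \<in> carrier (polyring W)" "q \<in> carrier (polyring W)"
    using that keys_mult[of p q] by (fastforce simp: polyring_def keys_add_monomial)
qed (auto simp: polyring_def)

lemma polyring_sum: "(\<And>x. x \<in> A \<Longrightarrow> f x \<in> carrier (polyring W)) \<Longrightarrow> sum f A \<in> carrier (polyring W)"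
  by (induction A rule: infinite_finite_induct) (auto intro: polyring_closed)

section \<open>Passage between chains over the polynomial ring and their degree parts\<close>

context labelled_polyhedral
begin

definition below :: "monomial \<Rightarrow> 'a set set" where
  "below m = {F \<in> X. mono_dvd (l F) m}"

lemma below_subset: "below m \<subseteq> X"
  by (auto simp: below_def)

text \<open>The label of a face divides that of the cell, and the empty cell, with unit label, lies
  below every \<open>m\<close>.\<close>

lemma polyhedral_below: "polyhedral_complex (below m)"
proof -
  have face: "F \<in> below m" if "P \<in> below m" "F face_of P" for P F
    using that cell_face label_mono mono_dvd_trans unfolding below_def by blast
  have "finite (below m)" using finite_X finite_subset below_subset by blast
  moreover have "{} \<in> below m" by (simp add: below_def cell_empty label_empty)
  moreover have "\<forall>P\<in>below m. polytope P" using cell_polytope below_subset by blast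
  moreover have "\<forall>P\<in>below m. \<forall>Q\<in>below m. P \<inter> Q face_of P \<and> P \<inter> Q face_of Q"
    using complex below_subset[of m] unfolding polyhedral_complex_def by blast
  ultimately show ?thesis using face unfolding polyhedral_complex_def by blast
qed

lemma orientation_below: "orientation (below m) ori"
  using ori below_subset[of m] unfolding orientation_def by blast

lemma aug_boundary_below:
  assumes "\<And>F. a F \<noteq> 0 \<Longrightarrow> F \<in> below m"
  shows "aug_boundary (below m) ori a G = aug_boundary X ori a G"
  unfolding aug_boundary_def
proof (rule sum.mono_neutral_left)
  show "finite {F. F \<in> X \<and> aug_facet G F}" using finite_X by simp
  show "{F. F \<in> below m \<and> aug_facet G F} \<subseteq> {F. F \<in> X \<and> aug_facet G F}" using below_subset by blast
  show "\<forall>F\<in>{F. F \<in> X \<and> aug_facet G F} - {F. F \<in> below m \<and> aug_facet G F}. of_int (aug_incidence ori F G) * a F = 0"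
    using assms by (metis (mono_tags, lifting) DiffD1 DiffD2 mem_Collect_eq mult_zero_right)
qed

lemma degree_part_nonzero: "c \<in> cell_chains W X d \<Longrightarrow> degree_part l m c F \<noteq> 0 \<Longrightarrow> F \<in> below m \<and> aff_dim F = int d"
  unfolding degree_part_def below_def cell_chains_def by (force split: if_splits)

lemma scalar_chain_degree_part: "c \<in> cell_chains W X d \<Longrightarrow> scalar_chain (below m) (int d) (degree_part l m c)"
  using degree_part_nonzero unfolding scalar_chain_def by blast

lemma aug_boundary_below_degree_part: "c \<in> cell_chains W X d \<Longrightarrow> aug_boundary (below m) ori (degree_part l m c) G = degree_part l m (aug_cell_boundary X ori l c) G"
  using aug_boundary_below[of "degree_part l m c" m G] degree_part_nonzero degree_part_aug_cell_boundary by metis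

lemma degree_part_keys:
  assumes "c \<in> cell_chains W X d" "degree_part l m c F \<noteq> 0"
  shows "Poly_Mapping.keys m \<subseteq> W" "m \<in> (\<lambda>p. p + l F) ` Poly_Mapping.keys (c F)"
proof -
  have F: "F \<in> X" "mono_dvd (l F) m" using degree_part_nonzero[OF assms] by (auto simp: below_def)
  have k: "m - l F \<in> Poly_Mapping.keys (c F)" using assms(2) F by (simp add: degree_part_def in_keys_iff)
  then show "m \<in> (\<lambda>p. p + l F) ` Poly_Mapping.keys (c F)" using mono_dvd_diff_add[OF F(2)] by force
  have "Poly_Mapping.keys (m - l F) \<subseteq> W" using assms(1) k unfolding cell_chains_def polyring_def by auto
  moreover have "Poly_Mapping.keys m = Poly_Mapping.keys (m - l F) \<union> Poly_Mapping.keys (l F)"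
    using keys_add_monomial[of "m - l F" "l F"] mono_dvd_diff_add[OF F(2)] by simp
  ultimately show "Poly_Mapping.keys m \<subseteq> W" using label_keys[OF F(1)] by blast
qed

text \<open>The condition at \<open>G = {}\<close> says that the augmentation vanishes, so degree 0
  needs no separate formulation.\<close>

definition module_exact :: "'k::field itself \<Rightarrow> nat \<Rightarrow> bool" where
  "module_exact K d \<longleftrightarrow> (\<forall>c :: 'a set \<Rightarrow> 'k mpol. c \<in> cell_chains W X d \<and> (\<forall>G. aug_cell_boundary X ori l c G = 0) \<longrightarrow>
     (\<exists>b \<in> cell_chains W X (Suc d). \<forall>G. aug_cell_boundary X ori l b G = c G))"

text \<open>A scalar cycle \<open>a\<close> is lifted to the chain with entries \<open>a F\<close>
  times the monomial \<open>m - l F\<close>; these lie in the ring because \<open>m\<close> involves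
  only variables from \<open>W\<close>. The lift is homogeneous of degree \<open>m\<close>, and the
  part in degree \<open>m\<close> of any preimage solves the scalar problem.\<close>

lemma scalar_exact_of_module_exact:
  assumes "module_exact TYPE('k::field) d" "Poly_Mapping.keys m \<subseteq> W"
  shows "scalar_exact TYPE('k) (below m) ori (int d)"
  unfolding scalar_exact_def
proof (intro allI impI)
  fix a :: "'a set \<Rightarrow> 'k"
  assume a: "scalar_chain (below m) (int d) a \<and> (\<forall>G. aug_boundary (below m) ori a G = 0)"
  then have aF: "F \<in> X" "mono_dvd (l F) m" "aff_dim F = int d" if "a F \<noteq> 0" for F
    using that unfolding scalar_chain_def below_def by auto
  define c where "c F = Poly_Mapping.single (m - l F) (a F)" for F
  have "c \<in> cell_chains W X d"
    unfolding cell_chains_def mem_Collect_eq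
  proof (intro conjI allI impI)
    show "c F \<in> carrier (polyring W)" for F
      unfolding c_def using keys_diff_monomial assms(2) by (intro polyring_closed) blast
    fix F assume "c F \<noteq> 0"
    then have "a F \<noteq> 0" by (auto simp: c_def)
    then show "F \<in> X" "aff_dim F = int d" "F \<noteq> {}" using aF[of F] by auto
  qed
  moreover have cc: "degree_part l m' c F = (if m' = m then a F else 0)" for m' F
  proof (cases "a F = 0")
    case False
    have "m' - l F = m - l F \<longleftrightarrow> m' = m" if "mono_dvd (l F) m'"
      using mono_dvd_diff_add[OF that] mono_dvd_diff_add[OF aF(2)[OF False]] by metis
    then show ?thesis using aF(2)[OF False] by (auto simp: degree_part_def c_def lookup_single when_def)
  qed (simp add: degree_part_def c_def)
  moreover have "aug_cell_boundary X ori l c G = 0" for G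
  proof -
    have "aug_cell_boundary X ori l c G = (\<lambda>_. 0) G"
    proof (rule degree_part_eqI)
      fix m'
      have "degree_part l m' c = (if m' = m then a else (\<lambda>_. 0))" using cc by auto
      moreover have "aug_boundary X ori a G = 0" using a aug_boundary_below[of a m G] unfolding scalar_chain_def by simp
      ultimately show "degree_part l m' (aug_cell_boundary X ori l c) G = degree_part l m' (\<lambda>_. 0) G"
        by (simp add: degree_part_aug_cell_boundary) (simp add: aug_boundary_def)
    qed
    then show ?thesis .
  qed
  ultimately obtain b where b: "b \<in> cell_chains W X (Suc d)" "\<forall>G. aug_cell_boundary X ori l b G = c G"
    using assms(1) unfolding module_exact_def by blast
  have "scalar_chain (below m) (int d + 1) (degree_part l m b)" using scalar_chain_degree_part[OF b(1), of m] by (simp add: add.commute)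
  moreover have "aug_boundary (below m) ori (degree_part l m b) G = a G" for G
  proof -
    have "aug_cell_boundary X ori l b = c" using b(2) by blast
    then show ?thesis using aug_boundary_below_degree_part[OF b(1), of m G] cc[of m G] by simp
  qed
  ultimately show "\<exists>b. scalar_chain (below m) (int d + 1) b \<and> (\<forall>G. aug_boundary (below m) ori b G = a G)" by blast
qed

text \<open>A chain has nonzero parts in finitely many degrees only, all with variables in
  \<open>W\<close>. Scalar preimages are chosen in each of these and reassembled.\<close>

lemma module_exact_of_scalar_exact:
  assumes ex: "\<And>m. Poly_Mapping.keys m \<subseteq> W \<Longrightarrow> scalar_exact TYPE('k::field) (below m) ori (int d)"
  shows "module_exact TYPE('k) d"
  unfolding module_exact_def
proof (intro allI impI)
  fix c :: "'a set \<Rightarrow> 'k mpol"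
  assume "c \<in> cell_chains W X d \<and> (\<forall>G. aug_cell_boundary X ori l c G = 0)"
  then have c: "c \<in> cell_chains W X d" and z: "aug_cell_boundary X ori l c = (\<lambda>_. 0)" by auto
  define M where "M = {m. \<exists>F. degree_part l m c F \<noteq> 0}"
  have "M \<subseteq> (\<Union>F\<in>X. (\<lambda>p. p + l F) ` Poly_Mapping.keys (c F))"
  proof
    fix m assume "m \<in> M"
    then obtain F where F: "degree_part l m c F \<noteq> 0" by (auto simp: M_def)
    then have "F \<in> X" using degree_part_nonzero[OF c] below_subset by blast
    then show "m \<in> (\<Union>F\<in>X. (\<lambda>p. p + l F) ` Poly_Mapping.keys (c F))" using degree_part_keys(2)[OF c F] by blast
  qed
  then have finM: "finite M" by (rule finite_subset) (simp add: finite_X)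
  have MW: "Poly_Mapping.keys m \<subseteq> W" if "m \<in> M" for m using that degree_part_keys(1)[OF c] by (auto simp: M_def)
  \<comment> \<open>Choosing zero outside \<open>M\<close> keeps the reassembled coefficients
    finitely supported.\<close>
  have "\<exists>b. scalar_chain (below m) (int d + 1) b \<and> (\<forall>G. aug_boundary (below m) ori b G = degree_part l m c G) \<and> (m \<notin> M \<longrightarrow> b = (\<lambda>_. 0))" for m
  proof (cases "m \<in> M")
    case True
    have "aug_boundary (below m) ori (degree_part l m c) G = 0" for G using aug_boundary_below_degree_part[OF c, of m G] z by simp
    then show ?thesis using ex[OF MW[OF True]] scalar_chain_degree_part[OF c, of m] True unfolding scalar_exact_def by blast
  next
    case False
    then show ?thesis by (intro exI[of _ "\<lambda>_. 0"]) (auto simp: scalar_chain_def aug_boundary_def M_def)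
  qed
  then obtain \<beta> where \<beta>: "\<And>m. scalar_chain (below m) (int d + 1) (\<beta> m)" "\<And>m G. aug_boundary (below m) ori (\<beta> m) G = degree_part l m c G"
    "\<And>m. m \<notin> M \<Longrightarrow> \<beta> m = (\<lambda>_. 0)" by metis
  have \<beta>F: "F \<in> X" "mono_dvd (l F) m" "aff_dim F = int d + 1" "m \<in> M" if "\<beta> m F \<noteq> 0" for m F
  proof -
    show "m \<in> M" using \<beta>(3)[of m] that by metis
  qed (use \<beta>(1)[of m] that in \<open>auto simp: scalar_chain_def below_def\<close>)
  \<comment> \<open>This inverts \<open>degree_part\<close>: the coefficient at \<open>p\<close>
    belongs to degree \<open>p + l F\<close>.\<close>
  define b where "b F = Abs_poly_mapping (\<lambda>p. \<beta> (p + l F) F)" for F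
  have lb: "Poly_Mapping.lookup (b F) p = \<beta> (p + l F) F" for F p
  proof -
    have "{p. \<beta> (p + l F) F \<noteq> 0} \<subseteq> (\<lambda>m. m - l F) ` M" using \<beta>F(4) by force
    then have "finite {p. \<beta> (p + l F) F \<noteq> 0}" using finM finite_subset by blast
    then show ?thesis unfolding b_def by (simp add: lookup_Abs_poly_mapping)
  qed
  have cb: "degree_part l m b = \<beta> m" for m
  proof
    fix F
    show "degree_part l m b F = \<beta> m F"
      using \<beta>F(2)[of m F] mono_dvd_diff_add[of "l F" m] by (auto simp: degree_part_def lb)
  qed
  have bF: "F \<in> X \<and> aff_dim F = int d + 1 \<and> p + l F \<in> M" if "p \<in> Poly_Mapping.keys (b F)" for F p
    using that \<beta>F[of "p + l F" F] by (simp add: in_keys_iff lb)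
  have "b \<in> cell_chains W X (Suc d)"
    unfolding cell_chains_def mem_Collect_eq
  proof (intro conjI allI impI)
    show "b F \<in> carrier (polyring W)" for F
      unfolding polyring_def using bF[of _ F] MW keys_add_monomial by fastforce
    fix F assume "b F \<noteq> 0"
    then obtain p where "p \<in> Poly_Mapping.keys (b F)" by (metis all_not_in_conv keys_eq_empty)
    from bF[OF this] show "F \<in> X" "aff_dim F = int (Suc d)" "F \<noteq> {}" by auto
  qed
  moreover have "aug_cell_boundary X ori l b G = c G" for G
  proof (rule degree_part_eqI)
    fix m
    have "aug_boundary (below m) ori (\<beta> m) G = aug_boundary X ori (\<beta> m) G"
      by (rule aug_boundary_below) (use \<beta>(1)[of m] in \<open>auto simp: scalar_chain_def\<close>)
    then show "degree_part l m (aug_cell_boundary X ori l b) G = degree_part l m c G" unfolding degree_part_aug_cell_boundary cb using \<beta>(2) by simp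
  qed
  ultimately show "\<exists>b \<in> cell_chains W X (Suc d). \<forall>G. aug_cell_boundary X ori l b G = c G" by blast
qed

section \<open>From the augmented boundary back to the exactness conditions of a resolution\<close>

lemma aug_cell_boundary_empty:
  fixes c :: "'a set \<Rightarrow> 'k::field mpol"
  shows "aug_cell_boundary X ori l c {} = cell_augmentation X l c"
proof -
  have "{F. F \<in> X \<and> aug_facet {} F} = {F. F \<in> X \<and> aff_dim F = 0}" by (auto simp: aug_facet_def)
  moreover have "aug_incidence ori F {} = 1" if "F \<in> X" "aff_dim F = 0" for F
    using that aug_incidence_vertex[OF ori] by (auto simp: aff_dim_eq_0)
  ultimately show ?thesis
    unfolding aug_cell_boundary_def cell_augmentation_def by (intro sum.cong) (auto simp: label_empty)
qed

lemma aug_cell_boundary_nonempty: "G \<noteq> {} \<Longrightarrow> aug_cell_boundary X ori l c G = cell_boundary X ori l c G"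
  unfolding aug_cell_boundary_def cell_boundary_def
proof (rule sum.cong)
  assume "G \<noteq> {}"
  then show "{F. F \<in> X \<and> aug_facet G F} = {F. F \<in> X \<and> G facet_of F}" by (auto simp: facet_of_aug_facet)
  fix F assume "F \<in> {F. F \<in> X \<and> G facet_of F}"
  then have F: "F \<in> X" "G facet_of F" by auto
  then have "incidence ori F G = aug_incidence ori F G"
    using incidence_eq_aug_incidence[OF ori F(1) cell_face[OF F(1)] cell_polytope[OF F(1)] F(2)] facet_of_imp_face_of by blast
  then show "of_int (aug_incidence ori F G) * monomial_poly (l F - l G) * c F =
      of_int (incidence ori F G) * monomial_poly (l F - l G) * c F" by simp
qed

lemma cell_boundary_empty: "cell_boundary X ori l c {} = 0"
proof -
  have *: "{F. F \<in> X \<and> {} facet_of F} = {}" by (auto simp: facet_of_aug_facet)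
  show ?thesis unfolding cell_boundary_def * by simp
qed

text \<open>The two maps differ only at the empty cell, where the augmented one has the
  augmentation; that is zero on chains of positive degree, whose support contains no
  vertices.\<close>

lemma cell_boundary_eq_aug_cell_boundary:
  assumes "c \<in> cell_chains W X (Suc d)"
  shows "cell_boundary X ori l c = aug_cell_boundary X ori l c"
proof
  fix G
  have "cell_augmentation X l c = 0"
    unfolding cell_augmentation_def using assms by (intro sum.neutral) (auto simp: cell_chains_def)
  then show "cell_boundary X ori l c G = aug_cell_boundary X ori l c G"
    using aug_cell_boundary_empty[of c] aug_cell_boundary_nonempty[of G c] cell_boundary_empty by (cases "G = {}") auto
qed

lemma monomial_poly_label: "F \<in> X \<Longrightarrow> monomial_poly (l F) \<in> carrier (polyring W)"
  unfolding monomial_poly_def using label_keys by (intro polyring_closed)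

lemma aug_cell_boundary_chain:
  fixes c :: "'a set \<Rightarrow> 'k::field mpol"
  assumes c: "c \<in> cell_chains W X (Suc d)"
  shows "aug_cell_boundary X ori l c \<in> cell_chains W X d"
  unfolding cell_chains_def mem_Collect_eq
proof (intro conjI allI impI)
  have "of_int (aug_incidence ori F G) * monomial_poly (l F - l G) * c F \<in> carrier (polyring W)" if "F \<in> X" for F G
    unfolding of_int_monomial_poly using c label_keys[OF that] keys_diff_monomial[of "l F" "l G"]
    by (intro polyring_closed) (auto simp: cell_chains_def)
  then show "aug_cell_boundary X ori l c G \<in> carrier (polyring W)" for G
    unfolding aug_cell_boundary_def by (intro polyring_sum) simp
  fix G assume "aug_cell_boundary X ori l c G \<noteq> 0"
  then obtain F where F: "F \<in> X" "aug_facet G F" "of_int (aug_incidence ori F G) * monomial_poly (l F - l G) * c F \<noteq> 0"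
    unfolding aug_cell_boundary_def by (metis (mono_tags, lifting) mem_Collect_eq sum.neutral)
  then have "aff_dim F = int (Suc d)" using c unfolding cell_chains_def by auto
  then show "G \<in> X" "aff_dim G = int d" "G \<noteq> {}"
    using aug_facetD(3)[OF F(2)] cell_face[OF F(1) aug_facetD(1)[OF F(2)]] by auto
qed

lemma module_exact_iff:
  "module_exact TYPE('k::field) d \<longleftrightarrow>
    {c \<in> cell_chains W X d. \<forall>G. aug_cell_boundary X ori l c G = 0} = cell_boundary X ori l ` (cell_chains W X (Suc d) :: ('a set \<Rightarrow> 'k mpol) set)"
    (is "_ \<longleftrightarrow> ?K = _ ` ?C")
proof -
  have im: "cell_boundary X ori l ` ?C = aug_cell_boundary X ori l ` ?C"
    using cell_boundary_eq_aug_cell_boundary by (intro image_cong) auto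
  have "aug_cell_boundary X ori l ` ?C \<subseteq> ?K" using aug_cell_boundary_chain aug_cell_boundary_aug_cell_boundary by blast
  moreover have "module_exact TYPE('k) d \<longleftrightarrow> ?K \<subseteq> aug_cell_boundary X ori l ` ?C"
  proof -
    have "c \<in> aug_cell_boundary X ori l ` ?C \<longleftrightarrow> (\<exists>b\<in>?C. \<forall>G. aug_cell_boundary X ori l b G = c G)" for c
      unfolding image_iff fun_eq_iff by metis
    then show ?thesis unfolding module_exact_def subset_iff mem_Collect_eq by simp
  qed
  ultimately show ?thesis unfolding im by blast
qed

text \<open>Vertices have no nonempty facets, so only the component at the empty cell
  remains.\<close>

lemma cycles_0: "{c \<in> cell_chains W X 0. \<forall>G. aug_cell_boundary X ori l c G = 0} =
    {c \<in> cell_chains W X 0. cell_augmentation X l c = (0 :: 'k::field mpol)}"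
proof -
  have "aug_cell_boundary X ori l c G = 0" if c: "c \<in> cell_chains W X 0" and "G \<noteq> {}" for c :: "'a set \<Rightarrow> 'k mpol" and G
    unfolding aug_cell_boundary_def
  proof (rule sum.neutral, clarify)
    fix F assume F: "F \<in> X" "aug_facet G F"
    have "aff_dim F \<noteq> 0" using aug_facetD(3)[OF F(2)] aff_dim_geq[of G] \<open>G \<noteq> {}\<close> aff_dim_empty[of G] by auto
    then have "c F = 0" using c unfolding cell_chains_def by auto
    then show "of_int (aug_incidence ori F G) * monomial_poly (l F - l G) * c F = 0" by simp
  qed
  then show ?thesis using aug_cell_boundary_empty by (metis (mono_tags, lifting))
qed

lemma cycles_Suc: "{c \<in> cell_chains W X (Suc d). \<forall>G. aug_cell_boundary X ori l c G = 0} =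
    {c \<in> cell_chains W X (Suc d). cell_boundary X ori l c = (\<lambda>G. 0 :: 'k::field mpol)}"
  by (auto simp: cell_boundary_eq_aug_cell_boundary fun_eq_iff)

lemma supports_iff:
  "supports_cellular_resolution W (I :: 'k::field mpol set) X ori l \<longleftrightarrow>
    cell_augmentation X l ` cell_chains W X 0 = I \<and> (\<forall>d. module_exact TYPE('k) d)"
proof -
  have "(\<forall>d. module_exact TYPE('k) d) \<longleftrightarrow> module_exact TYPE('k) 0 \<and> (\<forall>d. module_exact TYPE('k) (Suc d))"
    by (metis not0_implies_Suc)
  then show ?thesis
    unfolding supports_cellular_resolution_def module_exact_iff cycles_0 cycles_Suc
    using complex ori labelled by simp
qed

end

section \<open>The augmentation and the edge ideal\<close>

lemma polyring_simps [simp]: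
  "monoid.mult (polyring W) = (*)" "one (polyring W) = 1" "zero (polyring W) = 0" "add (polyring W) = (+)"
  by (simp_all add: polyring_def)

lemma polyring_one: "1 \<in> carrier (polyring W)"
  by (auto simp: polyring_def)

lemma ring_polyring: "ring (polyring W :: 'k::field mpol ring)"
proof (rule ringI)
  show "abelian_group (polyring W :: 'k mpol ring)"
  proof (rule abelian_groupI)
    fix p :: "'k mpol" assume "p \<in> carrier (polyring W)"
    then have "- p \<in> carrier (polyring W)" by (auto simp: polyring_def in_keys_iff)
    then show "\<exists>q\<in>carrier (polyring W). q \<oplus>\<^bsub>polyring W\<^esub> p = \<zero>\<^bsub>polyring W\<^esub>" by force
  qed (auto simp: algebra_simps polyring_closed)
  show "monoid (polyring W :: 'k mpol ring)"
    by (rule monoidI) (auto simp: algebra_simps polyring_closed polyring_one)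
qed (auto simp: algebra_simps)

lemma ideal_sum:
  assumes "ideal I (polyring W)" "\<And>x. x \<in> A \<Longrightarrow> f x \<in> I"
  shows "sum f A \<in> I"
  using assms(2)
proof (induction A rule: infinite_finite_induct)
  case (insert x A)
  then show ?case
    using additive_subgroup.a_closed[OF ideal.axioms(1)[OF assms(1)], of "f x" "sum f A"] by simp
qed (use additive_subgroup.zero_closed[OF ideal.axioms(1)[OF assms(1)]] in auto)

section \<open>The image of the augmentation as an ideal\<close>

context labelled_polyhedral
begin

text \<open>With \<open>label_in_augmentation\<close> and \<open>ideal_augmentation\<close> this
  makes the image of the augmentation the least ideal containing the vertex labels.\<close>

lemma augmentation_subset:
  fixes I :: "'k::field mpol set"
  assumes I: "ideal I (polyring W)" and v: "\<And>x. {x} \<in> X \<Longrightarrow> monomial_poly (l {x}) \<in> I"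
  shows "cell_augmentation X l ` cell_chains W X 0 \<subseteq> I"
proof clarify
  fix c :: "'a set \<Rightarrow> 'k mpol" assume c: "c \<in> cell_chains W X 0"
  show "cell_augmentation X l c \<in> I"
    unfolding cell_augmentation_def
  proof (rule ideal_sum[OF I], clarify)
    fix F assume "F \<in> X" "aff_dim F = 0"
    then have "monomial_poly (l F) \<in> I" using v by (auto simp: aff_dim_eq_0)
    moreover have "c F \<in> carrier (polyring W)" using c by (auto simp: cell_chains_def)
    ultimately show "monomial_poly (l F) * c F \<in> I" using ideal.I_r_closed[OF I] by fastforce
  qed
qed

lemma label_in_augmentation:
  assumes "{x} \<in> X"
  shows "monomial_poly (l {x}) \<in> cell_augmentation X l ` (cell_chains W X 0 :: ('a set \<Rightarrow> 'k::field mpol) set)"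
proof (rule image_eqI)
  let ?c = "\<lambda>F. if F = {x} then 1 else 0 :: 'k mpol"
  show "?c \<in> cell_chains W X 0" using assms by (auto simp: cell_chains_def polyring_one polyring_closed)
  have "cell_augmentation X l ?c = (\<Sum>F | F \<in> X \<and> aff_dim F = 0. if F = {x} then monomial_poly (l {x}) else 0)"
    unfolding cell_augmentation_def by (intro sum.cong) auto
  also have "\<dots> = monomial_poly (l {x})" using assms finite_X by (subst sum.delta) auto
  finally show "monomial_poly (l {x}) = cell_augmentation X l ?c" by simp
qed

lemma cell_chains_add:
  assumes "c \<in> cell_chains W X d" "c' \<in> cell_chains W X d"
  shows "(\<lambda>F. c F + c' F) \<in> cell_chains W X d"
  unfolding cell_chains_def mem_Collect_eq
proof (rule conjI; rule allI)
  fix F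
  show "c F + c' F \<in> carrier (polyring W)"
    using assms by (intro polyring_closed) (simp_all add: cell_chains_def)
  have "c F \<noteq> 0 \<or> c' F \<noteq> 0" if "c F + c' F \<noteq> 0" using that by auto
  then show "c F + c' F \<noteq> 0 \<longrightarrow> F \<in> X \<and> F \<noteq> {} \<and> aff_dim F = int d"
    using assms unfolding cell_chains_def by blast
qed

lemma cell_chains_mult:
  assumes "c \<in> cell_chains W X d" "r \<in> carrier (polyring W)"
  shows "(\<lambda>F. r * c F) \<in> cell_chains W X d"
  unfolding cell_chains_def mem_Collect_eq
proof (rule conjI; rule allI)
  fix F
  show "r * c F \<in> carrier (polyring W)"
    using assms by (intro polyring_closed) (simp_all add: cell_chains_def)
  have "c F \<noteq> 0" if "r * c F \<noteq> 0" using that by auto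
  then show "r * c F \<noteq> 0 \<longrightarrow> F \<in> X \<and> F \<noteq> {} \<and> aff_dim F = int d"
    using assms(1) unfolding cell_chains_def by blast
qed

lemma ideal_augmentation: "ideal (cell_augmentation X l ` (cell_chains W X 0 :: ('a set \<Rightarrow> 'k::field mpol) set)) (polyring W)"
  (is "ideal ?A _")
proof -
  interpret R: ring "polyring W :: 'k mpol ring" by (rule ring_polyring)
  have add: "x + y \<in> ?A" if "x \<in> ?A" "y \<in> ?A" for x y
  proof -
    obtain c c' :: "'a set \<Rightarrow> 'k mpol" where c: "c \<in> cell_chains W X 0" "x = cell_augmentation X l c"
      "c' \<in> cell_chains W X 0" "y = cell_augmentation X l c'" using \<open>x \<in> ?A\<close> \<open>y \<in> ?A\<close> by blast
    then have "(\<lambda>F. c F + c' F) \<in> cell_chains W X 0" by (intro cell_chains_add)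
    moreover have "cell_augmentation X l (\<lambda>F. c F + c' F) = x + y"
      by (simp add: c cell_augmentation_def algebra_simps sum.distrib)
    ultimately show ?thesis by force
  qed
  have mult: "r * x \<in> ?A" if "x \<in> ?A" "r \<in> carrier (polyring W)" for x r
  proof -
    obtain c :: "'a set \<Rightarrow> 'k mpol" where c: "c \<in> cell_chains W X 0" "x = cell_augmentation X l c" using \<open>x \<in> ?A\<close> by blast
    then have "(\<lambda>F. r * c F) \<in> cell_chains W X 0" using that(2) by (intro cell_chains_mult)
    moreover have "cell_augmentation X l (\<lambda>F. r * c F) = r * x"
      by (simp add: c cell_augmentation_def algebra_simps sum_distrib_left)
    ultimately show ?thesis by force
  qed
  have carr: "?A \<subseteq> carrier (polyring W)"
    using monomial_poly_label by (intro augmentation_subset R.oneideal)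
  have zero: "0 \<in> ?A"
    by (rule image_eqI[of _ _ "\<lambda>_. 0"]) (auto simp: cell_augmentation_def cell_chains_def polyring_closed)
  show ?thesis
  proof (rule idealI[OF ring_polyring])
    show "subgroup ?A (add_monoid (polyring W))"
    proof (rule subgroup.intro)
      fix x assume x: "x \<in> ?A"
      have "\<ominus>\<^bsub>polyring W\<^esub> x = (\<ominus>\<^bsub>polyring W\<^esub> \<one>\<^bsub>polyring W\<^esub>) \<otimes>\<^bsub>polyring W\<^esub> x"
        using x carr by (subst R.l_minus) (auto simp: polyring_one)
      also have "\<dots> \<in> ?A" using mult[OF x, of "\<ominus>\<^bsub>polyring W\<^esub> \<one>\<^bsub>polyring W\<^esub>"] by (simp add: polyring_one)
      finally show "inv\<^bsub>add_monoid (polyring W)\<^esub> x \<in> ?A" by (simp add: a_inv_def)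
    qed (use carr add zero in auto)
  qed (use mult in \<open>auto simp: mult.commute\<close>)
qed

end

lemma edge_generators_carrier:
  assumes "d_graph d W E" "finite W"
  shows "{\<Prod>v\<in>e. var v | e. e \<in> E} \<subseteq> carrier (polyring W :: 'k::field mpol ring)"
proof clarify
  fix e assume "e \<in> E"
  then have "e \<subseteq> W" using assms(1) by (auto simp: d_graph_def)
  then show "(\<Prod>v\<in>e. var v :: 'k mpol) \<in> carrier (polyring W)"
  proof (induction e rule: infinite_finite_induct)
    case (insert v e)
    then have "(var v :: 'k mpol) \<in> carrier (polyring W)"
      unfolding var_def monomial_poly_def by (intro polyring_closed) auto
    then show ?case using insert by (simp add: polyring_closed)
  qed (auto simp: polyring_one)
qed

section \<open>Vertices of a join\<close>

context oriented_join
begin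

lemma join_cell_vertex: "join_cell ((\<lambda>_. {})(i := {x})) = {join_embed i x}"
proof -
  have "(\<Union>j. join_embed j ` ((\<lambda>_. {})(i := {x})) j) = {join_embed i x}" by (auto split: if_splits)
  then show ?thesis by (simp add: join_cell_def)
qed

text \<open>A vertex is the join of its traces on the factors, and these cannot all be empty; hence
  it is an embedded point, whose trace is a vertex of a factor. Conversely, a vertex of a factor
  joined with empty cells is a face of the join.\<close>

lemma vertex_of_join_iff:
  assumes "\<And>j. \<sigma> j \<in> X j"
  shows "{v} face_of join_cell \<sigma> \<longleftrightarrow> (\<exists>i x. v = join_embed i x \<and> {x} face_of \<sigma> i)"
proof
  have cv: "convex (\<sigma> j)" for j using cell_convex[OF assms] .
  assume f: "{v} face_of join_cell \<sigma>"
  have eq: "{v} = join_cell (\<lambda>i. join_embed i -` {v})" by (rule face_of_join_cell[OF cv f])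
  have "\<exists>i x. v = join_embed i x"
  proof (rule ccontr)
    assume "\<not> ?thesis"
    then have "(\<lambda>i :: 'n. join_embed i -` {v}) = (\<lambda>i. {})" by (intro ext) auto
    then show False using eq by (simp add: join_cell_empty)
  qed
  then obtain i x where v: "v = join_embed i x" by blast
  then have "join_embed i -` {v} = {x}" by (auto simp: join_embed_inj)
  then have "{x} face_of \<sigma> i" using vimage_face[OF cv f, of i] by simp
  then show "\<exists>i x. v = join_embed i x \<and> {x} face_of \<sigma> i" using v by blast
next
  have cv: "convex (\<sigma> j)" for j using cell_convex[OF assms] .
  assume "\<exists>i x. v = join_embed i x \<and> {x} face_of \<sigma> i"
  then obtain i x where v: "v = join_embed i x" and x: "{x} face_of \<sigma> i" by blast
  have "join_cell ((\<lambda>_. {})(i := {x})) face_of join_cell \<sigma>"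
    by (rule join_cell_face[OF cv]) (use x in auto)
  then show "{v} face_of join_cell \<sigma>" by (simp add: v join_cell_vertex)
qed

end

section \<open>Joins of cellular resolutions\<close>

theorem theorem6p1:
  fixes W :: "int set" and d :: nat
    and H :: "'n::finite \<Rightarrow> int set set"
    and X :: "'n \<Rightarrow> 'a::euclidean_space set set"
    and ori :: "'n \<Rightarrow> 'a set \<Rightarrow> 'a list"
    and l :: "'n \<Rightarrow> 'a set \<Rightarrow> monomial"
    and ori_join :: "(('a \<times> real) ^ 'n) set \<Rightarrow> (('a \<times> real) ^ 'n) list"
    and l_join :: "(('a \<times> real) ^ 'n) set \<Rightarrow> monomial"
  assumes "finite W"
    and "\<And>i. d_graph d W (H i)"
    and "\<And>i. supports_cellular_resolution W (edge_ideal W (H i) :: 'k::field mpol set)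
               (X i) (ori i) (l i)"
    and "\<And>i v. {v} \<in> X i \<Longrightarrow> squarefree_monomial (l i {v})"
    and "orientation (join_complex X) ori_join"
    and "\<And>\<sigma>. (\<And>i. \<sigma> i \<in> X i) \<Longrightarrow> l_join (join_cell \<sigma>) = lcm_monomial {l i (\<sigma> i) | i. True}"
  shows "supports_cellular_resolution W (edge_ideal W (\<Union>i. H i) :: 'k mpol set)
           (join_complex X) ori_join l_join"
proof -
  have lp: "labelled_polyhedral W (X i) (ori i) (l i)" for i
    using assms(3)[of i] by (simp add: supports_cellular_resolution_def labelled_polyhedral_def)
  interpret L: labelled_polyhedral W "X i" "ori i" "l i" for i by (rule lp)
  interpret oriented_join X ori ori_join
    by unfold_locales (use L.complex L.ori assms(5) in auto)
  have aug: "cell_augmentation (X i) (l i) ` cell_chains W (X i) 0 = (edge_ideal W (H i) :: 'k mpol set)"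
    and exact: "L.module_exact i TYPE('k) e" for i e
    using assms(3)[of i] L.supports_iff by blast+
  have mono_dvd_join: "mono_dvd (l_join (join_cell \<sigma>)) m \<longleftrightarrow> (\<forall>i. mono_dvd (l i (\<sigma> i)) m)" if s: "\<And>i. \<sigma> i \<in> X i" for \<sigma> m
    unfolding assms(6)[of \<sigma>, OF s] by (subst mono_dvd_lcm) (auto simp: full_SetCompr_eq)
  \<comment> \<open>The other factors are empty and contribute the unit label to the lcm.\<close>
  have label_vertex: "l_join {join_embed i x} = l i {x}" if x: "{x} \<in> X i" for i x
  proof (rule mono_dvd_eqI)
    fix m
    have "mono_dvd (l_join (join_cell ((\<lambda>_. {})(i := {x})))) m \<longleftrightarrow> (\<forall>j. mono_dvd (l j (((\<lambda>_. {})(i := {x})) j)) m)"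
      by (rule mono_dvd_join) (use x cell_empty in auto)
    also have "\<dots> \<longleftrightarrow> mono_dvd (l i {x}) m" by (auto simp: L.label_empty)
    finally show "mono_dvd (l_join {join_embed i x}) m \<longleftrightarrow> mono_dvd (l i {x}) m" unfolding join_cell_vertex .
  qed
  have vertex_J: "{v} \<in> J \<longleftrightarrow> (\<exists>i x. v = join_embed i x \<and> {x} \<in> X i)" for v
  proof
    assume v: "{v} \<in> J"
    then obtain \<sigma> where s: "{v} = join_cell \<sigma>" "\<And>i. \<sigma> i \<in> X i" by (auto simp: join_complex_def)
    have "{v} face_of join_cell \<sigma>" unfolding s(1)[symmetric] by (simp add: face_of_refl)
    then show "\<exists>i x. v = join_embed i x \<and> {x} \<in> X i"
      unfolding vertex_of_join_iff[of \<sigma>, OF s(2)] using cell_face[OF s(2)] by blast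
  next
    assume "\<exists>i x. v = join_embed i x \<and> {x} \<in> X i"
    then obtain i x where v: "v = join_embed i x" and x: "{x} \<in> X i" by blast
    have "join_cell ((\<lambda>_. {})(i := {x})) \<in> J" by (rule J_I) (use x cell_empty in auto)
    then show "{v} \<in> J" unfolding v join_cell_vertex .
  qed
  have labelled: "labelled_complex W J l_join"
    unfolding labelled_complex_def
  proof (intro conjI allI impI ballI)
    fix v assume "{v} \<in> J"
    then obtain i x where v: "v = join_embed i x" and x: "{x} \<in> X i" unfolding vertex_J by blast
    show "Poly_Mapping.keys (l_join {v}) \<subseteq> W"
      unfolding v label_vertex[OF x] by (rule L.label_keys[OF x])
  next
    fix C assume C: "C \<in> J"
    then obtain \<sigma> where s: "C = join_cell \<sigma>" "\<And>i. \<sigma> i \<in> X i" by (auto simp: join_complex_def)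
    have fin: "finite {l_join {v} | v. {v} face_of C}"
    proof (rule finite_subset)
      show "{l_join {v} | v. {v} face_of C} \<subseteq> l_join ` J" using J_face[OF C] by blast
    qed (simp add: J_finite)
    show "l_join C = lcm_monomial {l_join {v} | v. {v} face_of C}"
    proof (rule mono_dvd_eqI)
      fix m
      have "mono_dvd (l_join C) m \<longleftrightarrow> (\<forall>i x. {x} face_of \<sigma> i \<longrightarrow> mono_dvd (l i {x}) m)"
        unfolding s(1) mono_dvd_join[of \<sigma>, OF s(2)] using L.mono_dvd_label[OF s(2)] by blast
      also have "\<dots> \<longleftrightarrow> (\<forall>i x. {x} face_of \<sigma> i \<longrightarrow> mono_dvd (l_join {join_embed i x}) m)"
        using label_vertex cell_face[OF s(2)] by metis
      also have "\<dots> \<longleftrightarrow> (\<forall>v. {v} face_of C \<longrightarrow> mono_dvd (l_join {v}) m)"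
        unfolding s(1) vertex_of_join_iff[of \<sigma>, OF s(2)] by blast
      also have "\<dots> \<longleftrightarrow> mono_dvd (lcm_monomial {l_join {v} | v. {v} face_of C}) m"
        unfolding mono_dvd_lcm[OF fin] by blast
      finally show "mono_dvd (l_join C) m \<longleftrightarrow> mono_dvd (lcm_monomial {l_join {v} | v. {v} face_of C}) m" .
    qed
  qed
  interpret LJ: labelled_polyhedral W J ori_join l_join
    by unfold_locales (use polyhedral_J assms(5) labelled in auto)
  interpret R: ring "polyring W :: 'k mpol ring" by (rule ring_polyring)
  have gens: "{\<Prod>v\<in>e. var v | e. e \<in> E} \<subseteq> carrier (polyring W :: 'k mpol ring)"
    if "\<And>e. e \<in> E \<Longrightarrow> \<exists>i. e \<in> H i" for E
    using edge_generators_carrier[of d W E] that assms(1,2) unfolding d_graph_def by blast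
  have Idl_J: "ideal (edge_ideal W (\<Union>i. H i) :: 'k mpol set) (polyring W)"
    unfolding edge_ideal_def by (intro R.genideal_ideal gens) blast
  \<comment> \<open>Vertex labels and edges are not matched one by one. Both inclusions use only
    that the vertex labels of \<open>X i\<close> generate the edge ideal of \<open>H i\<close>, and
    that the labelled vertices of the join are those of all the factors.\<close>
  have "cell_augmentation J l_join ` cell_chains W J 0 = (edge_ideal W (\<Union>i. H i) :: 'k mpol set)"
  proof
    show "cell_augmentation J l_join ` cell_chains W J 0 \<subseteq> (edge_ideal W (\<Union>i. H i) :: 'k mpol set)"
    proof (rule LJ.augmentation_subset[OF Idl_J])
      fix v assume "{v} \<in> J"
      then obtain i x where v: "v = join_embed i x" and x: "{x} \<in> X i" unfolding vertex_J by blast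
      have "(monomial_poly (l i {x}) :: 'k mpol) \<in> edge_ideal W (H i)"
        using L.label_in_augmentation[OF x] aug by blast
      also have "edge_ideal W (H i) \<subseteq> (edge_ideal W (\<Union>i. H i) :: 'k mpol set)"
        unfolding edge_ideal_def
        by (rule R.genideal_minimal[OF Idl_J[unfolded edge_ideal_def] order_trans[OF _ R.genideal_self[OF gens]]]) auto
      finally show "(monomial_poly (l_join {v}) :: 'k mpol) \<in> edge_ideal W (\<Union>i. H i)"
        by (simp add: v label_vertex[OF x])
    qed
    show "edge_ideal W (\<Union>i. H i) \<subseteq> cell_augmentation J l_join ` (cell_chains W J 0 :: (_ \<Rightarrow> 'k mpol) set)"
      unfolding edge_ideal_def
    proof (rule R.genideal_minimal[OF LJ.ideal_augmentation], clarify)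
      fix e i assume e: "e \<in> H i"
      have "(\<Prod>v\<in>e. var v :: 'k mpol) \<in> edge_ideal W (H i)"
        unfolding edge_ideal_def by (rule subsetD[OF R.genideal_self[OF gens]]) (use e in auto)
      then have "(\<Prod>v\<in>e. var v :: 'k mpol) \<in> cell_augmentation (X i) (l i) ` cell_chains W (X i) 0"
        unfolding aug .
      also have "\<dots> \<subseteq> cell_augmentation J l_join ` cell_chains W J 0"
      proof (rule L.augmentation_subset[OF LJ.ideal_augmentation])
        fix x assume x: "{x} \<in> X i"
        then have "{join_embed i x} \<in> J" unfolding vertex_J by blast
        from LJ.label_in_augmentation[OF this] label_vertex[OF x]
        show "(monomial_poly (l i {x}) :: 'k mpol) \<in> cell_augmentation J l_join ` cell_chains W J 0" by simp
      qed
      finally show "(\<Prod>v\<in>e. var v :: 'k mpol) \<in> cell_augmentation J l_join ` cell_chains W J 0" .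
    qed
  qed
  moreover have "LJ.module_exact TYPE('k) e" for e
  proof (rule LJ.module_exact_of_scalar_exact)
    fix m :: monomial assume m: "Poly_Mapping.keys m \<subseteq> W"
    have sub: "LJ.below m = join_complex (\<lambda>i. L.below i m)"
    proof (intro equalityI subsetI)
      fix C assume "C \<in> LJ.below m"
      then have C: "C \<in> J" "mono_dvd (l_join C) m" by (simp_all add: LJ.below_def)
      then obtain \<sigma> where s: "C = join_cell \<sigma>" "\<And>i. \<sigma> i \<in> X i" by (auto simp: join_complex_def)
      then have "\<sigma> i \<in> L.below i m" for i using mono_dvd_join[of \<sigma>, OF s(2)] C(2) by (simp add: L.below_def)
      then show "C \<in> join_complex (\<lambda>i. L.below i m)" using s(1) by (auto simp: join_complex_def)
    next
      fix C assume "C \<in> join_complex (\<lambda>i. L.below i m)"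
      then obtain \<sigma> where s: "C = join_cell \<sigma>" "\<And>i. \<sigma> i \<in> L.below i m" by (auto simp: join_complex_def)
      then have X: "\<sigma> i \<in> X i" for i using L.below_subset by blast
      show "C \<in> LJ.below m" using s mono_dvd_join[of \<sigma>, OF X] J_I[of \<sigma>, OF X] by (simp add: LJ.below_def L.below_def)
    qed
    interpret S: oriented_join "\<lambda>i. L.below i m" ori ori_join
      by unfold_locales (use L.polyhedral_below L.orientation_below LJ.orientation_below[of m] sub in auto)
    have "scalar_exact TYPE('k) (L.below i m) (ori i) f" if "f \<ge> 0" for i f
      using L.scalar_exact_of_module_exact[OF exact[of i "nat f"] m] that by simp
    then show "scalar_exact TYPE('k) (LJ.below m) ori_join (int e)" unfolding sub by (rule S.scalar_exact_J) auto
  qed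
  ultimately show ?thesis unfolding LJ.supports_iff by blast
qed

end
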